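(* Let $p$ be a prime, $0<\alpha\le1$, $\beta=\alpha^3-\epsilon$ with $\epsilon>0$, and suppose $\beta\ge\alpha^{C_p}/2$. Then there is an absolute constant $K$ such that: (1) $n_p(\alpha,\beta)\le \mathrm{Tow}\big(p,\log((\alpha-\alpha^3)/\epsilon)+5,1/\epsilon\big)$; (2) if $2^{-8-8C_p}\alpha^3<\beta\le 2^{-8-8C_p}\alpha$, then $n_p(\alpha,\beta)\le \mathrm{Tow}\big(p,\log(\beta/\epsilon)+K(\log p)\log\log_p(\alpha/\beta),1/\epsilon\big)$; (3) if $\beta\le 2^{-8-8C_p}\alpha^3$, then $n_p(\alpha,\beta)\le\mathrm{Tow}\big(p,K(\log p)\log\frac{\log(\alpha/\beta)}{\log(\alpha^3/\beta)},1/\beta\big)$.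
   Context: For a prime $p$, $A\subseteq\mathbb{F}_p^n$ has density $|A|/p^n$; the density of 3-APs in $A$ with common difference $d$ is $p^{-n}|\{x: x,x+d,x+2d\in A\}|$. For $0<\alpha\le1$, $\beta<\alpha^3$, $n_p(\alpha,\beta)$ is the least positive integer $N$ such that for all $n\ge N$ and all $A\subseteq\mathbb{F}_p^n$ of density at least $\alpha$ some nonzero $d$ has 3-AP density at least $\beta$. $\mathrm{Tow}(a,0,r)=r$, $\mathrm{Tow}(a,k+1,r)=a^{\mathrm{Tow}(a,k,r)}$, heights rounded up to integers. Logarithms base 2. $C_p\ge1$ is a constant depending only on $p$ (with $C_p=\Theta(\log p)$) such that for every $m\ge1$ and every $X\subseteq\mathbb{F}_p^m$ with $|X|=xp^m$, the number of pairs $(a,d)\in(\mathbb{F}_p^m)^2$ with $a,a+d,a+2d\in X$ is at least $x^{C_p}p^{2m}$. *)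

theory Defs
  imports "HOL-Computational_Algebra.Primes" Complex_Main
begin

text \<open>Vectors of F_p^n are represented as lists of length n with entries in {0..<p};
  addition is componentwise modulo p.\<close>

definition vecs :: "nat \<Rightarrow> nat \<Rightarrow> nat list set" where
  "vecs p n = {v. length v = n \<and> set v \<subseteq> {0..<p}}"

definition vadd :: "nat \<Rightarrow> nat list \<Rightarrow> nat list \<Rightarrow> nat list" where
  "vadd p x y = map2 (\<lambda>a b. (a + b) mod p) x y"

definition vzero :: "nat \<Rightarrow> nat list" where
  "vzero n = replicate n 0"

definition density :: "nat \<Rightarrow> nat \<Rightarrow> nat list set \<Rightarrow> real" where
  "density p n A = real (card A) / real p ^ n"

definition ap3_density :: "nat \<Rightarrow> nat \<Rightarrow> nat list set \<Rightarrow> nat list \<Rightarrow> real" where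
  "ap3_density p n A d =
     real (card {x \<in> vecs p n. x \<in> A \<and> vadd p x d \<in> A \<and> vadd p (vadd p x d) d \<in> A})
       / real p ^ n"

definition ap3_pairs :: "nat \<Rightarrow> nat \<Rightarrow> nat list set \<Rightarrow> nat" where
  "ap3_pairs p m X = card {(a, d). a \<in> vecs p m \<and> d \<in> vecs p m \<and>
       a \<in> X \<and> vadd p a d \<in> X \<and> vadd p (vadd p a d) d \<in> X}"

definition np_good :: "nat \<Rightarrow> real \<Rightarrow> real \<Rightarrow> nat \<Rightarrow> bool" where
  "np_good p \<alpha> \<beta> N \<longleftrightarrow> N \<ge> 1 \<and>
     (\<forall>n\<ge>N. \<forall>A \<subseteq> vecs p n. density p n A \<ge> \<alpha> \<longrightarrow>
        (\<exists>d \<in> vecs p n. d \<noteq> vzero n \<and> ap3_density p n A d \<ge> \<beta>))"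

definition n_p :: "nat \<Rightarrow> real \<Rightarrow> real \<Rightarrow> nat" where
  "n_p p \<alpha> \<beta> = (LEAST N. np_good p \<alpha> \<beta> N)"

fun tow_nat :: "real \<Rightarrow> nat \<Rightarrow> real \<Rightarrow> real" where
  "tow_nat a 0 r = r"
| "tow_nat a (Suc k) r = a powr (tow_nat a k r)"

text \<open>Tower with real height, rounded up to an integer (negative heights give height 0).\<close>
definition Tow :: "real \<Rightarrow> real \<Rightarrow> real \<Rightarrow> real" where
  "Tow a h r = tow_nat a (nat \<lceil>h\<rceil>) r"

end

theory Submission
  imports Defs "HOL-Library.FuncSet"
begin

text \<open>Rescale the indicator of the given set to a function \<open>f\<close> of mean exactly \<open>\<alpha>\<close>. For a subgroup
  \<open>H\<close> let \<open>b(H)\<close> be the mean of the cubes of the averages of \<open>f\<close> over the cosets of \<open>H\<close>; it lies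
  between \<open>\<alpha>^3\<close> and \<open>\<alpha>\<close>. If no nonzero difference is popular, the progressions with difference in
  \<open>H\<close> have density at most about \<open>\<beta>\<close>. Passing to the subgroup \<open>K\<close> of \<open>H\<close> that annihilates the large
  spectrum of \<open>f\<close> on every coset of \<open>H\<close>, which costs one exponential in the codimension, the same
  holds for the average \<open>g\<close> of \<open>f\<close> over \<open>K\<close>. Two inequalities on each coset then force \<open>b\<close> to grow.
  Schur's inequality gives \<open>b(K) + \<beta> \<ge> 2 b(H)\<close>, so the excess over \<open>\<beta>\<close> doubles, and the counting
  hypothesis applied to the level set where \<open>g\<close> exceeds half its mean gives
  \<open>b(K) \<ge> D b(H) - 8 D (8 D)^(C/2) \<beta>\<close> for every \<open>D > 0\<close>; optimising \<open>D\<close>, the logarithm of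
  \<open>b / \<beta>\<close> grows by the factor \<open>1 + 1 / C\<close>. Since \<open>b \<le> \<alpha>\<close>, counting the steps gives the tower heights.
  For \<open>p = 2\<close> a plain average over the differences suffices.\<close>

subsection \<open>Fourier analysis on a finite group with characters\<close>

text \<open>Codimension is measured only through the index \<open>card V / card H\<close>, so
  subgroups need neither bases nor dimensions. Each refinement wastes \<open>2 * \<delta>\<close> on
  top of \<beta>: one \<delta> for the zero difference, which counts fully but is only one of
  \<open>card H\<close> differences, the other for replacing f by its coset averages. Keeping
  \<open>card H\<close> large is what forces n up to the size of the tower. Doubling serves while b
  is within a factor \<open>2 powr (8 + 8 * C)\<close> of \<beta>; beyond that the counting
  inequality is the faster one. The middle range of \<beta> uses both in turn. One K has to serve
  all primes, so additive constants in the number of steps must be swallowed by the height itself.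
  In the middle range this works because log_p(\<alpha>/\<beta>) is at least 8, which rests on C
  being at least log p with constant one; that bound is extracted from the counting hypothesis by
  testing it on a progression-free piece of a sphere. For the smallest \<beta> it works because
  \<beta> is at least half of \<alpha>^C, which keeps the ratio of logarithms at 1 + 1 / C or
  more.\<close>

lemma sum_product3:
  fixes a :: "'a \<Rightarrow> 'd::comm_ring_1"
  shows "sum a A * sum b B * sum c C = (\<Sum>x\<in>A. \<Sum>y\<in>B. \<Sum>z\<in>C. a x * b y * c z)"
  by (subst sum_product, simp only: sum_distrib_right, simp only: sum_distrib_left)

text \<open>The pairing \<open>e\<close> is symmetric and identifies the group with its dual, so
  frequencies are elements of V and \<open>r \<oplus> r\<close> makes sense for them.
  \<open>orth\<close> is the completeness of these characters, and \<open>double_zero\<close>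
  excludes elements of order two.\<close>

locale char_group =
  fixes V :: "'a set" and add :: "'a \<Rightarrow> 'a \<Rightarrow> 'a" (infixl "\<oplus>" 65)
    and zero :: 'a ("\<zero>") and neg :: "'a \<Rightarrow> 'a"
    and e :: "'a \<Rightarrow> 'a \<Rightarrow> complex" and p :: nat
  assumes finite_V: "finite V"
    and add_closed: "x \<in> V \<Longrightarrow> y \<in> V \<Longrightarrow> x \<oplus> y \<in> V"
    and add_assoc: "x \<oplus> y \<oplus> z = x \<oplus> (y \<oplus> z)"
    and add_comm: "x \<oplus> y = y \<oplus> x"
    and zero_V: "\<zero> \<in> V"
    and add_zero: "x \<in> V \<Longrightarrow> x \<oplus> \<zero> = x"
    and neg_V: "x \<in> V \<Longrightarrow> neg x \<in> V"
    and add_neg: "x \<in> V \<Longrightarrow> x \<oplus> neg x = \<zero>"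
    and e_add: "r \<in> V \<Longrightarrow> x \<in> V \<Longrightarrow> y \<in> V \<Longrightarrow> e r (x \<oplus> y) = e r x * e r y"
    and e_sym: "r \<in> V \<Longrightarrow> x \<in> V \<Longrightarrow> e r x = e x r"
    and norm_e: "r \<in> V \<Longrightarrow> x \<in> V \<Longrightarrow> cmod (e r x) = 1"
    and e_power: "r \<in> V \<Longrightarrow> x \<in> V \<Longrightarrow> e r x ^ p = 1"
    and p_pos: "p > 0"
    and orth: "x \<in> V \<Longrightarrow> x \<noteq> \<zero> \<Longrightarrow> (\<Sum>r\<in>V. e r x) = 0"
    and double_zero: "x \<in> V \<Longrightarrow> x \<oplus> x = \<zero> \<Longrightarrow> x = \<zero>"
begin

lemma add_left_comm: "x \<oplus> (y \<oplus> z) = y \<oplus> (x \<oplus> z)"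
  by (metis add_assoc add_comm)

lemmas add_ac = add_assoc add_comm add_left_comm

lemma zero_add: "x \<in> V \<Longrightarrow> \<zero> \<oplus> x = x"
  using add_zero add_comm by metis

lemma add_cancel: "a \<in> V \<Longrightarrow> x \<in> V \<Longrightarrow> y \<in> V \<Longrightarrow> a \<oplus> x = a \<oplus> y \<longleftrightarrow> x = y"
  by (metis add_assoc add_comm add_neg add_zero)

lemma neg_add_cancel: "a \<in> V \<Longrightarrow> x \<in> V \<Longrightarrow> neg a \<oplus> (a \<oplus> x) = x"
  by (metis add_assoc add_comm add_neg add_zero)

lemma add_neg_cancel: "a \<in> V \<Longrightarrow> x \<in> V \<Longrightarrow> a \<oplus> (neg a \<oplus> x) = x"
  by (metis add_assoc add_neg zero_add)

lemma card_V_pos: "card V > 0"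
  using finite_V zero_V card_gt_0_iff by blast

lemma e_zero: "r \<in> V \<Longrightarrow> e r \<zero> = 1"
proof -
  assume r: "r \<in> V"
  have "e r \<zero> = e r \<zero> * e r \<zero>" using e_add[OF r zero_V zero_V] add_zero[OF zero_V] by simp
  moreover have "e r \<zero> \<noteq> 0" using norm_e[OF r zero_V] by auto
  ultimately show ?thesis by simp
qed

lemma e_neg: "r \<in> V \<Longrightarrow> x \<in> V \<Longrightarrow> e r (neg x) = cnj (e r x)"
proof -
  assume r: "r \<in> V" and x: "x \<in> V"
  have "e r x * e r (neg x) = 1" using e_add[OF r x neg_V[OF x]] add_neg[OF x] e_zero[OF r] by simp
  moreover have "e r x * cnj (e r x) = 1" using norm_e[OF r x] by (simp add: complex_norm_square[symmetric])
  ultimately show ?thesis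
    by (metis mult_cancel_left mult_zero_left zero_neq_one)
qed

lemma sum_e: "x \<in> V \<Longrightarrow> (\<Sum>r\<in>V. e r x) = (if x = \<zero> then of_nat (card V) else 0)"
  using orth e_zero by auto

section \<open>Subgroups, translations and doubling\<close>

definition subgrp :: "'a set \<Rightarrow> bool" where
  "subgrp H \<longleftrightarrow> H \<subseteq> V \<and> \<zero> \<in> H \<and> (\<forall>x\<in>H. \<forall>y\<in>H. x \<oplus> y \<in> H) \<and> (\<forall>x\<in>H. neg x \<in> H)"

lemma subgrp_V: "subgrp V"
  by (auto simp: subgrp_def zero_V add_closed neg_V)

lemma
  assumes "subgrp H"
  shows subgrp_in_V: "x \<in> H \<Longrightarrow> x \<in> V" and subgrp_zero: "\<zero> \<in> H"
    and subgrp_add: "x \<in> H \<Longrightarrow> y \<in> H \<Longrightarrow> x \<oplus> y \<in> H"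
    and subgrp_neg: "x \<in> H \<Longrightarrow> neg x \<in> H"
    and subgrp_finite: "finite H" and subgrp_card_pos: "card H > 0"
  using assms finite_V unfolding subgrp_def
  by (auto intro: finite_subset simp: card_gt_0_iff)

lemma bij_translate: 
  assumes "subgrp H" "a \<in> H" shows "bij_betw (\<lambda>x. a \<oplus> x) H H"
proof (rule bij_betw_byWitness[where f' = "\<lambda>x. neg a \<oplus> x"])
qed (use assms in \<open>auto simp: neg_add_cancel add_neg_cancel subgrp_in_V subgrp_add subgrp_neg\<close>)

lemma sum_translate:
  assumes "subgrp H" "a \<in> H" shows "(\<Sum>x\<in>H. F (a \<oplus> x)) = (\<Sum>x\<in>H. F x)"
  by (rule sum.reindex_bij_betw[OF bij_translate[OF assms]])

lemma sum_translate':
  assumes "subgrp H" "a \<in> H" shows "(\<Sum>x\<in>H. F (x \<oplus> a)) = (\<Sum>x\<in>H. F x)"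
  using sum_translate[OF assms, of F] by (simp add: add_comm)

text \<open>If 2x = 2y then x - y doubles to zero, hence is zero; finiteness gives surjectivity.
  Consequently any two points of a random progression in H are independent and uniform.\<close>

lemma bij_double:
  assumes "subgrp H" shows "bij_betw (\<lambda>x. x \<oplus> x) H H"
proof -
  have "inj_on (\<lambda>x. x \<oplus> x) H"
  proof (rule inj_onI)
    fix x y assume xy: "x \<in> H" "y \<in> H" "x \<oplus> x = y \<oplus> y"
    have v: "x \<in> V" "y \<in> V" "neg y \<in> V" using xy assms subgrp_in_V neg_V by auto
    have "(x \<oplus> neg y) \<oplus> (x \<oplus> neg y) = (x \<oplus> x) \<oplus> (neg y \<oplus> neg y)" by (simp add: add_ac)
    also have "\<dots> = (y \<oplus> neg y) \<oplus> (y \<oplus> neg y)" unfolding xy(3) by (simp add: add_ac)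
    also have "\<dots> = \<zero>" using v by (simp add: add_neg add_zero zero_V)
    finally have "x \<oplus> neg y = \<zero>" using double_zero v add_closed by blast
    thus "x = y" by (metis add_cancel add_comm add_neg v)
  qed
  moreover have "(\<lambda>x. x \<oplus> x) ` H \<subseteq> H" using assms subgrp_add by auto
  ultimately show ?thesis
    by (metis assms bij_betw_def endo_inj_surj subgrp_finite)
qed

lemma sum_double:
  assumes "subgrp H" shows "(\<Sum>x\<in>H. F (x \<oplus> x)) = (\<Sum>x\<in>H. F x)"
  by (rule sum.reindex_bij_betw[OF bij_double[OF assms]])

section \<open>Fourier transform and the progression form\<close>

definition ft :: "'a set \<Rightarrow> ('a \<Rightarrow> real) \<Rightarrow> 'a \<Rightarrow> complex" where
  "ft H u r = (\<Sum>x\<in>H. of_real (u x) * e r x)"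

definition ap_form :: "'a set \<Rightarrow> ('a \<Rightarrow> real) \<Rightarrow> ('a \<Rightarrow> real) \<Rightarrow> ('a \<Rightarrow> real) \<Rightarrow> real" where
  "ap_form H u v w = (\<Sum>x\<in>H. \<Sum>d\<in>H. u x * v (x \<oplus> d) * w (x \<oplus> d \<oplus> d))"

lemma cnj_ft:
  assumes "subgrp H" "r \<in> V"
  shows "cnj (ft H u r) = (\<Sum>x\<in>H. of_real (u x) * e r (neg x))"
  unfolding ft_def using assms by (auto simp: e_neg subgrp_in_V intro!: sum.cong)

text \<open>Frequencies range over all of V although u is summed over H. Each character of H is met
  \<open>card V / card H\<close> times, which explains the factor \<open>card V\<close> and avoids
  any description of the dual of H.\<close>

lemma parseval:
  assumes H: "subgrp H"
  shows "(\<Sum>r\<in>V. (cmod (ft H u r))\<^sup>2) = real (card V) * (\<Sum>x\<in>H. (u x :: real)\<^sup>2)"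
proof -
  have "complex_of_real (\<Sum>r\<in>V. (cmod (ft H u r))\<^sup>2) = (\<Sum>r\<in>V. ft H u r * cnj (ft H u r))"
    by (simp only: complex_norm_square of_real_sum)
  also have "\<dots> = (\<Sum>r\<in>V. \<Sum>x\<in>H. \<Sum>y\<in>H. of_real (u x * u y) * e r (x \<oplus> neg y))"
  proof (rule sum.cong[OF refl])
    fix r assume r: "r \<in> V"
    show "ft H u r * cnj (ft H u r) = (\<Sum>x\<in>H. \<Sum>y\<in>H. of_real (u x * u y) * e r (x \<oplus> neg y))"
      unfolding cnj_ft[OF H r] unfolding ft_def sum_product
      using r H by (auto intro!: sum.cong simp: e_add subgrp_in_V neg_V)
  qed
  also have "\<dots> = (\<Sum>x\<in>H. \<Sum>y\<in>H. \<Sum>r\<in>V. of_real (u x * u y) * e r (x \<oplus> neg y))"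
    by (subst sum.swap, rule sum.cong[OF refl], subst sum.swap, rule refl)
  also have "\<dots> = (\<Sum>x\<in>H. \<Sum>y\<in>H. if y = x then of_real (u x * u x) * of_nat (card V) else 0)"
  proof (intro sum.cong refl)
    fix x y assume xy: "x \<in> H" "y \<in> H"
    then have v: "x \<in> V" "y \<in> V" using H subgrp_in_V by auto
    have "(\<Sum>r\<in>V. of_real (u x * u y) * e r (x \<oplus> neg y)) = of_real (u x * u y) * (\<Sum>r\<in>V. e r (x \<oplus> neg y))"
      by (simp add: sum_distrib_left)
    also have "(\<Sum>r\<in>V. e r (x \<oplus> neg y)) = (if x \<oplus> neg y = \<zero> then of_nat (card V) else 0)"
      using v by (intro sum_e) (auto simp: add_closed neg_V)
    also have "x \<oplus> neg y = \<zero> \<longleftrightarrow> y = x"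
      by (metis add_cancel add_comm add_neg neg_V v)
    finally show "(\<Sum>r\<in>V. of_real (u x * u y) * e r (x \<oplus> neg y)) = (if y = x then of_real (u x * u x) * of_nat (card V) else 0)"
      by auto
  qed
  also have "\<dots> = of_real (card V * (\<Sum>x\<in>H. (u x)\<^sup>2))"
    using subgrp_finite[OF H] by (simp add: sum_distrib_left power2_eq_square algebra_simps)
  finally show ?thesis using of_real_eq_iff by blast
qed

text \<open>Three points x, y, z form a progression exactly when x - 2y + z = 0, and averaging
  characters detects this. The conjugated coefficient at \<open>r \<oplus> r\<close> is the
  frequency -2r attached to the middle point.\<close>

lemma ap_form_fourier:
  assumes H: "subgrp H"
  shows "complex_of_real (real (card V) * ap_form H u v w) = (\<Sum>r\<in>V. ft H u r * cnj (ft H v (r \<oplus> r)) * ft H w r)"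
proof -
  have "(\<Sum>r\<in>V. ft H u r * cnj (ft H v (r \<oplus> r)) * ft H w r)
     = (\<Sum>r\<in>V. \<Sum>x\<in>H. \<Sum>y\<in>H. \<Sum>z\<in>H. of_real (u x * v y * w z) * e r (x \<oplus> (neg y \<oplus> neg y) \<oplus> z))"
  proof (rule sum.cong[OF refl])
    fix r assume r: "r \<in> V"
    have e2: "e (r \<oplus> r) (neg y) = e r (neg y \<oplus> neg y)" if "y \<in> H" for y
    proof -
      have y: "neg y \<in> V" using that H subgrp_in_V neg_V by auto
      have "e (r \<oplus> r) (neg y) = e (neg y) (r \<oplus> r)" using y r e_sym add_closed by blast
      also have "\<dots> = e (neg y) r * e (neg y) r" using y r e_add by simp
      also have "\<dots> = e r (neg y \<oplus> neg y)" using y r e_add e_sym by simp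
      finally show ?thesis .
    qed
    have c: "cnj (ft H v (r \<oplus> r)) = (\<Sum>y\<in>H. of_real (v y) * e r (neg y \<oplus> neg y))"
      unfolding cnj_ft[OF H add_closed[OF r r]] using e2 by auto
    show "ft H u r * cnj (ft H v (r \<oplus> r)) * ft H w r = (\<Sum>x\<in>H. \<Sum>y\<in>H. \<Sum>z\<in>H. of_real (u x * v y * w z) * e r (x \<oplus> (neg y \<oplus> neg y) \<oplus> z))"
      unfolding c unfolding ft_def sum_product3
      using r H by (auto intro!: sum.cong simp: e_add subgrp_in_V neg_V add_closed)
  qed
  also have "\<dots> = (\<Sum>x\<in>H. \<Sum>y\<in>H. \<Sum>z\<in>H. \<Sum>r\<in>V. of_real (u x * v y * w z) * e r (x \<oplus> (neg y \<oplus> neg y) \<oplus> z))"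
    apply (subst sum.swap, rule sum.cong[OF refl])
    apply (subst sum.swap, rule sum.cong[OF refl])
    apply (subst sum.swap, rule refl)
    done
  \<comment> \<open>Substitute y = x + d, so that the condition on z becomes z = x + 2d.\<close>
  also have "\<dots> = (\<Sum>x\<in>H. \<Sum>d\<in>H. \<Sum>z\<in>H. \<Sum>r\<in>V. of_real (u x * v (x \<oplus> d) * w z) * e r (x \<oplus> (neg (x \<oplus> d) \<oplus> neg (x \<oplus> d)) \<oplus> z))"
    by (rule sum.cong[OF refl], rule sum_translate[OF H, symmetric])
  also have "\<dots> = (\<Sum>x\<in>H. \<Sum>d\<in>H. \<Sum>z\<in>H. if z = x \<oplus> d \<oplus> d then of_real (u x * v (x \<oplus> d) * w (x \<oplus> d \<oplus> d)) * of_nat (card V) else 0)"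
  proof (intro sum.cong refl)
    fix x d z assume xy: "x \<in> H" "d \<in> H" "z \<in> H"
    then have v: "x \<in> V" "d \<in> V" "z \<in> V" using H subgrp_in_V by auto
    let ?y = "x \<oplus> d"
    have yv: "?y \<in> V" "neg ?y \<in> V" using v add_closed neg_V by auto
    have "(\<Sum>r\<in>V. of_real (u x * v ?y * w z) * e r (x \<oplus> (neg ?y \<oplus> neg ?y) \<oplus> z)) 
      = of_real (u x * v ?y * w z) * (\<Sum>r\<in>V. e r (x \<oplus> (neg ?y \<oplus> neg ?y) \<oplus> z))"
      by (simp add: sum_distrib_left)
    also have "(\<Sum>r\<in>V. e r (x \<oplus> (neg ?y \<oplus> neg ?y) \<oplus> z)) = (if x \<oplus> (neg ?y \<oplus> neg ?y) \<oplus> z = \<zero> then of_nat (card V) else 0)"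
      using v yv by (intro sum_e) (auto simp: add_closed neg_V)
    also have "x \<oplus> (neg ?y \<oplus> neg ?y) \<oplus> z = \<zero> \<longleftrightarrow> z = x \<oplus> d \<oplus> d"
    proof -
      let ?k = "x \<oplus> (neg ?y \<oplus> neg ?y)"
      have kv: "?k \<in> V" using v yv add_closed by auto
      have "?k \<oplus> (x \<oplus> d \<oplus> d) = (?y \<oplus> neg ?y) \<oplus> (?y \<oplus> neg ?y)"
        by (simp add: add_ac)
      also have "\<dots> = \<zero>" using yv add_neg add_zero zero_V by simp
      finally show ?thesis using add_cancel[OF kv v(3), of "x \<oplus> d \<oplus> d"] v add_closed by metis
    qed
    finally show "(\<Sum>r\<in>V. of_real (u x * v ?y * w z) * e r (x \<oplus> (neg ?y \<oplus> neg ?y) \<oplus> z)) 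
      = (if z = x \<oplus> d \<oplus> d then of_real (u x * v (x \<oplus> d) * w (x \<oplus> d \<oplus> d)) * of_nat (card V) else 0)"
      by auto
  qed
  also have "\<dots> = (\<Sum>x\<in>H. \<Sum>d\<in>H. of_real (u x * v (x \<oplus> d) * w (x \<oplus> d \<oplus> d)) * of_nat (card V))"
    using H subgrp_add by (intro sum.cong refl) (simp add: subgrp_finite)
  also have "\<dots> = complex_of_real (real (card V) * ap_form H u v w)"
    by (simp add: ap_form_def sum_distrib_left mult.commute)
  finally show ?thesis by simp
qed

lemma parseval_le:
  assumes H: "subgrp H" and u: "\<And>x. x \<in> H \<Longrightarrow> 0 \<le> u x \<and> u x \<le> 1"
  shows "(\<Sum>r\<in>V. (cmod (ft H u r))\<^sup>2) \<le> real (card V) * real (card H)"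
    and "(\<Sum>r\<in>V. (cmod (ft H u (r \<oplus> r)))\<^sup>2) \<le> real (card V) * real (card H)"
proof -
  have "(\<Sum>x\<in>H. (u x)\<^sup>2) \<le> (\<Sum>x\<in>H. 1 :: real)"
    using u by (intro sum_mono) (simp add: power_le_one)
  then show 1: "(\<Sum>r\<in>V. (cmod (ft H u r))\<^sup>2) \<le> real (card V) * real (card H)"
    unfolding parseval[OF H] by (simp add: mult_left_mono)
  show "(\<Sum>r\<in>V. (cmod (ft H u (r \<oplus> r)))\<^sup>2) \<le> real (card V) * real (card H)"
    using 1 sum_double[OF subgrp_V, of "\<lambda>r. (cmod (ft H u r))\<^sup>2"] by simp
qed

text \<open>The uniform bound is spent on one factor. The other two are separated by AM-GM, which is
  as good as Cauchy-Schwarz here since both have the same bound Q.\<close>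

lemma sum_three_bound:
  fixes a b c :: "'b \<Rightarrow> real"
  assumes "\<And>r. r \<in> S \<Longrightarrow> 0 \<le> a r \<and> a r \<le> B" "0 \<le> B"
    "\<And>r. r \<in> S \<Longrightarrow> 0 \<le> b r" "\<And>r. r \<in> S \<Longrightarrow> 0 \<le> c r"
    "(\<Sum>r\<in>S. (b r)\<^sup>2) \<le> Q" "(\<Sum>r\<in>S. (c r)\<^sup>2) \<le> Q"
  shows "(\<Sum>r\<in>S. a r * b r * c r) \<le> B * Q"
proof -
  have "(\<Sum>r\<in>S. a r * b r * c r) \<le> (\<Sum>r\<in>S. B * (((b r)\<^sup>2 + (c r)\<^sup>2) / 2))"
  proof (rule sum_mono)
    fix r assume r: "r \<in> S"
    have "b r * c r \<le> ((b r)\<^sup>2 + (c r)\<^sup>2) / 2" using sum_squares_bound[of "b r" "c r"] by simp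
    then have "a r * (b r * c r) \<le> B * (((b r)\<^sup>2 + (c r)\<^sup>2) / 2)"
      using assms(1-4) r by (intro mult_mono) auto
    then show "a r * b r * c r \<le> B * (((b r)\<^sup>2 + (c r)\<^sup>2) / 2)" by (simp add: mult.assoc)
  qed
  also have "\<dots> = B * (((\<Sum>r\<in>S. (b r)\<^sup>2) + (\<Sum>r\<in>S. (c r)\<^sup>2)) / 2)"
    by (simp add: sum_distrib_left[symmetric] sum.distrib[symmetric] sum_divide_distrib[symmetric])
  also have "\<dots> \<le> B * Q" using assms by (intro mult_left_mono) auto
  finally show ?thesis .
qed

lemma ap_form_bounds:
  assumes H: "subgrp H" and h: "\<And>r. r \<in> V \<Longrightarrow> cmod (ft H h r) \<le> B"
    and u: "\<And>x. x \<in> H \<Longrightarrow> 0 \<le> u x \<and> u x \<le> 1" and v: "\<And>x. x \<in> H \<Longrightarrow> 0 \<le> v x \<and> v x \<le> 1"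
  shows "\<bar>ap_form H h u v\<bar> \<le> B * card H" "\<bar>ap_form H u h v\<bar> \<le> B * card H" "\<bar>ap_form H u v h\<bar> \<le> B * card H"
proof -
  have B: "0 \<le> B" using h[OF zero_V] norm_ge_zero order_trans by blast
  have n: "real (card V) * \<bar>ap_form H a b c\<bar> \<le> (\<Sum>r\<in>V. cmod (ft H a r) * cmod (ft H b (r \<oplus> r)) * cmod (ft H c r))" for a b c
  proof -
    have "real (card V) * \<bar>ap_form H a b c\<bar> = cmod (complex_of_real (real (card V) * ap_form H a b c))" by (simp add: abs_mult norm_mult del: of_real_mult)
    also have "\<dots> \<le> (\<Sum>r\<in>V. cmod (ft H a r) * cmod (ft H b (r \<oplus> r)) * cmod (ft H c r))"
      unfolding ap_form_fourier[OF H] by (rule order_trans[OF norm_sum]) (simp add: norm_mult)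
    finally show ?thesis .
  qed
  have k: "\<bar>t\<bar> \<le> B * card H" if "real (card V) * \<bar>t\<bar> \<le> B * (real (card V) * real (card H))" for t :: real
    using that card_V_pos by (simp add: mult.left_commute)
  have "(\<Sum>r\<in>V. cmod (ft H h r) * cmod (ft H u (r \<oplus> r)) * cmod (ft H v r)) \<le> B * (real (card V) * real (card H))"
    using h parseval_le[OF H u] parseval_le[OF H v] B by (intro sum_three_bound) auto
  then show "\<bar>ap_form H h u v\<bar> \<le> B * card H" using n k order_trans by blast
  \<comment> \<open>With h in the middle its coefficient is taken at 2r, where the uniform bound
    applies as well; in the other two cases Parseval is used along 2r.\<close>
  have "(\<Sum>r\<in>V. cmod (ft H h (r \<oplus> r)) * cmod (ft H u r) * cmod (ft H v r)) \<le> B * (real (card V) * real (card H))"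
    using h parseval_le[OF H u] parseval_le[OF H v] B add_closed by (intro sum_three_bound) auto
  then show "\<bar>ap_form H u h v\<bar> \<le> B * card H" using k[OF order_trans[OF n]] by (simp add: ac_simps)
  have "(\<Sum>r\<in>V. cmod (ft H h r) * cmod (ft H v (r \<oplus> r)) * cmod (ft H u r)) \<le> B * (real (card V) * real (card H))"
    using h parseval_le[OF H u] parseval_le[OF H v] B by (intro sum_three_bound) auto
  then show "\<bar>ap_form H u v h\<bar> \<le> B * card H" using k[OF order_trans[OF n]] by (simp add: ac_simps)
qed

lemma ap_form_approx:
  assumes H: "subgrp H" and h: "\<And>r. r \<in> V \<Longrightarrow> cmod (ft H (\<lambda>x. u x - g x) r) \<le> B"
    and u: "\<And>x. x \<in> H \<Longrightarrow> 0 \<le> u x \<and> u x \<le> 1" and g: "\<And>x. x \<in> H \<Longrightarrow> 0 \<le> g x \<and> g x \<le> 1"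
  shows "\<bar>ap_form H u u u - ap_form H g g g\<bar> \<le> 3 * B * card H"
proof -
  let ?h = "\<lambda>x. u x - g x"
  \<comment> \<open>Telescoping: u is replaced by g in one slot at a time, whence the factor
    3.\<close>
  have "ap_form H u u u - ap_form H g g g = ap_form H ?h u u + ap_form H g ?h u + ap_form H g g ?h"
    unfolding ap_form_def sum.distrib[symmetric] sum_subtractf[symmetric]
    by (intro sum.cong refl) (simp add: algebra_simps)
  moreover have "\<bar>ap_form H ?h u u\<bar> \<le> B * card H" "\<bar>ap_form H g ?h u\<bar> \<le> B * card H" "\<bar>ap_form H g g ?h\<bar> \<le> B * card H"
    using ap_form_bounds(1)[where h = ?h and u = u and v = u] ap_form_bounds(2)[where h = ?h and u = g and v = u]
      ap_form_bounds(3)[where h = ?h and u = g and v = g] H h u g by auto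
  ultimately show ?thesis by linarith
qed

subsection \<open>Refining a subgroup by its large spectrum\<close>

definition avg :: "'a set \<Rightarrow> ('a \<Rightarrow> real) \<Rightarrow> 'a \<Rightarrow> real" where
  "avg H f x = (\<Sum>h\<in>H. f (x \<oplus> h)) / card H"

text \<open>One set collects the large frequencies from all base points a, since a single subgroup
  has to serve all cosets at once.\<close>

definition spec :: "'a set \<Rightarrow> ('a \<Rightarrow> real) \<Rightarrow> real \<Rightarrow> 'a set" where
  "spec H f \<theta> = {r \<in> V. \<exists>a\<in>V. cmod (ft H (\<lambda>h. f (a \<oplus> h)) r) \<ge> \<theta> * card H}"

definition annihil :: "'a set \<Rightarrow> 'a set \<Rightarrow> 'a set" where
  "annihil H S = {x \<in> H. \<forall>r\<in>S. e r x = 1}"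

lemma subgrp_annihil:
  assumes "subgrp H" "S \<subseteq> V" shows "subgrp (annihil H S)"
  using assms unfolding subgrp_def annihil_def
  by (auto simp: e_zero e_add e_neg subset_iff)

lemma spec_subset: "spec H f \<theta> \<subseteq> V"
  by (auto simp: spec_def)

lemma ft_translate:
  assumes H: "subgrp H" and k: "k \<in> H" and r: "r \<in> V" and a: "a \<in> V"
  shows "cmod (ft H (\<lambda>h. f (a \<oplus> k \<oplus> h)) r) = cmod (ft H (\<lambda>h. f (a \<oplus> h)) r)"
proof -
  have kV: "k \<in> V" using H k subgrp_in_V by auto
  have "ft H (\<lambda>h. f (a \<oplus> h)) r = (\<Sum>x\<in>H. of_real (f (a \<oplus> (k \<oplus> x))) * e r (k \<oplus> x))"
    unfolding ft_def by (rule sum_translate[OF H k, symmetric])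
  also have "\<dots> = e r k * ft H (\<lambda>h. f (a \<oplus> k \<oplus> h)) r"
    unfolding ft_def sum_distrib_left using H r kV
    by (intro sum.cong refl) (simp add: e_add subgrp_in_V add_assoc)
  finally show ?thesis using norm_e[OF r kV] by (simp add: norm_mult)
qed

text \<open>A frequency that is large at a base point is large on its whole coset, so every element
  of the spectrum carries at least \<^term>\<open>card H\<close> of the total Parseval mass.\<close>

lemma card_spec:
  assumes H: "subgrp H" and \<theta>: "\<theta> > 0" and f: "\<And>x. x \<in> V \<Longrightarrow> 0 \<le> f x \<and> f x \<le> 1"
  shows "real (card (spec H f \<theta>)) \<le> (card V / card H)\<^sup>2 / \<theta>\<^sup>2"
proof -
  let ?F = "\<lambda>a r. (cmod (ft H (\<lambda>h. f (a \<oplus> h)) r))\<^sup>2"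
  let ?M = "real (card H)"
  have M: "?M > 0" using subgrp_card_pos[OF H] by simp
  have HV: "H \<subseteq> V" using H by (simp add: subgrp_def)
  have low: "?M * (\<theta> * ?M)\<^sup>2 \<le> (\<Sum>a\<in>V. ?F a r)" if r: "r \<in> spec H f \<theta>" for r
  proof -
    obtain a where a: "a \<in> V" "cmod (ft H (\<lambda>h. f (a \<oplus> h)) r) \<ge> \<theta> * ?M" and rV: "r \<in> V"
      using r by (auto simp: spec_def)
    have "?M * (\<theta> * ?M)\<^sup>2 = (\<Sum>k\<in>H. (\<theta> * ?M)\<^sup>2)" by simp
    also have "\<dots> \<le> (\<Sum>k\<in>H. ?F (a \<oplus> k) r)"
      using a(2) ft_translate[OF H _ rV a(1), of _ f] \<theta> M
      by (intro sum_mono power_mono) auto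
    also have "\<dots> \<le> (\<Sum>k\<in>V. ?F (a \<oplus> k) r)"
      using HV by (intro sum_mono2) (auto simp: finite_V)
    also have "\<dots> = (\<Sum>a\<in>V. ?F a r)" by (rule sum_translate[OF subgrp_V a(1)])
    finally show ?thesis .
  qed
  have "card (spec H f \<theta>) * (?M * (\<theta> * ?M)\<^sup>2) = (\<Sum>r\<in>spec H f \<theta>. ?M * (\<theta> * ?M)\<^sup>2)" by simp
  also have "\<dots> \<le> (\<Sum>r\<in>spec H f \<theta>. \<Sum>a\<in>V. ?F a r)" by (intro sum_mono low)
  also have "\<dots> \<le> (\<Sum>r\<in>V. \<Sum>a\<in>V. ?F a r)"
    using spec_subset by (intro sum_mono2) (auto simp: finite_V intro: sum_nonneg)
  also have "\<dots> = (\<Sum>a\<in>V. \<Sum>r\<in>V. ?F a r)" by (rule sum.swap)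
  also have "\<dots> \<le> (\<Sum>a\<in>V. real (card V) * ?M)"
    using f H by (intro sum_mono parseval_le) (auto simp: add_closed subgrp_in_V)
  finally have "card (spec H f \<theta>) * (?M * (\<theta> * ?M)\<^sup>2) \<le> (card V)\<^sup>2 * ?M" by (simp add: power2_eq_square)
  then have "(card (spec H f \<theta>) * (\<theta> * ?M)\<^sup>2) * ?M \<le> (card V)\<^sup>2 * ?M" by (simp add: ac_simps)
  then have "card (spec H f \<theta>) * (\<theta> * ?M)\<^sup>2 \<le> (card V)\<^sup>2" using M by simp
  then show ?thesis using M \<theta> by (simp add: field_simps power_divide)
qed

text \<open>The tuple of values \<open>e r x\<close>, r in S, takes at most
  \<open>p ^ card S\<close> values because its entries are p-th roots of unity; each fibre is moved
  into the annihilator by subtracting one of its points.\<close>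

lemma card_annihil:
  assumes H: "subgrp H" and S: "S \<subseteq> V"
  shows "card H \<le> p ^ card S * card (annihil H S)"
proof -
  have fS: "finite S" using S finite_V finite_subset by auto
  let ?Z = "{z :: complex. z ^ p = 1}"
  have fZ: "finite ?Z" and cZ: "card ?Z \<le> p"
    using finite_roots_unity[of p, where 'a = complex] card_roots_unity[of p, where 'a = complex] p_pos by auto
  define \<phi> where "\<phi> x = (\<lambda>r\<in>S. e r x)" for x
  have im: "\<phi> ` H \<subseteq> (\<Pi>\<^sub>E r\<in>S. ?Z)"
    using S e_power H subgrp_in_V unfolding \<phi>_def by fastforce
  have fib: "card {x \<in> H. \<phi> x = y} \<le> card (annihil H S)" if y: "y \<in> \<phi> ` H" for y
  proof -
    obtain a where a: "a \<in> H" "y = \<phi> a" using y by blast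
    have aV: "a \<in> V" "neg a \<in> V" using a H subgrp_in_V neg_V by auto
    show ?thesis
    proof (rule card_inj_on_le[where f = "\<lambda>x. neg a \<oplus> x"])
      show "inj_on (\<lambda>x. neg a \<oplus> x) {x \<in> H. \<phi> x = y}"
      proof (rule inj_onI)
        fix x y' assume "x \<in> {x \<in> H. \<phi> x = y}" "y' \<in> {x \<in> H. \<phi> x = y}" "neg a \<oplus> x = neg a \<oplus> y'"
        then show "x = y'" using add_cancel[OF aV(2)] subgrp_in_V[OF H] by blast
      qed
      show "(\<lambda>x. neg a \<oplus> x) ` {x \<in> H. \<phi> x = y} \<subseteq> annihil H S"
      proof clarify
        fix x assume x: "x \<in> H" "y = \<phi> x"
        have "e r (neg a \<oplus> x) = 1" if r: "r \<in> S" for r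
        proof -
          have rV: "r \<in> V" using r S by auto
          have "\<phi> x r = \<phi> a r" using x(2) a(2) by metis
          then have "e r x = e r a" using r by (simp add: \<phi>_def)
          then have "e r (neg a \<oplus> x) = e r (neg a \<oplus> a)"
            using rV aV x H by (simp add: e_add subgrp_in_V)
          also have "neg a \<oplus> a = \<zero>" using add_neg[OF aV(1)] add_comm[of a] by simp
          finally show ?thesis using e_zero rV by simp
        qed
        then show "neg a \<oplus> x \<in> annihil H S"
          using a x H subgrp_add subgrp_neg by (auto simp: annihil_def)
      qed
      show "finite (annihil H S)" using subgrp_finite[OF subgrp_annihil[OF H S]] .
    qed
  qed
  have "card H = (\<Sum>y\<in>\<phi> ` H. card {x \<in> H. \<phi> x = y})"
    using sum.image_gen[OF subgrp_finite[OF H], of "\<lambda>_. 1 :: nat" \<phi>] by simp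
  also have "\<dots> \<le> card (\<phi> ` H) * card (annihil H S)"
    using sum_bounded_above[of "\<phi> ` H" "\<lambda>y. card {x \<in> H. \<phi> x = y}", OF fib] by simp
  also have "card (\<phi> ` H) \<le> p ^ card S"
  proof -
    have "card (\<phi> ` H) \<le> card (\<Pi>\<^sub>E r\<in>S. ?Z)"
      using im fS fZ by (intro card_mono finite_PiE) auto
    also have "\<dots> = card ?Z ^ card S" using fS by (simp add: card_PiE)
    also have "\<dots> \<le> p ^ card S" using cZ by (intro power_mono) auto
    finally show ?thesis .
  qed
  finally show ?thesis by simp
qed

lemma avg_mem: 
  assumes "subgrp H" "\<And>x. x \<in> V \<Longrightarrow> 0 \<le> f x \<and> f x \<le> 1" "x \<in> V"
  shows "0 \<le> avg H f x \<and> avg H f x \<le> 1"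
proof -
  have b: "0 \<le> f (x \<oplus> h) \<and> f (x \<oplus> h) \<le> 1" if "h \<in> H" for h
    using that assms add_closed subgrp_in_V by auto
  have "(\<Sum>h\<in>H. f (x \<oplus> h)) \<le> card H * 1"
    using b sum_bounded_above[of H "\<lambda>h. f (x \<oplus> h)" 1] by auto
  moreover have "0 \<le> (\<Sum>h\<in>H. f (x \<oplus> h))" using b by (auto intro: sum_nonneg)
  ultimately show ?thesis
    using subgrp_card_pos[OF assms(1)] by (simp add: avg_def)
qed

lemma avg_invariant:
  assumes "subgrp H" "k \<in> H" shows "avg H f (x \<oplus> k) = avg H f x"
  using sum_translate[OF assms, of "\<lambda>h. f (x \<oplus> h)"] by (simp add: avg_def add_assoc)

text \<open>A frequency trivial on K is not affected by averaging over K. One that is nontrivial on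
  K is killed by averaging, and it cannot belong to the spectrum, so the coefficient of f itself is
  small.\<close>

lemma ft_approx:
  fixes f :: "'a \<Rightarrow> real"
  assumes H: "subgrp H" and \<theta>: "\<theta> > 0" and a: "a \<in> V" and r: "r \<in> V"
  defines "K \<equiv> annihil H (spec H f \<theta>)"
  shows "cmod (ft H (\<lambda>h. f (a \<oplus> h) - avg K f (a \<oplus> h)) r) \<le> \<theta> * card H"
proof -
  have K: "subgrp K" unfolding K_def by (rule subgrp_annihil[OF H spec_subset])
  have KH: "K \<subseteq> H" by (auto simp: K_def annihil_def)
  have cK: "card K > 0" using subgrp_card_pos[OF K] .
  let ?f = "ft H (\<lambda>h. f (a \<oplus> h)) r" and ?g = "ft H (\<lambda>h. avg K f (a \<oplus> h)) r"
  have diff: "ft H (\<lambda>h. f (a \<oplus> h) - avg K f (a \<oplus> h)) r = ?f - ?g"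
    by (simp add: ft_def sum_subtractf[symmetric] algebra_simps)
  show ?thesis
  proof (cases "\<forall>k\<in>K. e r k = 1")
    case True
    have "of_nat (card K) * ?g = (\<Sum>x\<in>H. (\<Sum>k\<in>K. of_real (f (a \<oplus> (x \<oplus> k)))) * e r x)"
      using cK by (simp add: ft_def avg_def sum_distrib_left add_assoc)
    also have "\<dots> = (\<Sum>x\<in>H. \<Sum>k\<in>K. of_real (f (a \<oplus> (x \<oplus> k))) * e r (x \<oplus> k))"
      unfolding sum_distrib_right using True H K r
      by (intro sum.cong refl) (simp add: e_add subgrp_in_V)
    also have "\<dots> = (\<Sum>k\<in>K. \<Sum>x\<in>H. of_real (f (a \<oplus> (x \<oplus> k))) * e r (x \<oplus> k))"
      by (rule sum.swap)
    also have "\<dots> = (\<Sum>k\<in>K. ?f)"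
      unfolding ft_def using KH
      by (intro sum.cong refl sum_translate'[OF H]) auto
    finally have "?g = ?f" using cK by simp
    then show ?thesis unfolding diff using \<theta> by simp
  next
    case False
    then obtain k where k: "k \<in> K" "e r k \<noteq> 1" by auto
    have kH: "k \<in> H" using k KH by auto
    have kV: "k \<in> V" using kH H subgrp_in_V by auto
    have "?g = (\<Sum>x\<in>H. of_real (avg K f (a \<oplus> (x \<oplus> k))) * e r (x \<oplus> k))"
      unfolding ft_def by (rule sum_translate'[OF H kH, symmetric])
    also have "\<dots> = (\<Sum>x\<in>H. of_real (avg K f (a \<oplus> x)) * e r x * e r k)"
      using avg_invariant[OF K k(1), of f] r kV H
      by (intro sum.cong refl) (simp add: e_add subgrp_in_V add_assoc[symmetric])
    also have "\<dots> = ?g * e r k" by (simp add: ft_def sum_distrib_right)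
    finally have "?g = 0" using k(2) by simp
    moreover have "r \<notin> spec H f \<theta>" using k by (auto simp: K_def annihil_def)
    ultimately show ?thesis unfolding diff using r a by (auto simp: spec_def not_le)
  qed
qed

section \<open>Mean cubes, progression means and Schur's inequality on cosets\<close>

definition cubes :: "'a set \<Rightarrow> ('a \<Rightarrow> real) \<Rightarrow> real" where
  "cubes H f = (\<Sum>x\<in>V. avg H f x ^ 3) / card V"

definition ap_mean :: "'a set \<Rightarrow> ('a \<Rightarrow> real) \<Rightarrow> real" where
  "ap_mean H f = (\<Sum>x\<in>V. \<Sum>d\<in>H. f x * f (x \<oplus> d) * f (x \<oplus> d \<oplus> d)) / (card V * card H)"

text \<open>Cosets are indexed by all base points in V, each coset being met \<open>card H\<close>
  times, so no representatives have to be chosen.\<close>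

lemma sum_cosets:
  assumes H: "subgrp H"
  shows "(\<Sum>a\<in>V. \<Sum>h\<in>H. F (a \<oplus> h)) = real (card H) * (\<Sum>x\<in>V. F x :: real)"
proof -
  have "(\<Sum>a\<in>V. \<Sum>h\<in>H. F (a \<oplus> h)) = (\<Sum>h\<in>H. \<Sum>a\<in>V. F (a \<oplus> h))" by (rule sum.swap)
  also have "\<dots> = (\<Sum>h\<in>H. \<Sum>x\<in>V. F x)"
    using H subgrp_in_V by (intro sum.cong refl sum_translate'[OF subgrp_V]) auto
  finally show ?thesis by simp
qed

lemma ap_mean_cosets:
  assumes H: "subgrp H"
  shows "ap_mean H f = (\<Sum>a\<in>V. ap_form H (\<lambda>h. f (a \<oplus> h)) (\<lambda>h. f (a \<oplus> h)) (\<lambda>h. f (a \<oplus> h))) / (card V * (real (card H))\<^sup>2)"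
proof -
  have "(\<Sum>a\<in>V. ap_form H (\<lambda>h. f (a \<oplus> h)) (\<lambda>h. f (a \<oplus> h)) (\<lambda>h. f (a \<oplus> h)))
    = (\<Sum>a\<in>V. \<Sum>x\<in>H. (\<lambda>y. \<Sum>d\<in>H. f y * f (y \<oplus> d) * f (y \<oplus> d \<oplus> d)) (a \<oplus> x))"
    by (simp add: ap_form_def add_assoc)
  also have "\<dots> = real (card H) * (\<Sum>x\<in>V. \<Sum>d\<in>H. f x * f (x \<oplus> d) * f (x \<oplus> d \<oplus> d))"
    by (rule sum_cosets[OF H])
  finally show ?thesis using subgrp_card_pos[OF H] by (simp add: ap_mean_def power2_eq_square)
qed

lemma avg_avg:
  assumes H: "subgrp H" and K: "subgrp K" and KH: "K \<subseteq> H"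
  shows "avg H (avg K f) x = avg H f x"
proof -
  have "(\<Sum>h\<in>H. avg K f (x \<oplus> h)) = (\<Sum>h\<in>H. \<Sum>k\<in>K. f (x \<oplus> (h \<oplus> k))) / card K"
    by (simp add: avg_def sum_divide_distrib add_assoc)
  also have "(\<Sum>h\<in>H. \<Sum>k\<in>K. f (x \<oplus> (h \<oplus> k))) = (\<Sum>k\<in>K. \<Sum>h\<in>H. f (x \<oplus> (h \<oplus> k)))"
    by (rule sum.swap)
  also have "\<dots> = (\<Sum>k\<in>K. \<Sum>h\<in>H. f (x \<oplus> h))"
    using KH by (intro sum.cong refl sum_translate'[OF H]) auto
  finally show ?thesis using subgrp_card_pos[OF K] by (simp add: avg_def)
qed

lemma schur_ineq:
  fixes x y z :: real
  assumes "0 \<le> x" "0 \<le> y" "0 \<le> z"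
  shows "x\<^sup>2*y + x*y\<^sup>2 + y\<^sup>2*z + y*z\<^sup>2 + x\<^sup>2*z + x*z\<^sup>2 \<le> x^3+y^3+z^3+3*(x*y*z)"
proof -
  \<comment> \<open>After sorting, the first two terms combine to a product of nonnegative factors
    and the third is nonnegative by itself.\<close>
  have main: "0 \<le> a*(a-b)*(a-c) + b*(b-a)*(b-c) + c*(c-a)*(c-b)" if "a \<ge> b" "b \<ge> c" "c \<ge> 0" for a b c :: real
  proof -
    have "a*(a-b)*(a-c) + b*(b-a)*(b-c) = (a-b)*((a-b)*(a+b-c))" by (simp add: algebra_simps)
    moreover have "0 \<le> (a-b)*((a-b)*(a+b-c))" using that by (intro mult_nonneg_nonneg) auto
    moreover have "c*(c-a)*(c-b) = c * ((a-c)*(b-c))" by (simp add: algebra_simps)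
    moreover have "0 \<le> c * ((a-c)*(b-c))" using that by (intro mult_nonneg_nonneg) auto
    ultimately show ?thesis by linarith
  qed
  have "0 \<le> x*(x-y)*(x-z) + y*(y-x)*(y-z) + z*(z-x)*(z-y)"
  proof -
    consider "x \<ge> y" "y \<ge> z" | "x \<ge> z" "z \<ge> y" | "y \<ge> x" "x \<ge> z" | "y \<ge> z" "z \<ge> x" | "z \<ge> x" "x \<ge> y" | "z \<ge> y" "y \<ge> x"
      by linarith
    then show ?thesis
      using main[of x y z] main[of x z y] main[of y x z] main[of y z x] main[of z x y] main[of z y x] assms
      by cases (simp_all add: algebra_simps)
  qed
  then show ?thesis by (simp add: algebra_simps power2_eq_square power3_eq_cube)
qed

text \<open>Schur's inequality is summed over the progressions in H. Each mixed term involves two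
  points only, which are independent, so it contributes the second moment times the first;
  Cauchy-Schwarz bounds this below by the cube of the mean.\<close>

lemma schur_ap_form:
  assumes H: "subgrp H" and g: "\<And>x. x \<in> H \<Longrightarrow> 0 \<le> g x"
  shows "2 * ((\<Sum>x\<in>H. g x) / card H) ^ 3 \<le> (\<Sum>x\<in>H. g x ^ 3) / card H + ap_form H g g g / (real (card H))\<^sup>2"
proof -
  let ?M = "real (card H)"
  have M: "?M > 0" using subgrp_card_pos[OF H] by simp
  define S1 S2 S3 where "S1 = (\<Sum>x\<in>H. g x)" and "S2 = (\<Sum>x\<in>H. (g x)\<^sup>2)" and "S3 = (\<Sum>x\<in>H. g x ^ 3)"
  have xy: "(\<Sum>x\<in>H. \<Sum>d\<in>H. F x * G (x \<oplus> d)) = sum F H * sum G H" for F G :: "'a \<Rightarrow> real"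
    by (simp add: sum_distrib_left[symmetric] sum_translate[OF H, of _ G] sum_distrib_right[symmetric])
  have xz: "(\<Sum>x\<in>H. \<Sum>d\<in>H. F x * G (x \<oplus> d \<oplus> d)) = sum F H * sum G H" for F G :: "'a \<Rightarrow> real"
  proof -
    have "(\<Sum>x\<in>H. \<Sum>d\<in>H. F x * G (x \<oplus> d \<oplus> d)) = (\<Sum>x\<in>H. \<Sum>d\<in>H. F x * G (x \<oplus> d))"
      using sum_double[OF H, of "\<lambda>d. F _ * G (_ \<oplus> d)"] by (simp add: add_assoc)
    then show ?thesis using xy by simp
  qed
  have yz: "(\<Sum>x\<in>H. \<Sum>d\<in>H. F (x \<oplus> d) * G (x \<oplus> d \<oplus> d)) = sum F H * sum G H" for F G :: "'a \<Rightarrow> real"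
  proof -
    have "(\<Sum>x\<in>H. \<Sum>d\<in>H. F (x \<oplus> d) * G (x \<oplus> d \<oplus> d)) = (\<Sum>d\<in>H. \<Sum>x\<in>H. F (x \<oplus> d) * G (x \<oplus> d \<oplus> d))"
      by (rule sum.swap)
    also have "\<dots> = (\<Sum>d\<in>H. \<Sum>x\<in>H. F x * G (x \<oplus> d))"
      by (rule sum.cong[OF refl], rule sum_translate'[OF H])
    also have "\<dots> = (\<Sum>x\<in>H. \<Sum>d\<in>H. F x * G (x \<oplus> d))" by (rule sum.swap)
    finally show ?thesis using xy by simp
  qed
  have one: "sum (\<lambda>_. 1) H = ?M" by simp
  have "(\<Sum>x\<in>H. \<Sum>d\<in>H. (g x)\<^sup>2*g (x \<oplus> d) + g x*(g (x \<oplus> d))\<^sup>2 + (g (x \<oplus> d))\<^sup>2*g (x \<oplus> d \<oplus> d) + g (x \<oplus> d)*(g (x \<oplus> d \<oplus> d))\<^sup>2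
          + (g x)\<^sup>2*g (x \<oplus> d \<oplus> d) + g x*(g (x \<oplus> d \<oplus> d))\<^sup>2)
     \<le> (\<Sum>x\<in>H. \<Sum>d\<in>H. g x^3 * 1 + 1 * g (x \<oplus> d)^3 + 1 * g (x \<oplus> d \<oplus> d)^3 + 3*(g x*g (x \<oplus> d)*g (x \<oplus> d \<oplus> d)))"
    using schur_ineq g H subgrp_add by (intro sum_mono) auto
  then have "6 * (S2 * S1) \<le> 3 * (S3 * ?M) + 3 * ap_form H g g g"
    unfolding sum.distrib xy[of "\<lambda>x. (g x)\<^sup>2" g] xy[of g "\<lambda>x. (g x)\<^sup>2"] yz[of "\<lambda>x. (g x)\<^sup>2" g] yz[of g "\<lambda>x. (g x)\<^sup>2"]
      xz[of "\<lambda>x. (g x)\<^sup>2" g] xz[of g "\<lambda>x. (g x)\<^sup>2"] xy[of "\<lambda>x. g x ^ 3" "\<lambda>_. 1"] xy[of "\<lambda>_. 1" "\<lambda>x. g x ^ 3"] xz[of "\<lambda>_. 1" "\<lambda>x. g x ^ 3"]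
      unfolding sum_distrib_left[symmetric] one ap_form_def[symmetric] S1_def[symmetric] S2_def[symmetric] S3_def[symmetric]
    by (simp add: algebra_simps)
  then have 1: "2 * (S2 * S1) \<le> S3 * ?M + ap_form H g g g" by simp
  have S1: "S1 \<ge> 0" unfolding S1_def using g by (rule sum_nonneg)
  \<comment> \<open>Cauchy-Schwarz in the form of a nonnegative variance.\<close>
  have "0 \<le> (\<Sum>x\<in>H. (?M * g x - S1)\<^sup>2)" by (intro sum_nonneg) auto
  also have "\<dots> = ?M\<^sup>2 * S2 - 2 * ?M * S1 * S1 + ?M * S1\<^sup>2"
    unfolding power2_diff sum.distrib sum_subtractf S2_def
    by (simp add: S1_def sum_distrib_left sum_distrib_right power_mult_distrib mult_ac)
  finally have "?M * S1\<^sup>2 \<le> ?M * (S2 * ?M)" by (simp add: power2_eq_square algebra_simps)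
  then have "S1\<^sup>2 \<le> S2 * ?M" using M by simp
  then have "S1\<^sup>2 * S1 \<le> S2 * ?M * S1" using S1 by (intro mult_right_mono)
  then have "2 * S1 ^ 3 \<le> ?M * (2 * (S2 * S1))" by (simp add: power2_eq_square power3_eq_cube ac_simps)
  also have "\<dots> \<le> ?M * (S3 * ?M + ap_form H g g g)" using 1 M by (intro mult_left_mono) auto
  finally have "2 * S1 ^ 3 / ?M ^ 3 \<le> ?M * (S3 * ?M + ap_form H g g g) / ?M ^ 3"
    using M by (intro divide_right_mono) auto
  also have "\<dots> = S3 / ?M + ap_form H g g g / ?M\<^sup>2"
    using M by (simp add: field_simps power2_eq_square power3_eq_cube)
  finally show ?thesis unfolding S1_def S3_def by (simp add: power_divide)
qed

end

subsection \<open>The increment of the mean cube density\<close>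

fun tow_n :: "nat \<Rightarrow> nat \<Rightarrow> nat \<Rightarrow> nat" where
  "tow_n p 0 r = r"
| "tow_n p (Suc k) r = p ^ tow_n p k r"

text \<open>At codimension c the index is at most \<open>p ^ c\<close>; the next spectrum has at
  most index squared times R elements, R being an upper bound for the inverse square of the spectral
  threshold.\<close>

fun codim_bound :: "nat \<Rightarrow> nat \<Rightarrow> nat \<Rightarrow> nat" where
  "codim_bound p R 0 = 0"
| "codim_bound p R (Suc i) = codim_bound p R i + p ^ (2 * codim_bound p R i) * R"

text \<open>The combination 2c + 2R is what reproduces itself: the doubled exponent of the recursion
  and the factor R are both absorbed by a single exponential, so a refinement costs exactly one
  level.\<close>

lemma codim_bound_le:
  assumes p: "p \<ge> 3"
  shows "2 * codim_bound p R i + 2 * R \<le> tow_n p i (2 * R)"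
proof (induction i)
  case (Suc i)
  let ?c = "codim_bound p R i"
  have lt: "k \<le> p ^ k" for k using p less_exp[of k] power_mono[of 2 p k] by linarith
  have 9: "1 + 4 * R \<le> p ^ (2 * R)"
  proof -
    have "1 + 4 * R \<le> 9 ^ R" by (induction R) auto
    also have "\<dots> = 3 ^ (2 * R)" by (simp add: power_mult)
    also have "\<dots> \<le> p ^ (2 * R)" using p by (intro power_mono) auto
    finally show ?thesis .
  qed
  have "2 * codim_bound p R (Suc i) + 2 * R = 2 * ?c + 2 * R + 2 * (p ^ (2 * ?c) * R)" by simp
  also have "\<dots> \<le> p ^ (2 * ?c) * (1 + 4 * R)"
  proof -
    have "1 * R \<le> p ^ (2 * ?c) * R" using p by (intro mult_right_mono) auto
    moreover have "p ^ (2 * ?c) * (1 + 4 * R) = p ^ (2 * ?c) + 4 * (p ^ (2 * ?c) * R)" by (simp add: algebra_simps)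
    ultimately show ?thesis using lt[of "2 * ?c"] by linarith
  qed
  also have "\<dots> \<le> p ^ (2 * ?c) * p ^ (2 * R)" using 9 by (rule mult_left_mono) simp
  also have "\<dots> = p ^ (2 * ?c + 2 * R)" by (simp add: power_add)
  also have "\<dots> \<le> p ^ tow_n p i (2 * R)" using Suc p by (intro power_increasing) auto
  finally show ?case by simp
qed simp

lemma tow_n_mono:
  assumes "p \<ge> 2" "i \<le> j" shows "tow_n p i r \<le> tow_n p j r"
proof -
  have "tow_n p i r \<le> tow_n p (Suc i) r" for i
    using less_exp[of "tow_n p i r"] power_mono[OF assms(1), of "tow_n p i r"] by (simp del: less_exp)
  then show ?thesis using assms(2) by (rule lift_Suc_mono_le)
qed

context char_group
begin

text \<open>Both increments come from an inequality on a single coset between the mean, the mean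
  cube and the progression count of the averaged function. Summing over base points gives the global
  form, since averaging over K and then over H is averaging over H.\<close>

lemma avg_cubes_linear:
  assumes H: "subgrp H" and K: "subgrp K" and KH: "K \<subseteq> H"
    and le: "\<And>a. a \<in> V \<Longrightarrow> A * ((\<Sum>h\<in>H. avg K f (a \<oplus> h)) / card H) ^ 3 \<le>
      (\<Sum>h\<in>H. avg K f (a \<oplus> h) ^ 3) / card H + B * (ap_form H (\<lambda>h. avg K f (a \<oplus> h)) (\<lambda>h. avg K f (a \<oplus> h)) (\<lambda>h. avg K f (a \<oplus> h)) / (real (card H))\<^sup>2)"
  shows "A * cubes H f \<le> cubes K f + B * ap_mean H (avg K f)"
proof -
  have M: "real (card H) > 0" using subgrp_card_pos[OF H] by simp
  have "A * (\<Sum>a\<in>V. avg H f a ^ 3) = (\<Sum>a\<in>V. A * ((\<Sum>h\<in>H. avg K f (a \<oplus> h)) / card H) ^ 3)"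
    unfolding sum_distrib_left avg_avg[OF H K KH, of f, symmetric] avg_def[of H "avg K f"] by simp
  also have "\<dots> \<le> (\<Sum>a\<in>V. (\<Sum>h\<in>H. avg K f (a \<oplus> h) ^ 3) / card H + B * (ap_form H (\<lambda>h. avg K f (a \<oplus> h)) (\<lambda>h. avg K f (a \<oplus> h)) (\<lambda>h. avg K f (a \<oplus> h)) / (real (card H))\<^sup>2))"
    by (rule sum_mono) (rule le)
  also have "\<dots> = (\<Sum>a\<in>V. \<Sum>h\<in>H. avg K f (a \<oplus> h) ^ 3) / card H + B * ((\<Sum>a\<in>V. ap_form H (\<lambda>h. avg K f (a \<oplus> h)) (\<lambda>h. avg K f (a \<oplus> h)) (\<lambda>h. avg K f (a \<oplus> h))) / (real (card H))\<^sup>2)"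
    by (simp only: sum.distrib sum_divide_distrib sum_distrib_left)
  also have "(\<Sum>a\<in>V. \<Sum>h\<in>H. avg K f (a \<oplus> h) ^ 3) / card H = (\<Sum>x\<in>V. avg K f x ^ 3)"
    using M sum_cosets[OF H, of "\<lambda>x. avg K f x ^ 3"] by simp
  also have "(\<Sum>a\<in>V. ap_form H (\<lambda>h. avg K f (a \<oplus> h)) (\<lambda>h. avg K f (a \<oplus> h)) (\<lambda>h. avg K f (a \<oplus> h))) / (real (card H))\<^sup>2
     = card V * ap_mean H (avg K f)"
    unfolding ap_mean_cosets[OF H] using card_V_pos by simp
  finally show ?thesis using card_V_pos by (simp add: cubes_def field_simps)
qed

text \<open>If the mean cube is below D times the cube of the mean m, then g cannot concentrate: the
  set where it exceeds m / 2 has density at least \<open>(8 * D) powr (- (1 / 2))\<close>, and each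
  progression inside that set weighs at least (m / 2)^3.\<close>

lemma ap_form_lower:
  assumes H: "subgrp H" and g: "\<And>x. x \<in> H \<Longrightarrow> 0 \<le> g x" and C: "C \<ge> 0" and D: "D > 0"
    and cnt: "\<And>X. X \<subseteq> H \<Longrightarrow> (card X / card H) powr C * (real (card H))\<^sup>2 \<le>
        real (card {(x, d). x \<in> H \<and> d \<in> H \<and> x \<in> X \<and> x \<oplus> d \<in> X \<and> x \<oplus> d \<oplus> d \<in> X})"
  shows "D * ((\<Sum>x\<in>H. g x) / card H) ^ 3 \<le>
    (\<Sum>x\<in>H. g x ^ 3) / card H + 8 * D * (8 * D) powr (C / 2) * (ap_form H g g g / (real (card H))\<^sup>2)"
proof -
  let ?M = "real (card H)"
  have fH: "finite H" and M: "?M > 0" using subgrp_card_pos[OF H] subgrp_finite[OF H] by auto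
  define m where "m = (\<Sum>x\<in>H. g x) / ?M"
  have m0: "m \<ge> 0" unfolding m_def using g by (simp add: sum_nonneg)
  have T0: "0 \<le> ap_form H g g g"
    unfolding ap_form_def using g H subgrp_add by (intro sum_nonneg mult_nonneg_nonneg) auto
  show ?thesis
  proof (cases "D * m ^ 3 \<le> (\<Sum>x\<in>H. g x ^ 3) / ?M")
    case True
    moreover have "0 \<le> 8 * D * (8 * D) powr (C / 2) * (ap_form H g g g / ?M\<^sup>2)" using T0 D by simp
    ultimately show ?thesis unfolding m_def by linarith
  next
    case False
    then have S3: "(\<Sum>x\<in>H. g x ^ 3) \<le> D * m ^ 3 * ?M" using M by (simp add: field_simps)
    have "m \<noteq> 0" using False g M by (auto simp: sum_nonneg)
    then have mp: "m > 0" using m0 by simp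
    define X where "X = {x \<in> H. g x > m / 2}"
    have XH: "X \<subseteq> H" by (auto simp: X_def)
    \<comment> \<open>Holder's inequality is used in its tangent form 3 t^2 g \<le> g^3 + 2 t^3.
      With this t the cube sum takes at most a third of the lower bound for the left side, and what
      is left bounds \<open>card X\<close> from below.\<close>
    define t where "t = sqrt (2 * D) * m"
    have t: "t > 0" and t2: "t\<^sup>2 = 2 * D * m\<^sup>2" using D mp by (auto simp: t_def power_mult_distrib)
    have split: "sum F H = sum F X + sum F (H - X)" for F :: "'a \<Rightarrow> real"
      using XH fH by (metis add.commute sum.subset_diff)
    have "(\<Sum>x\<in>H - X. g x) \<le> (\<Sum>x\<in>H - X. m / 2)" by (intro sum_mono) (auto simp: X_def)
    also have "\<dots> \<le> ?M * (m / 2)" using mp fH by (auto intro!: mult_right_mono card_mono)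
    finally have gX: "?M * m / 2 \<le> (\<Sum>x\<in>X. g x)" using split[of g] M by (simp add: m_def field_simps)
    have "3 * t\<^sup>2 * (\<Sum>x\<in>X. g x) \<le> (\<Sum>x\<in>X. g x ^ 3 + 2 * t ^ 3)"
      unfolding sum_distrib_left
    proof (rule sum_mono)
      fix x assume "x \<in> X"
      then have "0 \<le> g x" using g XH by auto
      then have "0 \<le> (g x - t)\<^sup>2 * (g x + 2 * t)" using t by simp
      then show "3 * t\<^sup>2 * g x \<le> g x ^ 3 + 2 * t ^ 3" by (simp add: algebra_simps power2_eq_square power3_eq_cube)
    qed
    also have "\<dots> = (\<Sum>x\<in>X. g x ^ 3) + 2 * t ^ 3 * card X" by (simp add: sum.distrib)
    also have "(\<Sum>x\<in>X. g x ^ 3) \<le> D * m ^ 3 * ?M"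
      using S3 sum_mono2[OF fH XH, of "\<lambda>x. g x ^ 3"] g by fastforce
    finally have "3 * t\<^sup>2 * (\<Sum>x\<in>X. g x) \<le> D * m ^ 3 * ?M + 2 * t ^ 3 * card X" by simp
    moreover have "3 * t\<^sup>2 * (?M * m / 2) \<le> 3 * t\<^sup>2 * (\<Sum>x\<in>X. g x)" using gX by (intro mult_left_mono) auto
    ultimately have "D * m ^ 3 * ?M \<le> t ^ 3 * card X" unfolding t2 by (simp add: power2_eq_square power3_eq_cube)
    also have "t ^ 3 = 2 * D * m\<^sup>2 * (sqrt (2 * D) * m)" using t2 by (simp add: power3_eq_cube power2_eq_square t_def)
    finally have "(D * m ^ 3) * ?M \<le> (D * m ^ 3) * (2 * sqrt (2 * D) * card X)"
      by (simp add: power3_eq_cube power2_eq_square mult_ac)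
    then have "?M \<le> 2 * sqrt (2 * D) * card X" using D mp by (simp add: mult_le_cancel_left_pos)
    also have "2 * sqrt (2 * D) = sqrt (8 * D)"
      using real_sqrt_mult[of 4 "2 * D"] by simp
    finally have "1 \<le> sqrt (8 * D) * (card X / ?M)" using M by (simp add: field_simps)
    then have x: "(8 * D) powr (- (1 / 2)) \<le> card X / ?M"
      using D by (simp add: powr_minus powr_half_sqrt field_simps)
    have "(8 * D) powr (- (C / 2)) = ((8 * D) powr (- (1 / 2))) powr C" by (simp add: powr_powr)
    also have "\<dots> \<le> (card X / ?M) powr C" using x C by (intro powr_mono2) auto
    finally have "(8 * D) powr (- (C / 2)) * ?M\<^sup>2 \<le> (card X / ?M) powr C * ?M\<^sup>2" by (intro mult_right_mono) auto
    also have "\<dots> \<le> real (card {(x, d). x \<in> H \<and> d \<in> H \<and> x \<in> X \<and> x \<oplus> d \<in> X \<and> x \<oplus> d \<oplus> d \<in> X})"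
      using cnt[OF XH] by simp
    finally have c: "(8 * D) powr (- (C / 2)) * ?M\<^sup>2 \<le> real (card {(x, d). x \<in> H \<and> d \<in> H \<and> x \<in> X \<and> x \<oplus> d \<in> X \<and> x \<oplus> d \<oplus> d \<in> X})" .
    let ?Y = "{(x, d). x \<in> H \<and> d \<in> H \<and> x \<in> X \<and> x \<oplus> d \<in> X \<and> x \<oplus> d \<oplus> d \<in> X}"
    have "(m / 2) ^ 3 * card ?Y = (\<Sum>(x,d)\<in>?Y. (m/2) * (m/2) * (m/2))" by (simp add: power3_eq_cube)
    also have "\<dots> \<le> (\<Sum>(x,d)\<in>?Y. g x * g (x \<oplus> d) * g (x \<oplus> d \<oplus> d))"
    proof (rule sum_mono, clarify)
      fix x d assume "x \<in> X" "x \<oplus> d \<in> X" "x \<oplus> d \<oplus> d \<in> X"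
      then have "m / 2 \<le> g x" "m / 2 \<le> g (x \<oplus> d)" "m / 2 \<le> g (x \<oplus> d \<oplus> d)" by (auto simp: X_def)
      moreover have "0 \<le> m / 2" using mp by simp
      ultimately show "m / 2 * (m / 2) * (m / 2) \<le> g x * g (x \<oplus> d) * g (x \<oplus> d \<oplus> d)"
        by (meson mult_mono mult_nonneg_nonneg order_trans)
    qed
    also have "\<dots> \<le> (\<Sum>(x,d)\<in>H \<times> H. g x * g (x \<oplus> d) * g (x \<oplus> d \<oplus> d))"
      using fH g H subgrp_add by (intro sum_mono2) (auto intro!: mult_nonneg_nonneg)
    also have "\<dots> = ap_form H g g g" unfolding ap_form_def by (simp add: sum.cartesian_product)
    finally have "(m / 2) ^ 3 * ((8 * D) powr (- (C / 2)) * ?M\<^sup>2) \<le> ap_form H g g g"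
      using mult_left_mono[OF c, of "(m / 2) ^ 3"] zero_le_power[of "m / 2" 3] mp by linarith
    then have "m ^ 3 * (8 * D) powr (- (C / 2)) \<le> 8 * (ap_form H g g g / ?M\<^sup>2)"
      using M by (simp add: field_simps power_divide)
    then have 1: "D * (8 * D) powr (C / 2) * (m ^ 3 * (8 * D) powr (- (C / 2))) \<le> D * (8 * D) powr (C / 2) * (8 * (ap_form H g g g / ?M\<^sup>2))"
      using D by (intro mult_left_mono) auto
    have "(8 * D) powr (C / 2) * (8 * D) powr (- (C / 2)) = 1"
      using D by (simp add: powr_add[symmetric])
    then have 2: "D * (8 * D) powr (C / 2) * (m ^ 3 * (8 * D) powr (- (C / 2))) = D * m ^ 3"
      by (simp add: mult_ac)
    have 3: "D * (8 * D) powr (C / 2) * (8 * (ap_form H g g g / ?M\<^sup>2)) = 8 * D * (8 * D) powr (C / 2) * (ap_form H g g g / ?M\<^sup>2)"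
      by simp
    have "0 \<le> (\<Sum>x\<in>H. g x ^ 3) / ?M" using g by (simp add: sum_nonneg)
    then show ?thesis using 1 unfolding 2 3 unfolding m_def by (rule add_increasing)
  qed
qed

text \<open>The number L is the progression mean of the average over K; it exceeds that of f by at
  most 3\<theta>, one \<theta> for each slot. Only this upper bound for L matters
  afterwards.\<close>

lemma refine:
  fixes f :: "'a \<Rightarrow> real"
  assumes H: "subgrp H" and \<theta>: "\<theta> > 0" and f: "\<And>x. x \<in> V \<Longrightarrow> 0 \<le> f x \<and> f x \<le> 1" and C: "C \<ge> 0"
    and cnt: "\<And>X. X \<subseteq> H \<Longrightarrow> (card X / card H) powr C * (real (card H))\<^sup>2 \<le>
        real (card {(x, d). x \<in> H \<and> d \<in> H \<and> x \<in> X \<and> x \<oplus> d \<in> X \<and> x \<oplus> d \<oplus> d \<in> X})"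
  obtains K L where "subgrp K" "card H \<le> p ^ nat \<lfloor>(card V / card H)\<^sup>2 / \<theta>\<^sup>2\<rfloor> * card K"
    "L \<le> ap_mean H f + 3 * \<theta>" "2 * cubes H f \<le> cubes K f + L"
    "\<And>D. D > 0 \<Longrightarrow> D * cubes H f \<le> cubes K f + 8 * D * (8 * D) powr (C / 2) * L"
proof -
  define K where "K = annihil H (spec H f \<theta>)"
  have K: "subgrp K" unfolding K_def by (rule subgrp_annihil[OF H spec_subset])
  have KH: "K \<subseteq> H" by (auto simp: K_def annihil_def)
  let ?M = "real (card H)"
  have M: "?M > 0" using subgrp_card_pos[OF H] by simp
  let ?g = "\<lambda>a h. avg K f (a \<oplus> h)" and ?f = "\<lambda>a h. f (a \<oplus> h)"
  have g: "0 \<le> ?g a h \<and> ?g a h \<le> 1" if "a \<in> V" "h \<in> H" for a h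
    using that avg_mem[OF K f] H subgrp_in_V add_closed by auto
  have "card H \<le> p ^ card (spec H f \<theta>) * card K" unfolding K_def by (rule card_annihil[OF H spec_subset])
  moreover have "card (spec H f \<theta>) \<le> nat \<lfloor>(card V / card H)\<^sup>2 / \<theta>\<^sup>2\<rfloor>"
    using card_spec[OF H \<theta> f] by (simp add: le_nat_floor)
  then have "p ^ card (spec H f \<theta>) * card K \<le> p ^ nat \<lfloor>(card V / card H)\<^sup>2 / \<theta>\<^sup>2\<rfloor> * card K"
    using p_pos by (intro mult_right_mono power_increasing) auto
  ultimately have cK: "card H \<le> p ^ nat \<lfloor>(card V / card H)\<^sup>2 / \<theta>\<^sup>2\<rfloor> * card K" by linarith
  have "ap_form H (?g a) (?g a) (?g a) \<le> ap_form H (?f a) (?f a) (?f a) + 3 * \<theta> * ?M\<^sup>2" if a: "a \<in> V" for a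
  proof -
    have "\<bar>ap_form H (?f a) (?f a) (?f a) - ap_form H (?g a) (?g a) (?g a)\<bar> \<le> 3 * (\<theta> * ?M) * ?M"
    proof (rule ap_form_approx[OF H])
      show "cmod (ft H (\<lambda>x. ?f a x - ?g a x) r) \<le> \<theta> * ?M" if "r \<in> V" for r
        unfolding K_def by (rule ft_approx[OF H \<theta> a that])
      show "0 \<le> ?f a x \<and> ?f a x \<le> 1" if "x \<in> H" for x using that f a H subgrp_in_V add_closed by auto
      show "0 \<le> ?g a x \<and> ?g a x \<le> 1" if "x \<in> H" for x using that g a by auto
    qed
    then show ?thesis by (simp add: power2_eq_square mult_ac)
  qed
  then have "(\<Sum>a\<in>V. ap_form H (?g a) (?g a) (?g a)) \<le> (\<Sum>a\<in>V. ap_form H (?f a) (?f a) (?f a) + 3 * \<theta> * ?M\<^sup>2)"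
    by (rule sum_mono)
  also have "\<dots> = (\<Sum>a\<in>V. ap_form H (?f a) (?f a) (?f a)) + 3 * \<theta> * (card V * ?M\<^sup>2)" by (simp add: sum.distrib)
  finally have "ap_mean H (avg K f) \<le> ((\<Sum>a\<in>V. ap_form H (?f a) (?f a) (?f a)) + 3 * \<theta> * (card V * ?M\<^sup>2)) / (card V * ?M\<^sup>2)"
    unfolding ap_mean_cosets[OF H] by (intro divide_right_mono) auto
  also have "\<dots> = ap_mean H f + 3 * \<theta>"
    unfolding ap_mean_cosets[OF H] using M card_V_pos by (simp add: add_divide_distrib)
  finally have L: "ap_mean H (avg K f) \<le> ap_mean H f + 3 * \<theta>" .
  have 2: "2 * cubes H f \<le> cubes K f + 1 * ap_mean H (avg K f)"
    using g by (intro avg_cubes_linear[OF H K KH]) (simp only: mult_1, rule schur_ap_form[OF H], auto)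
  have 3: "D * cubes H f \<le> cubes K f + 8 * D * (8 * D) powr (C / 2) * ap_mean H (avg K f)" if "D > 0" for D
    using g by (intro avg_cubes_linear[OF H K KH] ap_form_lower[OF H _ C that cnt]) auto
  show ?thesis by (rule that[OF K cK L _ 3]) (use 2 in auto)
qed

text \<open>The zero difference is not controlled by the assumption and may contribute 1, but it is
  only one of \<open>card H\<close> differences.\<close>

lemma ap_mean_bad:
  fixes f :: "'a \<Rightarrow> real" and \<beta> :: real
  assumes H: "subgrp H" and f: "\<And>x. x \<in> V \<Longrightarrow> 0 \<le> f x \<and> f x \<le> 1" and \<beta>: "\<beta> \<ge> 0"
    and bad: "\<And>d. d \<in> V \<Longrightarrow> d \<noteq> \<zero> \<Longrightarrow> (\<Sum>x\<in>V. f x * f (x \<oplus> d) * f (x \<oplus> d \<oplus> d)) \<le> \<beta> * card V"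
  shows "ap_mean H f \<le> \<beta> + 1 / card H"
proof -
  let ?S = "\<lambda>d. \<Sum>x\<in>V. f x * f (x \<oplus> d) * f (x \<oplus> d \<oplus> d)"
  have M: "real (card H) > 0" and N: "real (card V) > 0" using subgrp_card_pos[OF H] card_V_pos by auto
  have "(\<Sum>x\<in>V. \<Sum>d\<in>H. f x * f (x \<oplus> d) * f (x \<oplus> d \<oplus> d)) = (\<Sum>d\<in>H. ?S d)" by (rule sum.swap)
  also have "\<dots> = ?S \<zero> + (\<Sum>d\<in>H - {\<zero>}. ?S d)"
    using subgrp_finite[OF H] subgrp_zero[OF H] by (simp add: sum.remove)
  also have "?S \<zero> \<le> (\<Sum>x\<in>V. 1)" 
    using f by (intro sum_mono) (simp add: add_zero mult_le_one mult_nonneg_nonneg)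
  also have "(\<Sum>d\<in>H - {\<zero>}. ?S d) \<le> (\<Sum>d\<in>H - {\<zero>}. \<beta> * card V)"
    using bad H subgrp_in_V by (intro sum_mono) auto
  also have "\<dots> \<le> (\<Sum>d\<in>H. \<beta> * card V)"
    using \<beta> subgrp_finite[OF H] by (intro sum_mono2) auto
  finally have "(\<Sum>x\<in>V. \<Sum>d\<in>H. f x * f (x \<oplus> d) * f (x \<oplus> d \<oplus> d)) \<le> card V + card H * (\<beta> * card V)" by simp
  then have "ap_mean H f \<le> (card V + card H * (\<beta> * card V)) / (card V * card H)"
    unfolding ap_mean_def by (intro divide_right_mono) auto
  also have "\<dots> = \<beta> + 1 / card H" using M N by (simp add: field_simps)
  finally show ?thesis .
qed

lemma cubes_V: 
  shows "cubes V f = ((\<Sum>x\<in>V. f x) / card V) ^ 3"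
  using sum_translate[OF subgrp_V, of _ f] card_V_pos by (simp add: cubes_def avg_def)

lemma cubes_le:
  assumes H: "subgrp H" and f: "\<And>x. x \<in> V \<Longrightarrow> 0 \<le> f x \<and> f x \<le> 1"
  shows "cubes H f \<le> (\<Sum>x\<in>V. f x) / card V"
proof -
  have "(\<Sum>x\<in>V. avg H f x ^ 3) \<le> (\<Sum>x\<in>V. avg H f x)"
  proof (rule sum_mono)
    fix x assume "x \<in> V"
    then have "0 \<le> avg H f x" "avg H f x \<le> 1" using avg_mem[OF H f] by auto
    then show "avg H f x ^ 3 \<le> avg H f x" using power_decreasing[of 1 3 "avg H f x"] by simp
  qed
  also have "\<dots> = (\<Sum>x\<in>V. f x)"
    using sum_cosets[OF H, of f] subgrp_card_pos[OF H] by (simp add: avg_def sum_divide_distrib[symmetric])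
  finally show ?thesis by (simp add: cubes_def divide_right_mono)
qed

text \<open>The sequence s is prescribed in advance and merely has to stay below the mean cubes,
  each step being justified by either increment; the ranges of \<beta> differ in the choice of s.
  There are k + 1 refinements, but H has to be large only before each of them, so height k
  suffices.\<close>

lemma increment_iteration:
  fixes f :: "'a \<Rightarrow> real" and s :: "nat \<Rightarrow> real" and C \<beta> :: real
  assumes p: "p \<ge> 3" and V: "card V = p ^ n" and f: "\<And>x. x \<in> V \<Longrightarrow> 0 \<le> f x \<and> f x \<le> 1"
    and C: "C \<ge> 0" and \<beta>: "\<beta> \<ge> 0"
    and cnt: "\<And>H X. subgrp H \<Longrightarrow> X \<subseteq> H \<Longrightarrow> (card X / card H) powr C * (real (card H))\<^sup>2 \<le>
        real (card {(x, d). x \<in> H \<and> d \<in> H \<and> x \<in> X \<and> x \<oplus> d \<in> X \<and> x \<oplus> d \<oplus> d \<in> X})"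
    and bad: "\<And>d. d \<in> V \<Longrightarrow> d \<noteq> \<zero> \<Longrightarrow> (\<Sum>x\<in>V. f x * f (x \<oplus> d) * f (x \<oplus> d \<oplus> d)) \<le> \<beta> * card V"
    and \<delta>: "0 < \<delta>" "\<delta> \<le> 1" and R: "9 / \<delta>\<^sup>2 \<le> real R"
    and n: "n \<ge> tow_n p k (2 * R)"
    and s0: "s 0 \<le> ((\<Sum>x\<in>V. f x) / card V) ^ 3"
    and s: "\<And>i. i \<le> k \<Longrightarrow> s (Suc i) \<le> 2 * s i - (\<beta> + 2 * \<delta>) \<or>
       (\<exists>D>0. s (Suc i) \<le> D * s i - 8 * D * (8 * D) powr (C / 2) * (\<beta> + 2 * \<delta>))"
  shows "s (Suc k) \<le> (\<Sum>x\<in>V. f x) / card V"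
proof -
  have "\<exists>H. subgrp H \<and> card V \<le> p ^ codim_bound p R i * card H \<and> s i \<le> cubes H f" if "i \<le> Suc k" for i
    using that
  proof (induction i)
    case 0
    show ?case using s0 subgrp_V by (intro exI[of _ V]) (simp add: cubes_V)
  next
    case (Suc i)
    then obtain H where H: "subgrp H" "card V \<le> p ^ codim_bound p R i * card H" "s i \<le> cubes H f" by auto
    let ?c = "codim_bound p R i" and ?M = "real (card H)"
    have M: "?M > 0" using subgrp_card_pos[OF H(1)] by simp
    \<comment> \<open>With n this large H has at least \<open>p ^ R\<close> elements, so the zero
      difference contributes at most \<delta>.\<close>
    have "2 * ?c + 2 * R \<le> n"
      using codim_bound_le[OF p, of R i] tow_n_mono[of p i k "2 * R"] p n Suc.prems by simp
    then have "p ^ (?c + R) \<le> p ^ n" using p by (intro power_increasing) auto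
    also have "\<dots> \<le> p ^ ?c * card H" using H(2) V by simp
    finally have "p ^ R \<le> card H" using p by (simp add: power_add)
    then have "R \<le> card H" using less_exp[of R] power_mono[of 2 p R] p by linarith
    then have "9 / \<delta>\<^sup>2 \<le> ?M" using R by linarith
    then have "9 \<le> ?M * \<delta>\<^sup>2" using \<delta> by (simp add: field_simps)
    also have "\<dots> \<le> ?M * \<delta>" using \<delta> M by (simp add: power2_eq_square)
    finally have "1 / ?M \<le> \<delta>" using M by (simp add: field_simps)
    then have mean: "ap_mean H f \<le> \<beta> + \<delta>" using ap_mean_bad[OF H(1) f \<beta> bad] by linarith
    \<comment> \<open>The threshold \<delta> / 3 makes the total Fourier error \<delta>; 9 /
      \<delta>^2 is its inverse square.\<close>
    have th: "\<delta> / 3 > 0" using \<delta> by simp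
    obtain K L where K: "subgrp K" "card H \<le> p ^ nat \<lfloor>(card V / card H)\<^sup>2 / (\<delta> / 3)\<^sup>2\<rfloor> * card K"
      "L \<le> ap_mean H f + 3 * (\<delta> / 3)" "2 * cubes H f \<le> cubes K f + L"
      and KD: "\<And>D. D > 0 \<Longrightarrow> D * cubes H f \<le> cubes K f + 8 * D * (8 * D) powr (C / 2) * L"
      using refine[where f = f and C = C, OF H(1) th f C cnt[OF H(1)]] by (metis (no_types))
    have L: "L \<le> \<beta> + 2 * \<delta>" using K(3) mean by linarith
    have "card V / ?M \<le> p ^ ?c" using H(2) M 
      by (simp add: field_simps flip: of_nat_mult of_nat_power)
    then have "(card V / ?M)\<^sup>2 / (\<delta> / 3)\<^sup>2 \<le> (real p ^ ?c)\<^sup>2 * (9 / \<delta>\<^sup>2)"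
    proof -
      have "(card V / ?M)\<^sup>2 \<le> (real p ^ ?c)\<^sup>2" using \<open>card V / ?M \<le> p ^ ?c\<close> by (intro power_mono) auto
      moreover have "(card V / ?M)\<^sup>2 / (\<delta> / 3)\<^sup>2 = (card V / ?M)\<^sup>2 * (9 / \<delta>\<^sup>2)" by (simp add: power_divide)
      ultimately show ?thesis by (simp only: mult_right_mono zero_le_divide_iff zero_le_power2 zero_le_numeral simp_thms)
    qed
    also have "\<dots> \<le> (real p ^ ?c)\<^sup>2 * R" using R by (intro mult_left_mono) auto
    also have "\<dots> = real (p ^ (2 * ?c) * R)" by (simp add: power_mult[symmetric] mult.commute)
    finally have "nat \<lfloor>(card V / ?M)\<^sup>2 / (\<delta> / 3)\<^sup>2\<rfloor> \<le> p ^ (2 * ?c) * R"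
      by linarith
    then have "p ^ nat \<lfloor>(card V / ?M)\<^sup>2 / (\<delta> / 3)\<^sup>2\<rfloor> \<le> p ^ (p ^ (2 * ?c) * R)"
      using p by (intro power_increasing) auto
    then have "card H \<le> p ^ (p ^ (2 * ?c) * R) * card K" 
      using K(2) by (meson mult_le_mono1 order_trans)
    then have "p ^ ?c * card H \<le> p ^ ?c * (p ^ (p ^ (2 * ?c) * R) * card K)" by (rule mult_left_mono) simp
    with H(2) have "card V \<le> p ^ ?c * (p ^ (p ^ (2 * ?c) * R) * card K)" by (rule order_trans)
    then have cK: "card V \<le> p ^ codim_bound p R (Suc i) * card K"
      by (simp add: power_add mult.assoc)
    have "s (Suc i) \<le> cubes K f"
    proof -
      have "s (Suc i) \<le> 2 * s i - (\<beta> + 2 * \<delta>) \<or>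
       (\<exists>D>0. s (Suc i) \<le> D * s i - 8 * D * (8 * D) powr (C / 2) * (\<beta> + 2 * \<delta>))"
        using s[of i] Suc.prems by simp
      then show ?thesis
      proof (elim disjE exE conjE)
        assume "s (Suc i) \<le> 2 * s i - (\<beta> + 2 * \<delta>)"
        then show ?thesis using K(4) L H(3) by linarith
      next
        fix D :: real assume D: "D > 0" "s (Suc i) \<le> D * s i - 8 * D * (8 * D) powr (C / 2) * (\<beta> + 2 * \<delta>)"
        have "8 * D * (8 * D) powr (C / 2) * L \<le> 8 * D * (8 * D) powr (C / 2) * (\<beta> + 2 * \<delta>)"
          using L D by (intro mult_left_mono) auto
        moreover have "D * s i \<le> D * cubes H f" using D H(3) by simp
        ultimately show ?thesis using KD[OF D(1)] D(2) by linarith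
      qed
    qed
    then show ?case using K(1) cK by blast
  qed
  from this[of "Suc k"] obtain H where "subgrp H" "s (Suc k) \<le> cubes H f" by auto
  then show ?thesis using cubes_le[of H f, OF _ f] by linarith
qed

end

subsection \<open>The group of vectors\<close>

definition vneg :: "nat \<Rightarrow> nat list \<Rightarrow> nat list" where
  "vneg p x = map (\<lambda>a. (p - a) mod p) x"

definition root_char :: "nat \<Rightarrow> nat \<Rightarrow> complex" where
  "root_char p k = cis (2 * pi * real k / real p)"

text \<open>This is exp(2 pi i (r . x) / p), written as a product over coordinates; the default 1
  ends the recursion.\<close>

fun vchar :: "nat \<Rightarrow> nat list \<Rightarrow> nat list \<Rightarrow> complex" where
  "vchar p (a # r) (b # x) = root_char p (a * b) * vchar p r x"
| "vchar p _ _ = 1"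

lemma root_char_add: "root_char p (j + k) = root_char p j * root_char p k"
  by (simp add: root_char_def cis_mult add_divide_distrib distrib_left)

lemma root_char_mult: "root_char p (j * k) = root_char p j ^ k"
  by (simp add: root_char_def DeMoivre mult_ac)

lemma root_char_self: "p > 0 \<Longrightarrow> root_char p p = 1"
  by (simp add: root_char_def)

lemma root_char_mod: "p > 0 \<Longrightarrow> root_char p (k mod p) = root_char p k"
proof -
  assume p: "p > 0"
  have "root_char p k = root_char p (p * (k div p) + k mod p)" by simp
  also have "\<dots> = root_char p (k mod p)"
    unfolding root_char_add root_char_mult[of p p] using p root_char_self by simp
  finally show ?thesis by simp
qed

lemma root_char_neq_1:
  assumes "0 < b" "b < p" shows "root_char p b \<noteq> 1"
proof
  assume "root_char p b = 1"
  then have "cos (2 * pi * real b / real p) = 1" by (simp add: root_char_def complex_eq_iff)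
  then obtain k :: int where k: "2 * pi * real b / real p = k * 2 * pi"
    by (auto simp: cos_one_2pi_int)
  then have "real b = k * real p" using assms by (simp add: field_simps)
  then have "int b = k * int p" by (metis of_int_eq_iff of_int_mult of_int_of_nat_eq)
  then show False using assms by (metis dvd_triv_right int_dvd_int_iff nat_dvd_not_less)
qed

lemma vecs_0: "vecs p 0 = {[]}"
  by (auto simp: vecs_def)

lemma vecs_Suc: "vecs p (Suc n) = (\<lambda>(a, v). a # v) ` ({0..<p} \<times> vecs p n)"
proof
  show "vecs p (Suc n) \<subseteq> (\<lambda>(a, v). a # v) ` ({0..<p} \<times> vecs p n)"
  proof
    fix x assume "x \<in> vecs p (Suc n)"
    then show "x \<in> (\<lambda>(a, v). a # v) ` ({0..<p} \<times> vecs p n)"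
      by (cases x) (auto simp: vecs_def image_iff)
  qed
qed (auto simp: vecs_def)

lemma finite_vecs: "finite (vecs p n)" and card_vecs: "card (vecs p n) = p ^ n"
  using finite_lists_length_eq[of "{0..<p}" n] card_lists_length_eq[of "{0..<p}" n]
  by (auto simp: vecs_def conj_commute)

lemma vecs_nth: "x \<in> vecs p n \<Longrightarrow> i < n \<Longrightarrow> x ! i < p"
  by (auto simp: vecs_def dest!: nth_mem)

lemma length_vecs: "x \<in> vecs p n \<Longrightarrow> length x = n"
  by (simp add: vecs_def)

lemma vadd_vecs: "p > 0 \<Longrightarrow> x \<in> vecs p n \<Longrightarrow> y \<in> vecs p n \<Longrightarrow> vadd p x y \<in> vecs p n"
  by (auto simp: vecs_def vadd_def)

lemma vadd_assoc: "vadd p (vadd p x y) z = vadd p x (vadd p y z)"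
  by (auto simp: vadd_def list_eq_iff_nth_eq mod_simps add.assoc)

lemma vadd_comm: "vadd p x y = vadd p y x"
  by (auto simp: vadd_def list_eq_iff_nth_eq add.commute)

lemma vzero_vecs: "p > 0 \<Longrightarrow> vzero n \<in> vecs p n"
  by (auto simp: vecs_def vzero_def)

lemma vadd_zero: "x \<in> vecs p n \<Longrightarrow> vadd p x (vzero n) = x"
  by (auto simp: vadd_def vzero_def list_eq_iff_nth_eq length_vecs vecs_nth)

lemma vneg_vecs: "p > 0 \<Longrightarrow> x \<in> vecs p n \<Longrightarrow> vneg p x \<in> vecs p n"
  by (auto simp: vecs_def vneg_def)

lemma vadd_vneg: "x \<in> vecs p n \<Longrightarrow> vadd p x (vneg p x) = vzero n"
  using vecs_nth[of x p n] by (auto simp: vadd_def vneg_def vzero_def list_eq_iff_nth_eq length_vecs mod_simps less_imp_le)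

lemma vchar_add:
  assumes "p > 0" "length r = length x" "length x = length y"
  shows "vchar p r (vadd p x y) = vchar p r x * vchar p r y"
  using assms(2,3)
proof (induction r x y rule: list_induct3)
  case (Cons a r b x c y)
  have "root_char p (a * ((b + c) mod p)) = root_char p (a * (b + c) mod p)"
    using root_char_mod[OF assms(1), of "a * ((b + c) mod p)"] root_char_mod[OF assms(1), of "a * (b + c)"]
    by (simp add: mod_mult_right_eq)
  also have "\<dots> = root_char p (a * b) * root_char p (a * c)"
    using assms(1) by (simp add: root_char_mod root_char_add distrib_left)
  finally show ?case using Cons by (simp add: vadd_def mult_ac)
qed (simp add: vadd_def)

lemma vchar_sym: "vchar p r x = vchar p x r"
  by (induction p r x rule: vchar.induct) (auto simp: mult.commute)

lemma norm_vchar: "cmod (vchar p r x) = 1"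
  by (induction p r x rule: vchar.induct) (auto simp: norm_mult root_char_def)

lemma vchar_power: "p > 0 \<Longrightarrow> vchar p r x ^ p = 1"
proof (induction p r x rule: vchar.induct)
  case (1 p a r b x)
  have "root_char p (a * b) ^ p = root_char p (p * (a * b))"
    by (simp add: root_char_mult[symmetric] mult_ac)
  also have "\<dots> = 1" using 1(2) by (subst root_char_mult) (simp add: root_char_self)
  finally show ?case using 1 by (simp add: power_mult_distrib)
qed auto

lemma sum_vecs_Suc: "(\<Sum>v\<in>vecs p (Suc n). F v) = (\<Sum>a<p. \<Sum>v\<in>vecs p n. F (a # v))"
proof -
  have "(\<Sum>v\<in>vecs p (Suc n). F v) = (\<Sum>(a, v)\<in>{0..<p} \<times> vecs p n. F (a # v))"
    unfolding vecs_Suc by (subst sum.reindex) (auto simp: inj_on_def intro!: sum.cong)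
  then show ?thesis by (simp add: sum.cartesian_product lessThan_atLeast0)
qed

text \<open>The sum factors over coordinates, and a nonzero coordinate of x gives a vanishing
  geometric sum.\<close>

lemma vchar_orth:
  assumes p: "p > 0"
  shows "x \<in> vecs p n \<Longrightarrow> x \<noteq> vzero n \<Longrightarrow> (\<Sum>r\<in>vecs p n. vchar p r x) = 0"
proof (induction n arbitrary: x)
  case 0
  then show ?case by (simp add: vecs_0 vzero_def)
next
  case (Suc n)
  then obtain b y where x: "x = b # y" "b < p" "y \<in> vecs p n" by (auto simp: vecs_Suc)
  have "(\<Sum>r\<in>vecs p (Suc n). vchar p r x) = (\<Sum>a<p. root_char p b ^ a) * (\<Sum>v\<in>vecs p n. vchar p v y)"
    by (simp add: sum_vecs_Suc x sum_product root_char_mult[symmetric] mult.commute)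
  also have "\<dots> = 0"
  proof (cases "b = 0")
    case True
    then have "y \<noteq> vzero n" using Suc.prems(2) x by (auto simp: vzero_def)
    then show ?thesis using Suc.IH x by simp
  next
    case False
    then have "root_char p b \<noteq> 1" using root_char_neq_1 x by simp
    moreover have "root_char p b ^ p = 1"
      using p by (simp add: root_char_mult[symmetric] mult.commute[of b]) (simp add: root_char_mult root_char_self)
    ultimately show ?thesis by (simp add: geometric_sum)
  qed
  finally show ?case .
qed

lemma char_group_vecs:
  assumes p: "odd p"
  shows "char_group (vecs p n) (vadd p) (vzero n) (vneg p) (vchar p) p"
proof
  have p0: "p > 0" using p by (rule odd_pos)
  show "finite (vecs p n)" by (rule finite_vecs)
  fix x y z :: "nat list"
  show "vadd p (vadd p x y) z = vadd p x (vadd p y z)" by (rule vadd_assoc)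
  show "vadd p x y = vadd p y x" by (rule vadd_comm)
  show "vzero n \<in> vecs p n" by (rule vzero_vecs[OF p0])
  show "0 < p" by (rule p0)
  {
    assume x: "x \<in> vecs p n"
    show "vadd p x (vzero n) = x" by (rule vadd_zero[OF x])
    show "vneg p x \<in> vecs p n" by (rule vneg_vecs[OF p0 x])
    show "vadd p x (vneg p x) = vzero n" by (rule vadd_vneg[OF x])
    show "x \<noteq> vzero n \<Longrightarrow> (\<Sum>r\<in>vecs p n. vchar p r x) = 0" by (rule vchar_orth[OF p0 x])
    show "x = vzero n" if "vadd p x x = vzero n"
    proof (rule nth_equalityI)
      show "length x = length (vzero n)" using x by (simp add: vecs_def vzero_def)
      fix i assume "i < length x"
      then have i: "i < n" using x by (simp add: vecs_def)
      have "vadd p x x ! i = 0" unfolding that using i by (simp add: vzero_def)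
      then have "(x ! i + x ! i) mod p = 0" using i x by (simp add: vadd_def length_vecs)
      then have "p dvd 2 * (x ! i)" by (simp add: mod_eq_0_iff_dvd mult_2)
      \<comment> \<open>Here odd p is used: 2 is invertible modulo p.\<close>
      then have "p dvd x ! i" using p by (simp add: coprime_dvd_mult_right_iff)
      then show "x ! i = vzero n ! i" using vecs_nth[OF x i] i by (auto simp: vzero_def dest: dvd_imp_le)
    qed
    assume y: "y \<in> vecs p n"
    show "vadd p x y \<in> vecs p n" by (rule vadd_vecs[OF p0 x y])
    show "vchar p x y = vchar p y x" by (rule vchar_sym)
    show "cmod (vchar p x y) = 1" by (rule norm_vchar)
    show "vchar p x y ^ p = 1" by (rule vchar_power[OF p0])
    show "vchar p x (vadd p y z) = vchar p x y * vchar p x z" if "z \<in> vecs p n"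
      using that x y by (intro vchar_add[OF p0]) (auto simp: length_vecs)
  }
qed

section \<open>Transfer of the counting hypothesis to subgroups\<close>

lemma card_fibres:
  assumes "finite A" "finite Y" and k: "\<And>y. y \<in> Y \<Longrightarrow> card {x \<in> A. g x = y} = k"
  shows "card {x \<in> A. g x \<in> Y} = k * card Y"
proof -
  let ?S = "{x \<in> A. g x \<in> Y}"
  have "(\<Sum>y\<in>Y. sum (\<lambda>_. 1) {x \<in> ?S. g x = y}) = sum (\<lambda>_. 1 :: nat) ?S"
    using assms by (intro sum.group) auto
  moreover have "{x \<in> ?S. g x = y} = {x \<in> A. g x = y}" if "y \<in> Y" for y using that by auto
  ultimately have "card ?S = (\<Sum>y\<in>Y. card {x \<in> A. g x = y})" by simp
  then show ?thesis using k by simp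
qed

context char_group
begin

primrec nsm :: "nat \<Rightarrow> 'a \<Rightarrow> 'a" where
  "nsm 0 h = \<zero>"
| "nsm (Suc k) h = h \<oplus> nsm k h"

lemma nsm_subgrp: "subgrp H \<Longrightarrow> h \<in> H \<Longrightarrow> nsm k h \<in> H"
  by (induction k) (auto simp: subgrp_zero subgrp_add)

lemmas nsm_V = nsm_subgrp[OF subgrp_V]

lemma nsm_add: "h \<in> V \<Longrightarrow> nsm (j + k) h = nsm j h \<oplus> nsm k h"
  by (induction j) (auto simp: zero_add nsm_V add_assoc)

lemma e_nsm: "r \<in> V \<Longrightarrow> h \<in> V \<Longrightarrow> e r (nsm k h) = e r h ^ k"
  by (induction k) (auto simp: e_zero e_add nsm_V)

text \<open>Every character sends p h to 1, so the character sum at p h is \<open>card V\<close>;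
  orthogonality leaves only p h = 0.\<close>

lemma nsm_p: "h \<in> V \<Longrightarrow> nsm p h = \<zero>"
proof (rule ccontr)
  assume h: "h \<in> V" and "nsm p h \<noteq> \<zero>"
  then have "(\<Sum>r\<in>V. e r (nsm p h)) = 0" using orth nsm_V by blast
  moreover have "(\<Sum>r\<in>V. e r (nsm p h)) = (\<Sum>r\<in>V. 1)" using h by (intro sum.cong) (auto simp: e_nsm e_power)
  ultimately show False using card_V_pos by simp
qed

lemma nsm_mod: assumes h: "h \<in> V" shows "nsm (k mod p) h = nsm k h"
proof -
  have z: "nsm (p * q) h = \<zero>" for q
    by (induction q) (auto simp: nsm_add[OF h] nsm_p[OF h] add_zero zero_V)
  have "nsm k h = nsm (p * (k div p) + k mod p) h" by simp
  also have "\<dots> = nsm (k mod p) h" unfolding nsm_add[OF h] z using h by (simp add: zero_add nsm_V)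
  finally show ?thesis by simp
qed

text \<open>The linear map from coefficient vectors to the group; coefficients are added modulo p,
  which is consistent because p annihilates the group.\<close>

fun lincomb :: "nat list \<Rightarrow> 'a list \<Rightarrow> 'a" where
  "lincomb (c # cs) (h # hs) = nsm c h \<oplus> lincomb cs hs"
| "lincomb _ _ = \<zero>"

lemma lincomb_subgrp: "subgrp H \<Longrightarrow> set hs \<subseteq> H \<Longrightarrow> lincomb c hs \<in> H"
  by (induction c hs rule: lincomb.induct) (auto simp: subgrp_zero subgrp_add nsm_subgrp)

lemma lincomb_vadd:
  "length c = length c' \<Longrightarrow> length c' = length hs \<Longrightarrow> set hs \<subseteq> V \<Longrightarrow>
    lincomb (vadd p c c') hs = lincomb c hs \<oplus> lincomb c' hs"
proof (induction c c' hs rule: list_induct3)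
  case (Cons a c b c' h hs)
  then have "lincomb (vadd p (a # c) (b # c')) (h # hs) = nsm a h \<oplus> nsm b h \<oplus> (lincomb c hs \<oplus> lincomb c' hs)"
    by (simp add: vadd_def nsm_mod nsm_add)
  then show ?case by (simp add: add_ac)
qed (simp add: vadd_def add_zero zero_V)

lemma lincomb_vzero: "set hs \<subseteq> V \<Longrightarrow> lincomb (vzero m) hs = \<zero>"
proof (induction hs arbitrary: m)
  case (Cons h hs)
  then show ?case by (cases m) (auto simp: vzero_def add_zero zero_V)
qed (cases m; simp add: vzero_def)

lemma lincomb_surj:
  assumes "p > 1" "set hs \<subseteq> V" "h \<in> set hs"
  shows "\<exists>c\<in>vecs p (length hs). lincomb c hs = h"
  using assms(2,3)
proof (induction hs)
  case (Cons g hs)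
  show ?case
  proof (cases "h = g")
    case True
    have "lincomb (1 # vzero (length hs)) (g # hs) = h"
      using True Cons.prems lincomb_vzero[of hs] by (simp add: add_zero)
    moreover have "1 # vzero (length hs) \<in> vecs p (length (g # hs))" using assms(1) by (auto simp: vecs_def vzero_def)
    ultimately show ?thesis by blast
  next
    case False
    then obtain c where "c \<in> vecs p (length hs)" "lincomb c hs = h" using Cons by auto
    moreover from this have "0 # c \<in> vecs p (length (g # hs))" using assms(1) by (auto simp: vecs_def)
    ultimately show ?thesis using Cons.prems by (intro bexI[of _ "0 # c"]) (auto simp: zero_add)
  qed
qed simp

text \<open>The counting hypothesis only concerns the full spaces \<^term>\<open>vecs p m\<close>; it passes to a
  subgroup \<^term>\<open>H\<close> by pulling back along the surjection from the space of coefficient vectors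
  indexed by all the elements of \<^term>\<open>H\<close>, whose fibres have equal size.\<close>

lemma subgrp_count:
  assumes p: "odd p" "p > 1"
    and cnt: "\<And>m X. m \<ge> 1 \<Longrightarrow> X \<subseteq> vecs p m \<Longrightarrow> density p m X powr C * real p ^ (2 * m) \<le> real (ap3_pairs p m X)"
    and H: "subgrp H" and X: "X \<subseteq> H"
  shows "(card X / card H) powr C * (real (card H))\<^sup>2 \<le>
        real (card {(x, d). x \<in> H \<and> d \<in> H \<and> x \<in> X \<and> x \<oplus> d \<in> X \<and> x \<oplus> d \<oplus> d \<in> X})"
proof -
  obtain hs where hs: "set hs = H" "distinct hs" using finite_distinct_list[OF subgrp_finite[OF H]] by auto
  define m where "m = card H"
  have lhs: "length hs = m" using hs distinct_card m_def by metis
  have HV: "set hs \<subseteq> V" using hs H by (simp add: subgrp_def)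
  have fX: "finite X" and fH: "finite H" using X subgrp_finite[OF H] finite_subset by auto
  have m1: "m \<ge> 1" using subgrp_card_pos[OF H] by (simp add: m_def)
  interpret W: char_group "vecs p m" "vadd p" "vzero m" "vneg p" "vchar p" p
    by (rule char_group_vecs[OF p(1)])
  define \<psi> where "\<psi> c = lincomb c hs" for c
  have \<psi>H: "\<psi> c \<in> H" for c unfolding \<psi>_def by (rule lincomb_subgrp[OF H]) (simp add: hs)
  have \<psi>add: "\<psi> (vadd p c d) = \<psi> c \<oplus> \<psi> d" if "c \<in> vecs p m" "d \<in> vecs p m" for c d
    unfolding \<psi>_def using that HV lhs by (intro lincomb_vadd) (auto simp: length_vecs)
  define k where "k = card {c \<in> vecs p m. \<psi> c = \<zero>}"
  have fib: "card {c \<in> vecs p m. \<psi> c = y} = k" if y: "y \<in> H" for y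
  proof -
    obtain b where b: "b \<in> vecs p m" "\<psi> b = y"
      using lincomb_surj[OF p(2) HV, of y] y hs lhs unfolding \<psi>_def by auto
    have yV: "y \<in> V" using y H subgrp_in_V by auto
    have "bij_betw (\<lambda>c. vadd p b c) {c \<in> vecs p m. \<psi> c = \<zero>} {c \<in> vecs p m. \<psi> c = y}"
      unfolding bij_betw_def
    proof
      show "inj_on (vadd p b) {c \<in> vecs p m. \<psi> c = \<zero>}"
        using W.bij_translate[OF W.subgrp_V b(1)] by (auto simp: bij_betw_def intro: inj_on_subset)
      show "vadd p b ` {c \<in> vecs p m. \<psi> c = \<zero>} = {c \<in> vecs p m. \<psi> c = y}"
      proof
        show "vadd p b ` {c \<in> vecs p m. \<psi> c = \<zero>} \<subseteq> {c \<in> vecs p m. \<psi> c = y}"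
        proof (rule image_subsetI)
          fix c assume "c \<in> {c \<in> vecs p m. \<psi> c = \<zero>}"
          then have c: "c \<in> vecs p m" "\<psi> c = \<zero>" by auto
          show "vadd p b c \<in> {c \<in> vecs p m. \<psi> c = y}"
            using \<psi>add[OF b(1) c(1)] c b add_zero[OF yV] W.add_closed[OF b(1) c(1)] by simp
        qed
        show "{c \<in> vecs p m. \<psi> c = y} \<subseteq> vadd p b ` {c \<in> vecs p m. \<psi> c = \<zero>}"
        proof
          fix c assume c: "c \<in> {c \<in> vecs p m. \<psi> c = y}"
          then have "c \<in> vadd p b ` vecs p m" using W.bij_translate[OF W.subgrp_V b(1)] by (auto simp: bij_betw_def)
          then obtain d where d: "d \<in> vecs p m" "c = vadd p b d" by auto
          then have "y \<oplus> \<psi> d = y \<oplus> \<zero>" using \<psi>add[OF b(1) d(1)] b(2) c yV by (simp add: add_zero)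
          then have "\<psi> d = \<zero>" using add_cancel[OF yV subgrp_in_V[OF H \<psi>H] zero_V] by simp
          then show "c \<in> vadd p b ` {c \<in> vecs p m. \<psi> c = \<zero>}" using d by auto
        qed
      qed
    qed
    from bij_betw_same_card[OF this] show ?thesis by (simp add: k_def)
  qed
  have "card {c \<in> vecs p m. \<psi> c \<in> H} = k * card H"
    by (rule card_fibres[OF finite_vecs fH fib])
  then have pm: "real p ^ m = real k * card H" using \<psi>H card_vecs[of p m] by (simp flip: of_nat_mult of_nat_power)
  have k0: "k > 0" using pm p by (cases k) auto
  define X' where "X' = {c \<in> vecs p m. \<psi> c \<in> X}"
  have "card X' = k * card X" unfolding X'_def using X by (intro card_fibres[OF finite_vecs fX fib]) auto
  then have dens: "density p m X' = card X / card H"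
    using k0 by (simp add: density_def pm)
  let ?Z = "{(x, d). x \<in> H \<and> d \<in> H \<and> x \<in> X \<and> x \<oplus> d \<in> X \<and> x \<oplus> d \<oplus> d \<in> X}"
  have fZ: "finite ?Z" by (rule finite_subset[of _ "H \<times> H"]) (use fH in auto)
  have "ap3_pairs p m X' = card {z \<in> vecs p m \<times> vecs p m. (case z of (a, d) \<Rightarrow> (\<psi> a, \<psi> d)) \<in> ?Z}"
    unfolding ap3_pairs_def X'_def
  proof (rule arg_cong[of _ _ card])
    have "\<psi> (vadd p a d) = \<psi> a \<oplus> \<psi> d \<and> \<psi> (vadd p (vadd p a d) d) = \<psi> a \<oplus> \<psi> d \<oplus> \<psi> d"
      if "a \<in> vecs p m" "d \<in> vecs p m" for a d
      using \<psi>add[OF that] \<psi>add[OF W.add_closed[OF that] that(2)] by simp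
    then show "{(a, d). a \<in> vecs p m \<and> d \<in> vecs p m \<and> a \<in> {c \<in> vecs p m. \<psi> c \<in> X} \<and> vadd p a d \<in> {c \<in> vecs p m. \<psi> c \<in> X} \<and>
        vadd p (vadd p a d) d \<in> {c \<in> vecs p m. \<psi> c \<in> X}} =
      {z \<in> vecs p m \<times> vecs p m. (case z of (a, d) \<Rightarrow> (\<psi> a, \<psi> d)) \<in> ?Z}"
      using \<psi>H by (auto intro: W.add_closed)
  qed
  also have "\<dots> = (k * k) * card ?Z"
  proof (rule card_fibres[OF _ fZ])
    show "finite (vecs p m \<times> vecs p m)" by (simp add: finite_vecs)
    fix z assume "z \<in> ?Z"
    then obtain x d where z: "z = (x, d)" "x \<in> H" "d \<in> H" by auto
    have "{w \<in> vecs p m \<times> vecs p m. (case w of (a, d) \<Rightarrow> (\<psi> a, \<psi> d)) = z} = {c \<in> vecs p m. \<psi> c = x} \<times> {c \<in> vecs p m. \<psi> c = d}"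
      using z by auto
    then show "card {w \<in> vecs p m \<times> vecs p m. (case w of (a, d) \<Rightarrow> (\<psi> a, \<psi> d)) = z} = k * k"
      using fib z by (simp add: card_cartesian_product)
  qed
  finally have "real (ap3_pairs p m X') = (real k)\<^sup>2 * card ?Z" by (simp add: power2_eq_square)
  moreover have "X' \<subseteq> vecs p m" by (auto simp: X'_def)
  ultimately have "(card X / card H) powr C * (real p ^ m)\<^sup>2 \<le> (real k)\<^sup>2 * card ?Z"
    using cnt[OF m1, of X'] dens by (simp add: power_mult[symmetric] mult.commute)
  then have "(real k)\<^sup>2 * ((card X / card H) powr C * (real (card H))\<^sup>2) \<le> (real k)\<^sup>2 * card ?Z"
    unfolding pm by (simp add: power_mult_distrib mult_ac)
  then show ?thesis using k0 by simp
qed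

end

subsection \<open>Popular differences\<close>

lemma np_good_increment:
  fixes C \<alpha> \<beta> \<delta> :: real and s :: "nat \<Rightarrow> real"
  assumes p: "odd p" "p \<ge> 3" and C: "C \<ge> 0"
    and cnt: "\<And>m X. m \<ge> 1 \<Longrightarrow> X \<subseteq> vecs p m \<Longrightarrow> density p m X powr C * real p ^ (2 * m) \<le> real (ap3_pairs p m X)"
    and \<alpha>: "0 < \<alpha>" and \<beta>: "\<beta> \<ge> 0"
    and \<delta>: "0 < \<delta>" "\<delta> \<le> 1" and R: "9 / \<delta>\<^sup>2 \<le> real R"
    and s0: "s 0 \<le> \<alpha> ^ 3"
    and s: "\<And>i. i \<le> k \<Longrightarrow> s (Suc i) \<le> 2 * s i - (\<beta> + 2 * \<delta>) \<or>
       (\<exists>D>0. s (Suc i) \<le> D * s i - 8 * D * (8 * D) powr (C / 2) * (\<beta> + 2 * \<delta>))"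
    and s_end: "s (Suc k) > \<alpha>"
  shows "np_good p \<alpha> \<beta> (tow_n p k (2 * R))"
  unfolding np_good_def
proof (intro conjI allI impI)
  have "0 < 9 / \<delta>\<^sup>2" using \<delta> by simp
  then have "R \<ge> 1" using R by (cases R) auto
  then show "1 \<le> tow_n p k (2 * R)" using tow_n_mono[of p 0 k "2 * R"] p by simp
  fix n A assume n: "tow_n p k (2 * R) \<le> n" and A: "A \<subseteq> vecs p n" and d: "\<alpha> \<le> density p n A"
  interpret char_group "vecs p n" "vadd p" "vzero n" "vneg p" "vchar p" p
    by (rule char_group_vecs[OF p(1)])
  have P: "real p ^ n > 0" using p by simp
  show "\<exists>d\<in>vecs p n. d \<noteq> vzero n \<and> \<beta> \<le> ap3_density p n A d"
  proof (rule ccontr)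
    assume neg: "\<not> (\<exists>d\<in>vecs p n. d \<noteq> vzero n \<and> \<beta> \<le> ap3_density p n A d)"
    \<comment> \<open>Since f is at most the indicator of A, no difference becomes more popular, and
      the mean is exactly the \<alpha> with which both ends of the sequence s are compared.\<close>
    define sc where "sc = \<alpha> / density p n A"
    have sc: "0 \<le> sc" "sc \<le> 1" using d \<alpha> by (auto simp: sc_def field_simps)
    define f where "f x = (if x \<in> A then sc else 0)" for x
    have f: "0 \<le> f x \<and> f x \<le> 1" for x using sc by (simp add: f_def)
    have "(\<Sum>x\<in>vecs p n. f x) = sc * card A"
      using A finite_vecs by (simp add: f_def sum.If_cases Int_absorb1 mult.commute)
    also have "\<dots> = \<alpha> * real p ^ n" 
    proof -
      have "real (card A) = density p n A * real p ^ n" using P by (simp add: density_def)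
      moreover have "density p n A \<noteq> 0" using d \<alpha> by linarith
      ultimately show ?thesis by (simp add: sc_def)
    qed
    finally have mean: "(\<Sum>x\<in>vecs p n. f x) / card (vecs p n) = \<alpha>" using P by (simp add: card_vecs)
    have bad: "(\<Sum>x\<in>vecs p n. f x * f (vadd p x d) * f (vadd p (vadd p x d) d)) \<le> \<beta> * card (vecs p n)"
      if dd: "d \<in> vecs p n" "d \<noteq> vzero n" for d
    proof -
      let ?Z = "{x \<in> vecs p n. x \<in> A \<and> vadd p x d \<in> A \<and> vadd p (vadd p x d) d \<in> A}"
      have "(\<Sum>x\<in>vecs p n. f x * f (vadd p x d) * f (vadd p (vadd p x d) d)) \<le> (\<Sum>x\<in>vecs p n. if x \<in> ?Z then 1 else 0)"
        using sc by (intro sum_mono) (auto simp: f_def mult_le_one mult_nonneg_nonneg)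
      also have "\<dots> = card ?Z" using finite_vecs by (simp add: sum.If_cases Int_absorb1 flip: Int_def) (simp add: Int_def)
      also have "\<dots> \<le> \<beta> * real p ^ n" using neg dd P by (auto simp: ap3_density_def not_le field_simps)
      finally show ?thesis by (simp add: card_vecs)
    qed
    have "s (Suc k) \<le> (\<Sum>x\<in>vecs p n. f x) / card (vecs p n)"
    proof (rule increment_iteration[where C = C and \<beta> = \<beta> and \<delta> = \<delta> and R = R and n = n])
      show "3 \<le> p" using p by simp
      show "card (vecs p n) = p ^ n" by (rule card_vecs)
      show "s 0 \<le> ((\<Sum>x\<in>vecs p n. f x) / card (vecs p n)) ^ 3" unfolding mean by (rule s0)
      show "(card X / card H) powr C * (real (card H))\<^sup>2 \<le> real (card {(x, d). x \<in> H \<and> d \<in> H \<and> x \<in> X \<and> vadd p x d \<in> X \<and> vadd p (vadd p x d) d \<in> X})"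
        if "subgrp H" "X \<subseteq> H" for H X
        using p by (intro subgrp_count[OF _ _ cnt that]) auto
    qed (use f C \<beta> bad \<delta> R n s in auto)
    then show False using s_end unfolding mean by simp
  qed
qed

text \<open>In characteristic two x + 2d = x, so only the pair x, x + d matters, and all differences
  together carry \<open>card A\<close> squared pairs. Without d = 0 the mean density is at least
  (a^2 M - a) / (M - 1), where a is the density of A and M = 2^n; this is at least a^3 once a (M -
  1) \<ge> 1.\<close>

lemma np_good_char_two:
  assumes \<alpha>: "0 < \<alpha>" and \<beta>: "\<beta> \<le> \<alpha> ^ 3" and N: "N \<ge> 1" "1 + 1 / \<alpha> \<le> 2 ^ N"
  shows "np_good 2 \<alpha> \<beta> N"
  unfolding np_good_def
proof (intro conjI allI impI)
  show "1 \<le> N" by (rule N)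
  fix n A assume n: "N \<le> n" and A: "A \<subseteq> vecs 2 n" and d: "\<alpha> \<le> density 2 n A"
  let ?V = "vecs 2 n" and ?M = "real 2 ^ n"
  define a where "a = density 2 n A"
  have fA: "finite A" using A finite_vecs finite_subset by blast
  have cA: "real (card A) = a * ?M" by (simp add: a_def density_def)
  have a1: "a \<le> 1" using card_mono[OF finite_vecs A] by (simp add: a_def density_def card_vecs)
  have a0: "0 < a" "\<alpha> \<le> a" using d \<alpha> by (auto simp: a_def)
  have two: "(i + (i + j)) mod 2 = j" if "j < 2" for i j :: nat using that by presburger
  have idem: "vadd 2 x (vadd 2 x y) = y" if "x \<in> ?V" "y \<in> ?V" for x y
    using that vecs_nth[of y 2 n] by (auto simp: vadd_def list_eq_iff_nth_eq length_vecs mod_simps two)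
  let ?Z = "\<lambda>d. {x \<in> ?V. x \<in> A \<and> vadd 2 x d \<in> A \<and> vadd 2 (vadd 2 x d) d \<in> A}"
  have Z: "?Z d = {x \<in> A. vadd 2 x d \<in> A}" if "d \<in> ?V" for d
    using that A idem[of d] by (auto simp: vadd_comm[of 2 _ d])
  show "\<exists>d\<in>?V. d \<noteq> vzero n \<and> \<beta> \<le> ap3_density 2 n A d"
  proof (rule ccontr)
    assume "\<not> (\<exists>d\<in>?V. d \<noteq> vzero n \<and> \<beta> \<le> ap3_density 2 n A d)"
    then have neg: "real (card (?Z d)) < \<beta> * ?M" if "d \<in> ?V - {vzero n}" for d
      using that by (auto simp: ap3_density_def not_le field_simps)
    have "real (card A) * real (card A) = (\<Sum>x\<in>A. real (card A))" by simp
    also have "\<dots> \<le> (\<Sum>x\<in>A. real (card {d \<in> ?V. vadd 2 x d \<in> A}))"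
    proof (rule sum_mono)
      fix x assume x: "x \<in> A"
      have "card A \<le> card {d \<in> ?V. vadd 2 x d \<in> A}"
      proof (rule card_inj_on_le[where f = "vadd 2 x"])
        show "inj_on (vadd 2 x) A" using idem x A by (intro inj_on_inverseI[where g = "vadd 2 x"]) auto
        show "vadd 2 x ` A \<subseteq> {d \<in> ?V. vadd 2 x d \<in> A}" using idem x A by (auto intro!: vadd_vecs simp: subset_iff)
      qed (simp add: finite_vecs)
      then show "real (card A) \<le> real (card {d \<in> ?V. vadd 2 x d \<in> A})" by simp
    qed
    also have "\<dots> = (\<Sum>x\<in>A. \<Sum>d\<in>?V. if vadd 2 x d \<in> A then 1 else 0)"
      using finite_vecs by (simp add: sum.If_cases Int_def)
    also have "\<dots> = (\<Sum>d\<in>?V. \<Sum>x\<in>A. if vadd 2 x d \<in> A then 1 else 0)" by (rule sum.swap)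
    also have "\<dots> = (\<Sum>d\<in>?V. real (card (?Z d)))"
      using fA by (intro sum.cong refl) (simp only: Z, simp add: sum.If_cases Int_def)
    also have "\<dots> = real (card (?Z (vzero n))) + (\<Sum>d\<in>?V - {vzero n}. real (card (?Z d)))"
      using finite_vecs vzero_vecs[of 2 n] by (simp add: sum.remove)
    also have "\<dots> < real (card A) + (\<Sum>d\<in>?V - {vzero n}. \<beta> * ?M)"
    proof (rule add_le_less_mono)
      show "real (card (?Z (vzero n))) \<le> real (card A)" using fA by (auto intro!: card_mono)
      \<comment> \<open>The all-ones vector shows that nonzero differences exist, which makes the
        inequality strict.\<close>
      have "replicate n (1::nat) \<in> ?V - {vzero n}" using n N by (auto simp: vecs_def vzero_def)
      then show "(\<Sum>d\<in>?V - {vzero n}. real (card (?Z d))) < (\<Sum>d\<in>?V - {vzero n}. \<beta> * ?M)"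
        using finite_vecs neg by (intro sum_strict_mono) auto
    qed
    also have "\<dots> = a * ?M + (?M - 1) * (\<beta> * ?M)"
      using vzero_vecs[of 2 n] finite_vecs cA by (simp add: card_Diff_singleton card_vecs of_nat_diff)
    finally have "?M * (a * a * ?M) < ?M * (a + (?M - 1) * \<beta>)" unfolding cA by (simp add: algebra_simps)
    then have "a * a * ?M < a + (?M - 1) * \<beta>" by simp
    also have "(?M - 1) * \<beta> \<le> (?M - 1) * a ^ 3"
      using \<beta> a0 power_mono[OF a0(2) less_imp_le[OF \<alpha>], of 3] by (intro mult_left_mono) auto
    finally have lt: "a * ((1 - a) * (a * (?M - 1) - 1)) < 0" by (simp add: algebra_simps power3_eq_cube)
    have "(2 :: real) ^ N \<le> 2 ^ n" using n by (intro power_increasing) auto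
    then have "1 / \<alpha> \<le> ?M - 1" using N(2) unfolding of_nat_numeral by linarith
    then have "1 \<le> \<alpha> * (?M - 1)" using \<alpha> by (simp add: field_simps)
    also have "\<dots> \<le> a * (?M - 1)" using a0 by (intro mult_right_mono) auto
    finally have "0 \<le> a * ((1 - a) * (a * (?M - 1) - 1))"
      using a0 a1 by (intro mult_nonneg_nonneg) auto
    then show False using lt by simp
  qed
qed

lemma vadd_inj: "p > 0 \<Longrightarrow> d \<in> vecs p n \<Longrightarrow> inj_on (\<lambda>x. vadd p x d) (vecs p n)"
  by (rule inj_on_inverseI[where g = "\<lambda>x. vadd p x (vneg p d)"]) (simp add: vadd_assoc vadd_vneg vadd_zero)

text \<open>Union bound: each point of a progression misses A for a fraction 1 - a of the starting
  points, a being the density of A, so any fixed nonzero difference will do.\<close>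

lemma np_good_one:
  assumes p: "p > 1" and \<beta>: "\<beta> \<le> 3 * \<alpha> - 2"
  shows "np_good p \<alpha> \<beta> 1"
  unfolding np_good_def
proof (intro conjI allI impI)
  fix n A assume n: "1 \<le> n" and A: "A \<subseteq> vecs p n" and dn: "\<alpha> \<le> density p n A"
  let ?V = "vecs p n"
  define d where "d = replicate n (1 :: nat)"
  have d: "d \<in> ?V" "d \<noteq> vzero n" using p n by (auto simp: d_def vecs_def vzero_def)
  have p0: "p > 0" using p by simp
  let ?Z = "{x \<in> ?V. x \<in> A \<and> vadd p x d \<in> A \<and> vadd p (vadd p x d) d \<in> A}"
  have fA: "finite A" using A finite_vecs finite_subset by blast
  have le: "card {x \<in> ?V. g x \<notin> A} \<le> card (?V - A)" if "inj_on g ?V" "g ` ?V \<subseteq> ?V" for g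
    using that finite_vecs by (intro card_inj_on_le[where f = g]) (auto intro: inj_on_subset)
  let ?B1 = "{x \<in> ?V. vadd p x d \<notin> A}" and ?B2 = "{x \<in> ?V. vadd p (vadd p x d) d \<notin> A}"
  have "card ?B1 \<le> card (?V - A)" using vadd_inj[OF p0 d(1)] vadd_vecs[OF p0 _ d(1)] by (intro le) auto
  moreover have "card ?B2 \<le> card (?V - A)"
    using comp_inj_on[OF vadd_inj[OF p0 d(1)] inj_on_subset[OF vadd_inj[OF p0 d(1)]]] vadd_vecs[OF p0 _ d(1)]
    by (intro le) (auto simp: comp_def image_subset_iff)
  moreover have "card ?V \<le> card (?Z \<union> (?V - A) \<union> ?B1 \<union> ?B2)"
    by (rule card_mono) (auto simp: finite_vecs)
  moreover have "\<dots> \<le> card ?Z + card (?V - A) + card ?B1 + card ?B2"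
    by (meson add_le_mono card_Un_le le_refl order_trans)
  moreover have "card (?V - A) = card ?V - card A" "card A \<le> card ?V"
    using card_Diff_subset[OF fA A] card_mono[OF finite_vecs A] by auto
  ultimately have "3 * real (card A) - 2 * real (card ?V) \<le> card ?Z" by linarith
  then have "(3 * real (card A) - 2 * real p ^ n) / real p ^ n \<le> card ?Z / real p ^ n"
    by (intro divide_right_mono) (auto simp: card_vecs)
  then have "3 * density p n A - 2 \<le> ap3_density p n A d"
    using p by (simp add: density_def ap3_density_def diff_divide_distrib)
  then show "\<exists>d\<in>?V. d \<noteq> vzero n \<and> \<beta> \<le> ap3_density p n A d" using d \<beta> dn by force
qed simp

subsection \<open>A lower bound for the counting exponent\<close>

definition sqnorm :: "nat list \<Rightarrow> nat" where
  "sqnorm v = (\<Sum>i<length v. (v ! i)\<^sup>2)"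

text \<open>Entries below h add without wrapping around, because h is at most (p + 1) / 2, so a
  progression modulo p is one over the integers. Its middle term is then the midpoint of two points
  of the same sphere and lies on that sphere, which by the parallelogram law makes all three points
  equal.\<close>

lemma sphere_AP_free:
  assumes h: "2 * h \<le> p + 1" "h > 0" and a: "a \<in> vecs h m" and b: "vadd p a d \<in> vecs h m" and c: "vadd p (vadd p a d) d \<in> vecs h m"
    and d: "d \<in> vecs p m"
    and eq: "sqnorm a = s" "sqnorm (vadd p a d) = s" "sqnorm (vadd p (vadd p a d) d) = s"
  shows "d = vzero m"
proof -
  let ?b = "vadd p a d" and ?c = "vadd p (vadd p a d) d"
  have lb: "length a = m" "length d = m" "length ?b = m" "length ?c = m" using a b c d by (auto simp: length_vecs)
  have bi: "?b ! i = (a ! i + d ! i) mod p" and ci: "?c ! i = (?b ! i + d ! i) mod p" if "i < m" for i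
    using that lb by (auto simp: vadd_def)
  have mid: "a ! i + ?c ! i = 2 * ?b ! i" if i: "i < m" for i
  proof -
    have lt: "a ! i < h" "?b ! i < h" "?c ! i < h" using vecs_nth i a b c by auto
    have "(a ! i + ?c ! i) mod p = (?b ! i + (a ! i + d ! i)) mod p" unfolding ci[OF i] by (simp add: mod_simps ac_simps)
    also have "\<dots> = (2 * ?b ! i) mod p" unfolding bi[OF i] by (simp add: mod_simps mult_2)
    finally show ?thesis using lt h by simp
  qed
  have sq: "(\<Sum>i<m. int ((v ! i)\<^sup>2)) = int s" if "length v = m" "sqnorm v = s" for v
    unfolding that(2)[symmetric] sqnorm_def that(1) by simp
  have "(\<Sum>i<m. (int (a ! i) - int (?c ! i))\<^sup>2) = (\<Sum>i<m. 2 * int ((a ! i)\<^sup>2) + 2 * int ((?c ! i)\<^sup>2) - 4 * int ((?b ! i)\<^sup>2))"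
  proof (rule sum.cong[OF refl])
    fix i assume "i \<in> {..<m}"
    then have "int (a ! i) + int (?c ! i) = 2 * int (?b ! i)" using mid[of i] by simp
    moreover have "(A - B)\<^sup>2 = 2 * A\<^sup>2 + 2 * B\<^sup>2 - 4 * M\<^sup>2" if "A + B = 2 * M" for A B M :: int
    proof -
      have B: "B = 2 * M - A" using that by simp
      show ?thesis unfolding B by (simp add: power2_eq_square algebra_simps)
    qed
    ultimately show "(int (a ! i) - int (?c ! i))\<^sup>2 = 2 * int ((a ! i)\<^sup>2) + 2 * int ((?c ! i)\<^sup>2) - 4 * int ((?b ! i)\<^sup>2)"
      by simp
  qed
  also have "\<dots> = 2 * (\<Sum>i<m. int ((a ! i)\<^sup>2)) + 2 * (\<Sum>i<m. int ((?c ! i)\<^sup>2)) - 4 * (\<Sum>i<m. int ((?b ! i)\<^sup>2))"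
    by (simp only: sum.distrib sum_subtractf sum_distrib_left)
  also have "\<dots> = 0" using sq lb eq by simp
  finally have z: "(int (a ! i) - int (?c ! i))\<^sup>2 = 0" if "i < m" for i
    using that by (subst (asm) sum_nonneg_eq_0_iff) auto
  show ?thesis
  proof (rule nth_equalityI)
    show "length d = length (vzero m)" using lb by (simp add: vzero_def)
    fix i assume "i < length d"
    then have i: "i < m" using lb by simp
    have "a ! i = ?b ! i" using z[OF i] mid[OF i] by simp
    then have "(a ! i + d ! i) mod p = (a ! i + 0) mod p" using bi[OF i] vecs_nth[OF a i] h by simp
    moreover have "d ! i < p" using vecs_nth[OF d i] .
    moreover have "a ! i < p" using vecs_nth[OF a i] h by linarith
    ultimately have "d ! i = 0"
      by (cases "a ! i + d ! i < p") (auto simp: le_mod_geq)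
    then show "d ! i = vzero m ! i" using i by (simp add: vzero_def)
  qed
qed

lemma sqnorm_le: "h \<le> p \<Longrightarrow> v \<in> vecs h m \<Longrightarrow> sqnorm v \<le> m * p\<^sup>2"
proof -
  assume h: "h \<le> p" and v: "v \<in> vecs h m"
  have "sqnorm v \<le> (\<Sum>i<m. p\<^sup>2)"
    unfolding sqnorm_def length_vecs[OF v]
  proof (intro sum_mono power_mono)
    fix i assume "i \<in> {..<m}"
    then show "v ! i \<le> p" using vecs_nth[OF v, of i] h by simp
  qed simp
  then show ?thesis by simp
qed

text \<open>Behrend's construction: just over half of the residues in each coordinate, and the most
  popular of the m p^2 + 1 possible squared norms.\<close>

lemma AP_free_set:
  assumes p: "odd p" "p \<ge> 3" and m: "m \<ge> 1"
  shows "\<exists>X \<subseteq> vecs p m. ap3_pairs p m X \<le> card X \<and> 2 powr (- real m) / (m * real p ^ 2 + 1) \<le> density p m X"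
proof -
  obtain q where q: "p = 2 * q + 1" using p(1) by (elim oddE)
  define h where "h = q + 1"
  have h: "2 * h \<le> p + 1" "h > 0" "h \<le> p" "p \<le> 2 * h" by (auto simp: h_def q)
  define X where "X s = {v \<in> vecs h m. sqnorm v = s}" for s
  have sub: "vecs h m \<subseteq> vecs p m" using h by (auto simp: vecs_def)
  have hm: "h ^ m = (\<Sum>s\<le>m * p\<^sup>2. card (X s))"
  proof -
    have "sqnorm ` vecs h m \<subseteq> {..m * p\<^sup>2}" using sqnorm_le[OF h(3)] by auto
    then have "(\<Sum>s\<in>{..m * p\<^sup>2}. sum (\<lambda>_. 1) {v \<in> vecs h m. sqnorm v = s}) = sum (\<lambda>_. 1 :: nat) (vecs h m)"
      by (rule sum.group[where g = sqnorm, OF finite_vecs finite_atMost])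
    then have "(\<Sum>s\<in>{..m * p\<^sup>2}. card (X s)) = card (vecs h m)"
      unfolding X_def card_eq_sum .
    then show ?thesis by (simp only: card_vecs)
  qed
  have "\<exists>s. h ^ m \<le> card (X s) * (m * p\<^sup>2 + 1)"
  proof (rule ccontr)
    assume "\<not> ?thesis"
    then have "card (X s) * (m * p\<^sup>2 + 1) < h ^ m" for s by (simp add: not_le)
    then have "(\<Sum>s\<le>m * p\<^sup>2. card (X s) * (m * p\<^sup>2 + 1)) < (\<Sum>s\<le>m * p\<^sup>2. h ^ m)" by (intro sum_strict_mono) auto
    moreover have "(\<Sum>s\<le>m * p\<^sup>2. card (X s) * (m * p\<^sup>2 + 1)) = h ^ m * (m * p\<^sup>2 + 1)"
      unfolding hm by (rule sum_distrib_right[symmetric])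
    ultimately show False by simp
  qed
  then obtain s where s: "h ^ m \<le> card (X s) * (m * p\<^sup>2 + 1)" by blast
  have Xs: "X s \<subseteq> vecs p m" using sub unfolding X_def by blast
  have fX: "finite (X s)" by (rule finite_subset[OF Xs finite_vecs])
  have "ap3_pairs p m (X s) \<le> card (X s \<times> {vzero m})"
    unfolding ap3_pairs_def
  proof (rule card_mono)
    show "{(a, d). a \<in> vecs p m \<and> d \<in> vecs p m \<and> a \<in> X s \<and> vadd p a d \<in> X s \<and> vadd p (vadd p a d) d \<in> X s} \<subseteq> X s \<times> {vzero m}"
      (is "?S \<subseteq> _")
    proof
      fix z assume "z \<in> ?S"
      then obtain a d where z: "z = (a, d)" and "d \<in> vecs p m" "a \<in> X s" "vadd p a d \<in> X s" "vadd p (vadd p a d) d \<in> X s" by blast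
      then have "d = vzero m" by (intro sphere_AP_free[OF h(1,2), of a m d s]) (auto simp: X_def)
      then show "z \<in> X s \<times> {vzero m}" using \<open>a \<in> X s\<close> z by simp
    qed
  qed (use fX in simp)
  moreover have "card (X s \<times> {vzero m}) = card (X s)" by (subst card_cartesian_product) simp
  ultimately have ap: "ap3_pairs p m (X s) \<le> card (X s)" by (rule ord_le_eq_trans)
  have "2 powr (- real m) / (m * real p ^ 2 + 1) \<le> density p m (X s)"
  proof -
    have P: "real p ^ m > 0" using p by simp
    have "real p ^ m \<le> (2 * real h) ^ m" using h by (intro power_mono) auto
    also have "\<dots> = 2 ^ m * real (h ^ m)" by (simp add: power_mult_distrib)
    also have "real (h ^ m) \<le> real (card (X s) * (m * p\<^sup>2 + 1))" by (rule of_nat_mono[OF s])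
    finally have le: "real p ^ m \<le> 2 ^ m * (card (X s) * (m * real p ^ 2 + 1))" by (simp add: algebra_simps)
    have "1 / (2 ^ m * y) \<le> real (card (X s)) / real p ^ m" if "0 < y" "real p ^ m \<le> 2 ^ m * (card (X s) * y)" for y :: real
    proof -
      have "1 / (2 ^ m * y) * real p ^ m \<le> 1 / (2 ^ m * y) * (2 ^ m * (card (X s) * y))"
        using that by (intro mult_left_mono) auto
      also have "\<dots> = real (card (X s))" using that(1) by simp
      finally show ?thesis unfolding pos_le_divide_eq[OF P] .
    qed
    from this[OF _ le] have "1 / (2 ^ m * (m * real p ^ 2 + 1)) \<le> real (card (X s)) / real p ^ m" by (simp add: add_nonneg_pos)
    moreover have "2 powr (- real m) / (m * real p ^ 2 + 1) = 1 / (2 ^ m * (m * real p ^ 2 + 1))"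
      by (simp add: powr_minus powr_realpow divide_inverse)
    ultimately show ?thesis by (simp only: density_def)
  qed
  with Xs ap show ?thesis by (intro exI[of _ "X s"] conjI) simp_all
qed

lemma log2_le: "n > 0 \<Longrightarrow> log 2 (real n) \<le> n"
proof -
  assume n: "n > 0"
  have "real n \<le> real (2 ^ n)" using less_exp[of n] by (intro of_nat_mono less_imp_le)
  then have "real n \<le> 2 ^ n" by simp
  then have "log 2 n \<le> log 2 (2 ^ n)" using n by (subst log_le_cancel_iff) auto
  then show ?thesis by (simp add: log_nat_power)
qed

text \<open>A progression-free X has only the progressions with d = 0, so with density x the
  hypothesis gives x^C p^(2m) \<le> x p^m. As log(1 / x) is at most m plus a logarithmic term, C - 1
  can hardly be below log p; the slack of one allows an explicit m.\<close>

lemma exponent_lower_bound: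
  assumes p: "odd p" "p \<ge> 3" and C1: "C \<ge> 1"
    and cnt: "\<And>m X. m \<ge> 1 \<Longrightarrow> X \<subseteq> vecs p m \<Longrightarrow> density p m X powr C * real p ^ (2 * m) \<le> real (ap3_pairs p m X)"
  shows "log 2 p \<le> C"
proof (rule ccontr)
  assume "\<not> log 2 p \<le> C"
  then have CL: "C < log 2 p" by simp
  \<comment> \<open>Assuming C < log p, the argument ends with m at most 6 p^2, which this choice
    contradicts.\<close>
  define m where "m = 16 * p\<^sup>2"
  have m1: "m \<ge> 1" using p by (simp add: m_def)
  define L where "L = log 2 p"
  define y where "y = m * real p ^ 2 + 1"
  have y: "y \<ge> 1" by (simp add: y_def)
  have Lp: "L \<le> p" unfolding L_def using p by (intro log2_le) auto
  have L1: "L > 1" using CL C1 by (simp add: L_def)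
  obtain X where X: "X \<subseteq> vecs p m" "ap3_pairs p m X \<le> card X" "2 powr (- real m) / y \<le> density p m X"
    using AP_free_set[OF p m1] unfolding y_def by auto
  define x where "x = density p m X"
  have P: "real p ^ m > 0" using p by simp
  have "0 < 2 powr (- real m) / y" using y by simp
  then have x0: "x > 0" using X(3) unfolding x_def by linarith
  have "x powr C * real p ^ (2 * m) \<le> x * real p ^ m"
    using cnt[OF m1 X(1)] X(2) P by (simp add: x_def density_def)
  then have "log 2 (x powr C * real p ^ (2 * m)) \<le> log 2 (x * real p ^ m)"
    using x0 p by (subst log_le_cancel_iff) auto
  then have "C * log 2 x + 2 * m * L \<le> log 2 x + m * L"
    using x0 p by (simp add: log_mult log_powr log_nat_power L_def)
  then have 1: "m * L \<le> (C - 1) * (- log 2 x)" by (simp add: algebra_simps)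
  have "log 2 (2 powr (- real m) / y) \<le> log 2 x" using X(3) x0 y unfolding x_def by (subst log_le_cancel_iff) auto
  then have "- log 2 x \<le> m + log 2 y" using y by (simp add: log_divide)
  then have "(C - 1) * (- log 2 x) \<le> (C - 1) * (m + log 2 y)" using C1 by (intro mult_left_mono) auto
  also have "\<dots> \<le> (L - 1) * (m + log 2 y)" using CL y by (intro mult_right_mono) (auto simp: L_def)
  finally have "m * L \<le> (L - 1) * (m + log 2 y)" using 1 by linarith
  then have "m \<le> (L - 1) * log 2 y" by (simp add: algebra_simps)
  also have "\<dots> \<le> L * log 2 y" using y by (intro mult_right_mono) auto
  also have "log 2 y \<le> 6 * p"
  proof -
    have "y \<le> 32 * real p ^ 4"
    proof -
      have "1 \<le> real p ^ 4" using p by simp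
      then show ?thesis by (simp add: y_def m_def power2_eq_square power4_eq_xxxx)
    qed
    then have "log 2 y \<le> log 2 (32 * real p ^ 4)" using y p by (subst log_le_cancel_iff) auto
    also have "\<dots> = log 2 (2 powr 5) + 4 * L" using p by (simp add: log_mult log_nat_power L_def)
    also have "\<dots> \<le> 5 + 4 * p" using Lp by (subst log_powr_cancel) auto
    finally show ?thesis using p by simp
  qed
  then have "L * log 2 y \<le> real p * real (6 * p)" using L1 Lp y by (intro mult_mono) auto
  finally show False using p by (simp add: m_def power2_eq_square)
qed

subsection \<open>Tower bounds\<close>

lemma ln2_ge_half: "ln (2 :: real) \<ge> 1 / 2"
proof -
  have "exp (1 / 2 :: real) \<le> 1 + 1 / 2 + (1 / 2)\<^sup>2" by (intro exp_bound) auto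
  also have "\<dots> \<le> 2" by (simp add: power2_eq_square)
  finally show ?thesis by (subst ln_ge_iff) auto
qed

text \<open>Squaring a linear bound for 2^(x/2) suffices, as (1 + x/4)^2 = x + (1 - x/4)^2.\<close>

lemma two_powr_ge: "x \<le> 2 powr (x :: real)"
proof (cases "x \<ge> 0")
  case True
  have "1 + x / 4 \<le> 1 + x / 2 * ln 2" using ln2_ge_half True mult_left_mono[of "1/2" "ln 2" "x / 2"] by simp
  also have "\<dots> \<le> exp (x / 2 * ln 2)" by (rule exp_ge_add_one_self)
  also have "\<dots> = 2 powr (x / 2)" by (simp add: powr_def)
  finally have "(1 + x / 4)\<^sup>2 \<le> (2 powr (x / 2))\<^sup>2" using True by (intro power_mono) auto
  also have "\<dots> = 2 powr x" by (simp add: power2_eq_square powr_add[symmetric])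
  finally have "(1 + x / 4)\<^sup>2 \<le> 2 powr x" .
  moreover have "(1 + x / 4)\<^sup>2 = x + (1 - x / 4)\<^sup>2" by (simp add: power2_eq_square field_simps)
  ultimately show ?thesis using zero_le_power2[of "1 - x / 4"] by linarith
next
  case False
  then show ?thesis using powr_ge_zero[of 2 x] by linarith
qed

lemma powr_ge_self: "a \<ge> 2 \<Longrightarrow> x \<le> a powr (x :: real)"
proof (cases "x \<ge> 0")
  case True
  assume "a \<ge> 2"
  then have "2 powr x \<le> a powr x" using True by (intro powr_mono2) auto
  then show ?thesis using two_powr_ge[of x] by linarith
next
  case False
  then show ?thesis using powr_ge_zero[of a x] by linarith
qed

lemma three_powr_ge:
  fixes a x :: real
  assumes "a \<ge> 3" "x \<ge> 1" shows "3 * x \<le> a powr x"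
proof -
  have ln3: "ln (3::real) \<ge> 1" using exp_le by (subst ln_ge_iff) auto
  have "1 + (x - 1) \<le> 1 + (x - 1) * ln 3" using ln3 assms mult_left_mono[of 1 "ln 3" "x - 1"] by simp
  also have "\<dots> \<le> exp ((x - 1) * ln 3)" by (rule exp_ge_add_one_self)
  also have "\<dots> = 3 powr (x - 1)" by (simp add: powr_def)
  finally have "3 * x \<le> 3 * 3 powr (x - 1)" by simp
  also have "\<dots> = 3 powr x" by (simp add: powr_diff)
  also have "\<dots> \<le> a powr x" using assms by (intro powr_mono2) auto
  finally show ?thesis .
qed

lemma tow_nat_tow_n: "p > 0 \<Longrightarrow> real (tow_n p k r) = tow_nat (real p) k (real r)"
  by (induction k) (auto simp: powr_realpow[symmetric])

lemma tow_nat_add: "tow_nat a (k + j) r = tow_nat a k (tow_nat a j r)"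
  by (induction k) auto

lemma tow_nat_mono: "a \<ge> 1 \<Longrightarrow> r \<le> r' \<Longrightarrow> tow_nat a k r \<le> tow_nat a k r'"
  by (induction k) (auto intro: powr_mono)

lemma tow_nat_mono_height:
  assumes "a \<ge> 2" "i \<le> j" shows "tow_nat a i r \<le> tow_nat a j r"
proof -
  have "tow_nat a i r \<le> tow_nat a (Suc i) r" for i using powr_ge_self[OF assms(1)] by simp
  then show ?thesis using assms(2) by (rule lift_Suc_mono_le)
qed

text \<open>Twice the rounded up 576 x^2 is at most 1154 x^2, the number at the bottom of the tower;
  three levels pay for it. The second level is at least 9x and at least 27, and the third dominates
  its fourth power up to a constant.\<close>

lemma tow_nat_3:
  fixes a x :: real
  assumes a: "a \<ge> 3" and x: "x \<ge> 1"
  shows "1154 * x\<^sup>2 \<le> tow_nat a 3 x"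
proof -
  define t u where "t = a powr x" and "u = a powr t"
  have t: "3 * x \<le> t" unfolding t_def by (rule three_powr_ge[OF a x])
  have u: "3 * t \<le> u" unfolding u_def using t x by (intro three_powr_ge[OF a]) auto
  have "27 = 3 powr (3 :: real)" by (simp add: powr_numeral)
  also have "\<dots> \<le> 3 powr t" using t x by (intro powr_mono) auto
  also have "\<dots> \<le> u" unfolding u_def using a t x by (intro powr_mono2) auto
  finally have u27: "u \<ge> 27" .
  have "3 * (u / 4) \<le> a powr (u / 4)" using u27 by (intro three_powr_ge[OF a]) auto
  then have "(3 * (u / 4)) ^ 4 \<le> (a powr (u / 4)) ^ 4" using u27 by (intro power_mono) auto
  also have "\<dots> = a powr u" using a by (simp add: powr_powr flip: powr_realpow)
  finally have 1: "(3 * (u / 4)) ^ 4 \<le> a powr u" .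
  have "(9 * x)\<^sup>2 \<le> u\<^sup>2" "27\<^sup>2 \<le> u\<^sup>2" using t u u27 x by (intro power_mono; simp)+
  then have "27\<^sup>2 * (9 * x)\<^sup>2 \<le> u\<^sup>2 * u\<^sup>2" by (intro mult_mono) auto
  moreover have "(3 * (u / 4)) ^ 4 = 81 / 256 * (u\<^sup>2 * u\<^sup>2)" by (simp add: power2_eq_square power4_eq_xxxx)
  moreover have "1154 * x\<^sup>2 \<le> 81 / 256 * (27\<^sup>2 * (9 * x)\<^sup>2)" by (simp add: power_mult_distrib)
  ultimately have "1154 * x\<^sup>2 \<le> (3 * (u / 4)) ^ 4" by linarith
  then show ?thesis using 1 by (simp add: numeral_3_eq_3 t_def u_def)
qed

text \<open>Used to trade a factor \<open>2 ^ j\<close> at the bottom of a tower for j more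
  levels.\<close>

lemma tow_nat_double:
  fixes a y :: real
  assumes a: "a \<ge> 3" and y: "y \<ge> 1"
  shows "2 ^ j * y \<le> tow_nat a j y"
proof (induction j)
  case (Suc j)
  have "1 \<le> 2 ^ j * y" using y one_le_power[of "2 :: real" j] mult_mono[of 1 "2 ^ j" 1 y] by simp
  then have "3 * tow_nat a j y \<le> tow_nat a (Suc j) y" using Suc three_powr_ge[OF a, of "tow_nat a j y"] by simp
  then show ?case using Suc \<open>1 \<le> 2 ^ j * y\<close> by simp
qed simp

lemma tow_n_le_Tow:
  assumes p: "p \<ge> 3" and r: "real r \<le> tow_nat (real p) h x" and H: "real (k + h) \<le> H"
  shows "real (tow_n p k r) \<le> Tow (real p) H x"
proof -
  have "real (tow_n p k r) \<le> tow_nat p k (tow_nat p h x)"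
    using p r by (simp add: tow_nat_tow_n tow_nat_mono)
  also have "\<dots> = tow_nat p (k + h) x" by (simp add: tow_nat_add)
  also have "\<dots> \<le> tow_nat p (nat \<lceil>H\<rceil>) x"
  proof (rule tow_nat_mono_height)
    show "k + h \<le> nat \<lceil>H\<rceil>" using H by linarith
  qed (use p in auto)
  finally show ?thesis by (simp add: Tow_def)
qed

lemma Tow_ge_base: "a \<ge> 2 \<Longrightarrow> x \<le> Tow a H x"
  using tow_nat_mono_height[of a 0 "nat \<lceil>H\<rceil>" x] by (simp add: Tow_def)

section \<open>Growth along the two increment inequalities\<close>

lemma phase2_step:
  fixes C y \<beta> L :: real
  assumes C: "C \<ge> 1" and y: "y \<ge> 8 + 8 * C" and \<beta>: "\<beta> > 0" and L: "L \<le> 2 * \<beta>"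
  shows "\<exists>D>0. \<beta> * 2 powr (y * (1 + 1 / C)) \<le> D * (\<beta> * 2 powr y) - 8 * D * (8 * D) powr (C / 2) * L"
proof -
  \<comment> \<open>Chosen so that \<open>(8 * D) powr (C / 2)\<close> equals
    \<open>2 powr y / 32\<close>; with L \<le> 2\<beta> the loss is then at most half of D times
    \<open>\<beta> * 2 powr y\<close>. The gain 2(y - 5) / C - 4 left in the exponent is at least y
    / C as soon as y \<ge> 10 + 4C, hence for y \<ge> 8 + 8C.\<close>
  define D where "D = 2 powr ((y - 5) * 2 / C - 3)"
  have D: "D > 0" by (simp add: D_def)
  have "8 * D = 2 powr 3 * D" by (simp add: powr_numeral)
  also have "\<dots> = 2 powr ((y - 5) * 2 / C)" unfolding D_def by (subst powr_add[symmetric]) simp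
  finally have "(8 * D) powr (C / 2) = 2 powr ((y - 5) * 2 / C * (C / 2))" by (simp only: powr_powr)
  also have "(y - 5) * 2 / C * (C / 2) = y - 5" using C by (simp add: field_simps)
  finally have "(8 * D) powr (C / 2) = 2 powr (y - 5)" .
  moreover have "2 powr (y - 5) = 2 powr y / 32"
    using powr_diff[of 2 y 5] by (simp add: powr_numeral)
  ultimately have Q: "(8 * D) powr (C / 2) = 2 powr y / 32" by simp
  have "8 * D * (8 * D) powr (C / 2) * L \<le> 8 * D * (8 * D) powr (C / 2) * (2 * \<beta>)"
    using L D by (intro mult_left_mono) auto
  also have "\<dots> = D * (\<beta> * 2 powr y) / 2" unfolding Q by simp
  finally have 1: "D * (\<beta> * 2 powr y) / 2 \<le> D * (\<beta> * 2 powr y) - 8 * D * (8 * D) powr (C / 2) * L" by linarith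
  have "10 + 4 * C \<le> y" using y C by linarith
  then have "(10 + 4 * C) / C \<le> y / C" using C by (intro divide_right_mono) auto
  then have "10 / C + 4 \<le> y / C" using C by (simp add: add_divide_distrib)
  moreover have "y * (1 + 1 / C) = y + y / C" "(y - 5) * 2 / C = 2 * (y / C) - 10 / C"
    by (simp_all add: algebra_simps diff_divide_distrib)
  ultimately have "y * (1 + 1 / C) \<le> (y - 5) * 2 / C - 3 + (y - 1)" by linarith
  then have "2 powr (y * (1 + 1 / C)) \<le> 2 powr ((y - 5) * 2 / C - 3 + (y - 1))" by (intro powr_mono) auto
  also have "\<dots> = D * (2 powr y / 2)" unfolding powr_add D_def by (simp add: powr_diff)
  finally have "\<beta> * 2 powr (y * (1 + 1 / C)) \<le> \<beta> * (D * (2 powr y / 2))" using \<beta> by (intro mult_left_mono) auto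
  also have "\<dots> = D * (\<beta> * 2 powr y) / 2" by simp
  finally have "\<beta> * 2 powr (y * (1 + 1 / C)) \<le> D * (\<beta> * 2 powr y) / 2" .
  then have "\<beta> * 2 powr (y * (1 + 1 / C)) \<le> D * (\<beta> * 2 powr y) - 8 * D * (8 * D) powr (C / 2) * L"
    using 1 by (rule order_trans)
  then show ?thesis using D by blast
qed

lemma log2_one_plus_ge:
  fixes t :: real assumes "0 \<le> t" "t \<le> 1" shows "t / 2 \<le> log 2 (1 + t)"
proof -
  have "ln (1 / (1 + t)) \<le> 1 / (1 + t) - 1" using assms by (intro ln_le_minus_one) auto
  then have "t / (1 + t) \<le> ln (1 + t)" using assms by (simp add: ln_div field_simps)
  moreover have "t / 2 \<le> t / (1 + t)" using assms by (intro divide_left_mono) auto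
  moreover have "ln (1 + t) \<le> log 2 (1 + t)"
  proof -
    have "ln (2::real) \<le> 1" using ln_le_minus_one[of 2] by simp
    moreover have "ln (1 + t) \<ge> 0" using assms by simp
    ultimately show ?thesis using ln2_ge_half by (simp add: log_def le_divide_eq mult_left_le)
  qed
  ultimately show ?thesis by linarith
qed

text \<open>Each step multiplies y by 1 + 1 / C, whose binary logarithm is at least 1 /
  (2C).\<close>

lemma phase2_length:
  fixes C y Y :: real
  assumes C: "C \<ge> 1" and y: "y > 0" and Y: "Y > 0" and k: "k = nat \<lfloor>2 * C * log 2 (Y / y)\<rfloor>"
  shows "Y < y * (1 + 1 / C) ^ Suc k"
proof -
  have pos: "0 < 1 + 1 / C" using C by (simp add: add_pos_nonneg)
  have "2 * C * log 2 (Y / y) < real (Suc k)" unfolding k by linarith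
  then have "log 2 (Y / y) < real (Suc k) * (1 / C / 2)" using C by (simp add: field_simps)
  also have "\<dots> \<le> real (Suc k) * log 2 (1 + 1 / C)" using C by (intro mult_left_mono log2_one_plus_ge) auto
  also have "\<dots> = log 2 ((1 + 1 / C) ^ Suc k)" using C by (subst log_nat_power) (auto intro: add_pos_nonneg)
  finally have "Y / y < (1 + 1 / C) ^ Suc k" 
    using y Y zero_less_power[OF pos, of "Suc k"] by (subst (asm) log_less_cancel_iff) (auto simp del: power_Suc)
  then show ?thesis using y by (simp add: field_simps)
qed

text \<open>The doubling recursion fixes b + 2\<delta>, so the distance from it doubles.\<close>

lemma phase1_step:
  fixes b \<epsilon> \<delta> :: real
  shows "b + 2 * \<delta> + 2 ^ Suc i * (\<epsilon> - 2 * \<delta>) = 2 * (b + 2 * \<delta> + 2 ^ i * (\<epsilon> - 2 * \<delta>)) - (b + 2 * \<delta>)"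
  by (simp add: algebra_simps)

lemma nat_ceiling_576:
  fixes x :: real
  assumes "x \<ge> 1" "y \<le> 576 * x\<^sup>2"
  shows "real (2 * nat \<lceil>y\<rceil>) \<le> 1154 * x\<^sup>2"
proof -
  have "1 \<le> x\<^sup>2" using assms one_le_power by blast
  moreover have "real (nat \<lceil>y\<rceil>) \<le> 576 * x\<^sup>2 + 1" using assms(2) zero_le_power2[of x] by linarith
  ultimately show ?thesis by simp
qed

section \<open>The three bounds for odd p\<close>

locale popular_difference =
  fixes p :: nat and C \<alpha> \<epsilon> \<beta> :: real
  assumes p: "odd p" "p \<ge> 3" and C: "C \<ge> 1"
    and cnt: "\<And>m X. m \<ge> 1 \<Longrightarrow> X \<subseteq> vecs p m \<Longrightarrow> density p m X powr C * real p ^ (2 * m) \<le> real (ap3_pairs p m X)"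
    and \<alpha>: "0 < \<alpha>" "\<alpha> \<le> 1" and \<epsilon>: "\<epsilon> > 0" and \<beta>: "\<beta> > 0" and \<beta>\<epsilon>: "\<beta> = \<alpha> ^ 3 - \<epsilon>"
begin

lemma bounds: "\<epsilon> < 1" "\<beta> < 1" "\<beta> < \<alpha> ^ 3" "\<alpha> ^ 3 \<le> 1" "\<alpha> ^ 3 \<le> \<alpha>" "\<epsilon> < \<alpha> ^ 3"
  using \<alpha> \<epsilon> \<beta> \<beta>\<epsilon> power_le_one[of \<alpha> 3] power_decreasing[of 1 3 \<alpha>] by auto

lemma np_bound_general:
  assumes T: "(\<alpha> - \<alpha> ^ 3) / \<epsilon> > 2 / 5"
  shows "\<exists>N. np_good p \<alpha> \<beta> N \<and> real N \<le> Tow p (log 2 ((\<alpha> - \<alpha> ^ 3) / \<epsilon>) + 5) (1 / \<epsilon>)"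
proof -
  define T where "T = (\<alpha> - \<alpha> ^ 3) / \<epsilon>"
  \<comment> \<open>The loss 2\<delta> costs a quarter of the initial excess \<epsilon>, and 9 /
    \<delta>^2 is 576 / \<epsilon>^2.\<close>
  define \<delta> where "\<delta> = \<epsilon> / 8"
  define R where "R = nat \<lceil>9 / \<delta>\<^sup>2\<rceil>"
  define s where "s i = \<beta> + 2 * \<delta> + 2 ^ i * (\<epsilon> - 2 * \<delta>)" for i :: nat
  \<comment> \<open>Doubled k + 1 times, the excess 3\<epsilon>/4 has to outgrow 3\<epsilon>/4 +
    \<alpha> - \<alpha>^3, that is, 2^(k + 1) has to exceed 1 + 4T/3.\<close>
  define k where "k = nat \<lfloor>log 2 (1 + 4 * T / 3)\<rfloor>"
  have T0: "T > 2 / 5" using T by (simp add: T_def)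
  have "np_good p \<alpha> \<beta> (tow_n p k (2 * R))"
  proof (rule np_good_increment[OF p _ cnt \<alpha>(1), where \<delta> = \<delta> and s = s])
    show "9 / \<delta>\<^sup>2 \<le> real R" unfolding R_def by linarith
    show "s 0 \<le> \<alpha> ^ 3" by (simp add: s_def \<beta>\<epsilon>)
    show "s (Suc i) \<le> 2 * s i - (\<beta> + 2 * \<delta>) \<or> (\<exists>D>0. s (Suc i) \<le> D * s i - 8 * D * (8 * D) powr (C / 2) * (\<beta> + 2 * \<delta>))" for i
      unfolding s_def phase1_step by simp
    have "log 2 (1 + 4 * T / 3) < real (Suc k)" unfolding k_def by linarith
    then have "1 + 4 * T / 3 < 2 powr (Suc k)" using T0 by (subst (asm) log_less_iff) auto
    then have "1 + 4 * T / 3 < 2 ^ Suc k" by (subst (asm) powr_realpow) auto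
    then have "(3 / 4 * \<epsilon>) * (1 + 4 * T / 3) < (3 / 4 * \<epsilon>) * 2 ^ Suc k" using \<epsilon> by (intro mult_strict_left_mono) auto
    moreover have "(3 / 4 * \<epsilon>) * (1 + 4 * T / 3) = 3 / 4 * \<epsilon> + (\<alpha> - \<alpha> ^ 3)" using \<epsilon> by (simp add: T_def field_simps)
    moreover have "s (Suc k) = \<alpha> ^ 3 - 3 / 4 * \<epsilon> + (3 / 4 * \<epsilon>) * 2 ^ Suc k"
      by (simp add: s_def \<delta>_def \<beta>\<epsilon> field_simps)
    ultimately show "\<alpha> < s (Suc k)" by linarith
  qed (use \<epsilon> C \<beta> bounds in \<open>auto simp: \<delta>_def\<close>)
  moreover have "real (tow_n p k (2 * R)) \<le> Tow p (log 2 T + 5) (1 / \<epsilon>)"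
  proof (rule tow_n_le_Tow[OF p(2)])
    have x: "1 / \<epsilon> \<ge> 1" using \<epsilon> bounds by simp
    have "9 / \<delta>\<^sup>2 \<le> 576 * (1 / \<epsilon>)\<^sup>2" by (simp add: \<delta>_def power_divide)
    then have "real (2 * R) \<le> 1154 * (1 / \<epsilon>)\<^sup>2" unfolding R_def by (rule nat_ceiling_576[OF x])
    also have "\<dots> \<le> tow_nat p 3 (1 / \<epsilon>)" using p by (intro tow_nat_3 x) auto
    finally show "real (2 * R) \<le> tow_nat p 3 (1 / \<epsilon>)" .
    \<comment> \<open>The inequality 1 + 4T/3 \<le> 4T holds from T = 3/8 on, which is why small T
      is treated separately.\<close>
    have "log 2 (1 + 4 * T / 3) \<le> log 2 (2 powr 2 * T)"
      using T0 by (subst log_le_cancel_iff) (auto simp: powr_numeral)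
    also have "\<dots> = log 2 (2 powr 2) + log 2 T" using T0 by (subst log_mult) auto
    also have "log 2 (2 powr 2) = (2 :: real)" by (rule log_powr_cancel) auto
    finally have "log 2 (1 + 4 * T / 3) \<le> 2 + log 2 T" .
    moreover have "0 \<le> log 2 (1 + 4 * T / 3)" using T0 by simp
    ultimately show "real (k + 3) \<le> log 2 T + 5" unfolding k_def by linarith
  qed
  ultimately show ?thesis unfolding T_def by blast
qed

text \<open>With the mean cube density written as \<^term>\<open>\<beta> * 2 powr y\<close>, once
  \<^term>\<open>y \<ge> 8 + 8 * C\<close> each refinement multiplies \<^term>\<open>y\<close> by \<^term>\<open>1 + 1 / C\<close>.\<close>

lemma np_bound_small:
  assumes small: "\<beta> \<le> 2 powr (- 8 - 8 * C) * \<alpha> ^ 3"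
    and H: "2 * C * log 2 (log 2 (\<alpha> / \<beta>) / log 2 (\<alpha> ^ 3 / \<beta>)) + 3 \<le> H"
    and r: "0 \<le> log 2 (log 2 (\<alpha> / \<beta>) / log 2 (\<alpha> ^ 3 / \<beta>))"
  shows "\<exists>N. np_good p \<alpha> \<beta> N \<and> real N \<le> Tow p H (1 / \<beta>)"
proof -
  define y where "y = log 2 (\<alpha> ^ 3 / \<beta>)"
  define Y where "Y = log 2 (\<alpha> / \<beta>)"
  \<comment> \<open>Small against \<beta> rather than \<epsilon>, so that \<beta> + 2\<delta> \<le>
    2\<beta>; hence the base 1 / \<beta> of the tower.\<close>
  define \<delta> where "\<delta> = \<beta> / 8"
  define R where "R = nat \<lceil>9 / \<delta>\<^sup>2\<rceil>"
  define s where "s i = \<beta> * 2 powr (y * (1 + 1 / C) ^ i)" for i :: nat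
  define k where "k = nat \<lfloor>2 * C * log 2 (Y / y)\<rfloor>"
  have "2 powr (8 + 8 * C) \<le> \<alpha> ^ 3 / \<beta>"
    using small \<beta> by (simp add: powr_diff powr_minus powr_add field_simps)
  then have y: "8 + 8 * C \<le> y" unfolding y_def using \<alpha> \<beta> by (subst le_log_iff) auto
  have y0: "y > 0" using y C by linarith
  have "y \<le> Y" unfolding y_def Y_def using \<alpha> \<beta> bounds by (subst log_le_cancel_iff) (auto intro: divide_right_mono)
  then have Y0: "Y > 0" using y0 by linarith
  have 2: "2 powr y = \<alpha> ^ 3 / \<beta>" "2 powr Y = \<alpha> / \<beta>" unfolding y_def Y_def using \<alpha> \<beta> by auto
  have "np_good p \<alpha> \<beta> (tow_n p k (2 * R))"
  proof (rule np_good_increment[OF p _ cnt \<alpha>(1), where \<delta> = \<delta> and s = s])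
    show "9 / \<delta>\<^sup>2 \<le> real R" unfolding R_def by linarith
    show "s 0 \<le> \<alpha> ^ 3" using \<beta> by (simp add: s_def 2)
    show "s (Suc i) \<le> 2 * s i - (\<beta> + 2 * \<delta>) \<or> (\<exists>D>0. s (Suc i) \<le> D * s i - 8 * D * (8 * D) powr (C / 2) * (\<beta> + 2 * \<delta>))" for i
    proof (rule disjI2)
      have "y * 1 \<le> y * (1 + 1 / C) ^ i" using y0 C by (intro mult_left_mono one_le_power) auto
      then have "8 + 8 * C \<le> y * (1 + 1 / C) ^ i" using y by linarith
      moreover have "\<beta> + 2 * \<delta> \<le> 2 * \<beta>" using \<beta> by (simp add: \<delta>_def)
      ultimately show "\<exists>D>0. s (Suc i) \<le> D * s i - 8 * D * (8 * D) powr (C / 2) * (\<beta> + 2 * \<delta>)"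
        using phase2_step[OF C _ \<beta>, of "y * (1 + 1 / C) ^ i" "\<beta> + 2 * \<delta>"] by (simp add: s_def mult_ac)
    qed
    have "2 powr Y < 2 powr (y * (1 + 1 / C) ^ Suc k)" using phase2_length[OF C y0 Y0 k_def] by (intro powr_less_mono) auto
    then have "\<beta> * (\<alpha> / \<beta>) < s (Suc k)" unfolding s_def 2 using \<beta> by (intro mult_strict_left_mono) auto
    then show "\<alpha> < s (Suc k)" using \<beta> by simp
  qed (use \<beta> C bounds in \<open>auto simp: \<delta>_def\<close>)
  moreover have "real (tow_n p k (2 * R)) \<le> Tow p H (1 / \<beta>)"
  proof (rule tow_n_le_Tow[OF p(2)])
    have x: "1 / \<beta> \<ge> 1" using \<beta> bounds by simp
    have "9 / \<delta>\<^sup>2 \<le> 576 * (1 / \<beta>)\<^sup>2" by (simp add: \<delta>_def power_divide)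
    then have "real (2 * R) \<le> 1154 * (1 / \<beta>)\<^sup>2" unfolding R_def by (rule nat_ceiling_576[OF x])
    also have "\<dots> \<le> tow_nat p 3 (1 / \<beta>)" using p by (intro tow_nat_3 x) auto
    finally show "real (2 * R) \<le> tow_nat p 3 (1 / \<beta>)" .
    have "0 \<le> 2 * C * log 2 (Y / y)" using r C by (simp add: y_def Y_def)
    then show "real (k + 3) \<le> H" using H unfolding k_def y_def[symmetric] Y_def[symmetric] by linarith
  qed
  ultimately show ?thesis by blast
qed

lemma np_bound_middle:
  assumes \<beta>1: "2 powr (- 8 - 8 * C) * \<alpha> ^ 3 < \<beta>" and \<beta>2: "\<beta> \<le> 2 powr (- 8 - 8 * C) * \<alpha>"
    and Z: "log 2 (log 2 (\<alpha> / \<beta>) / (8 + 8 * C)) \<le> Z"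
    and H: "log 2 (\<beta> / \<epsilon>) + 2 * C * Z + 54 * C \<le> H"
  shows "\<exists>N. np_good p \<alpha> \<beta> N \<and> real N \<le> Tow p H (1 / \<epsilon>)"
proof -
  define y where "y = 8 + 8 * C"
  define Y where "Y = log 2 (\<alpha> / \<beta>)"
  \<comment> \<open>Doubling needs \<delta> small against \<epsilon>, growth of the exponent needs
    it small against \<beta>.\<close>
  define \<mu> where "\<mu> = min \<epsilon> \<beta>"
  define \<delta> where "\<delta> = \<mu> / 8"
  define R where "R = nat \<lceil>9 / \<delta>\<^sup>2\<rceil>"
  define k1 where "k1 = nat \<lceil>y + log 2 (\<beta> / \<epsilon>) + 1\<rceil>"
  define k2 where "k2 = nat \<lfloor>2 * C * log 2 (Y / y)\<rfloor>"
  define s1 where "s1 i = \<beta> + 2 * \<delta> + 2 ^ i * (\<epsilon> - 2 * \<delta>)" for i :: nat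
  define s2 where "s2 i = \<beta> * 2 powr (y * (1 + 1 / C) ^ i)" for i :: nat
  \<comment> \<open>At \<open>k1\<close> the sequence may drop in passing from \<open>s1\<close> to
    \<open>s2\<close>, which is harmless because it only has to stay below the mean cubes and
    \<open>s2 0\<close> is at most \<open>s1 k1\<close>.\<close>
  define s where "s i = (if i < k1 then s1 i else s2 (i - k1))" for i
  have y0: "y > 0" using C by (simp add: y_def)
  have minus: "2 powr (- 8 - 8 * C) = 1 / 2 powr y"
    unfolding y_def by (simp add: powr_diff powr_minus powr_add field_simps)
  have "2 powr y \<le> \<alpha> / \<beta>" using \<beta>2 \<beta> unfolding minus by (simp add: field_simps)
  then have yY: "y \<le> Y" unfolding Y_def using \<alpha> \<beta> by (subst le_log_iff) auto
  have Y0: "Y > 0" using yY y0 by linarith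
  have 2: "2 powr Y = \<alpha> / \<beta>" unfolding Y_def using \<alpha> \<beta> by auto
  have "1 / 2 powr y * \<epsilon> \<le> 1 / 2 powr y * \<alpha> ^ 3" using bounds by (intro mult_left_mono) auto
  also have "\<dots> < \<beta>" using \<beta>1 unfolding minus .
  finally have \<epsilon>\<beta>: "\<epsilon> < 2 powr y * \<beta>" by (simp add: field_simps)
  then have "log 2 \<epsilon> < log 2 (2 powr y * \<beta>)" using \<epsilon> \<beta> by (subst log_less_cancel_iff) auto
  \<comment> \<open>The logarithm may be negative; this bound keeps the number under the ceiling in
    \<open>k1\<close> positive.\<close>
  then have lo: "- y < log 2 (\<beta> / \<epsilon>)" using \<epsilon> \<beta> by (simp add: log_mult log_divide)
  have \<mu>: "0 < \<mu>" "\<mu> \<le> \<epsilon>" "\<mu> \<le> \<beta>" using \<epsilon> \<beta> by (auto simp: \<mu>_def)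
  have s1k: "2 powr y * \<beta> \<le> s1 k1"
  proof -
    have "y + log 2 (\<beta> / \<epsilon>) + 1 \<le> k1" unfolding k1_def by linarith
    then have "2 powr (y + log 2 (\<beta> / \<epsilon>) + 1) \<le> 2 powr k1" by (intro powr_mono) auto
    then have "2 powr y * (\<beta> / \<epsilon>) * 2 \<le> 2 ^ k1" using \<epsilon> \<beta> by (simp add: powr_add powr_realpow)
    then have "2 powr y * \<beta> * 2 \<le> 2 ^ k1 * \<epsilon>" using \<epsilon> by (simp add: field_simps)
    moreover have "2 ^ k1 * (\<epsilon> / 2) \<le> 2 ^ k1 * (\<epsilon> - 2 * \<delta>)" using \<mu> by (intro mult_left_mono) (auto simp: \<delta>_def)
    moreover have "0 \<le> \<delta>" using \<mu> by (simp add: \<delta>_def)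
    ultimately show ?thesis unfolding s1_def using \<beta> by linarith
  qed
  have s20: "s2 0 = 2 powr y * \<beta>" by (simp add: s2_def)
  have s_le: "s i \<le> s1 i" if "i \<le> k1" for i
    using that s1k s20 by (cases "i < k1") (auto simp: s_def)
  have "np_good p \<alpha> \<beta> (tow_n p (k1 + k2) (2 * R))"
  proof (rule np_good_increment[OF p _ cnt \<alpha>(1), where \<delta> = \<delta> and s = s])
    show "9 / \<delta>\<^sup>2 \<le> real R" unfolding R_def by linarith
    have "s1 0 = \<alpha> ^ 3" by (simp add: s1_def \<beta>\<epsilon>)
    then show "s 0 \<le> \<alpha> ^ 3" using s_le[of 0] by simp
    show "s (Suc i) \<le> 2 * s i - (\<beta> + 2 * \<delta>) \<or> (\<exists>D>0. s (Suc i) \<le> D * s i - 8 * D * (8 * D) powr (C / 2) * (\<beta> + 2 * \<delta>))" for i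
    proof (cases "i < k1")
      case True
      then have "s (Suc i) \<le> s1 (Suc i)" by (intro s_le) simp
      also have "\<dots> = 2 * s i - (\<beta> + 2 * \<delta>)" using True unfolding s_def s1_def phase1_step by simp
      finally show ?thesis by blast
    next
      case False
      define j where "j = i - k1"
      have sj: "s i = s2 j" "s (Suc i) = s2 (Suc j)" using False by (auto simp: s_def j_def Suc_diff_le)
      have "y * 1 \<le> y * (1 + 1 / C) ^ j" using y0 C by (intro mult_left_mono one_le_power) auto
      then have "8 + 8 * C \<le> y * (1 + 1 / C) ^ j" by (simp add: y_def)
      moreover have "\<beta> + 2 * \<delta> \<le> 2 * \<beta>" using \<mu> by (simp add: \<delta>_def)
      ultimately have "\<exists>D>0. s2 (Suc j) \<le> D * s2 j - 8 * D * (8 * D) powr (C / 2) * (\<beta> + 2 * \<delta>)"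
        using phase2_step[OF C _ \<beta>, of "y * (1 + 1 / C) ^ j" "\<beta> + 2 * \<delta>"] by (simp add: s2_def mult_ac)
      then show ?thesis unfolding sj by (rule disjI2)
    qed
    have "2 powr Y < 2 powr (y * (1 + 1 / C) ^ Suc k2)" using phase2_length[OF C y0 Y0 k2_def] by (intro powr_less_mono) auto
    then have "\<beta> * (\<alpha> / \<beta>) < s2 (Suc k2)" unfolding s2_def 2 using \<beta> by (intro mult_strict_left_mono) auto
    moreover have "s (Suc (k1 + k2)) = s2 (Suc k2)" by (simp add: s_def)
    ultimately show "\<alpha> < s (Suc (k1 + k2))" using \<beta> by simp
  qed (use \<mu> \<beta> C bounds in \<open>auto simp: \<delta>_def\<close>)
  moreover have "real (tow_n p (k1 + k2) (2 * R)) \<le> Tow p H (1 / \<epsilon>)"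
  proof (rule tow_n_le_Tow[OF p(2)])
    \<comment> \<open>If \<beta> < \<epsilon>, then 1 / \<mu> exceeds 1 / \<epsilon>, but at most by
      the factor \<open>2 powr y\<close>; its square is paid for with j levels.\<close>
    define j where "j = nat \<lceil>2 * y\<rceil>"
    define x where "x = 2 powr y / \<epsilon>"
    have x1: "1 / \<epsilon> \<ge> 1" using \<epsilon> bounds by simp
    have y1: "1 \<le> 2 powr y" using y0 by (intro ge_one_powr_ge_zero) auto
    have x: "x \<ge> 1" using x1 y1 mult_mono[of 1 "2 powr y" 1 "1 / \<epsilon>"] by (simp add: x_def)
    have "1 / \<mu> \<le> x"
    proof -
      have "\<epsilon> * 1 \<le> \<epsilon> * 2 powr y" using y1 \<epsilon> by (intro mult_left_mono) auto
      then have "\<epsilon> \<le> 2 powr y * \<mu>" using \<epsilon>\<beta> by (auto simp: \<mu>_def min_def mult.commute)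
      then show ?thesis using \<mu> \<epsilon> by (simp add: x_def field_simps)
    qed
    then have "(1 / \<mu>)\<^sup>2 \<le> x\<^sup>2" using \<mu> by (intro power_mono) auto
    then have "9 / \<delta>\<^sup>2 \<le> 576 * x\<^sup>2" by (simp add: \<delta>_def power_divide)
    then have "real (2 * R) \<le> 1154 * x\<^sup>2" unfolding R_def by (rule nat_ceiling_576[OF x])
    also have "\<dots> = 2 powr (2 * y) * (1154 * (1 / \<epsilon>)\<^sup>2)"
      by (simp add: x_def power_divide powr_powr[symmetric] powr_power mult.commute flip: powr_numeral)
    also have "\<dots> \<le> 2 ^ j * (1154 * (1 / \<epsilon>)\<^sup>2)"
    proof (rule mult_right_mono)
      have "2 powr (2 * y) \<le> 2 powr j" unfolding j_def by (intro powr_mono) linarith+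
      then show "2 powr (2 * y) \<le> 2 ^ j" by (simp add: powr_realpow)
    qed simp
    also have "\<dots> \<le> 2 ^ j * tow_nat p 3 (1 / \<epsilon>)" using p by (intro mult_left_mono tow_nat_3 x1) auto
    also have "\<dots> \<le> tow_nat p j (tow_nat p 3 (1 / \<epsilon>))"
    proof (rule tow_nat_double)
      show "1 \<le> tow_nat p 3 (1 / \<epsilon>)"
        using tow_nat_3[of "real p", OF _ x1] p one_le_power[OF x1, of 2] by linarith
    qed (use p in simp)
    also have "\<dots> = tow_nat p (j + 3) (1 / \<epsilon>)" by (simp add: tow_nat_add)
    finally show "real (2 * R) \<le> tow_nat p (j + 3) (1 / \<epsilon>)" .
    have "real k1 \<le> y + log 2 (\<beta> / \<epsilon>) + 2" unfolding k1_def using lo by linarith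
    moreover have "real j \<le> 2 * y + 1" unfolding j_def using y0 by linarith
    moreover have "real k2 \<le> 2 * C * Z"
    proof -
      have "1 \<le> Y / y" using yY y0 by simp
      then have "0 \<le> 2 * C * log 2 (Y / y)" using C by simp
      then have "real k2 \<le> 2 * C * log 2 (Y / y)" unfolding k2_def by linarith
      also have "\<dots> \<le> 2 * C * Z" using Z C by (intro mult_left_mono) (auto simp: Y_def y_def)
      finally show ?thesis .
    qed
    \<comment> \<open>The doubling steps and the base together cost 3y + 6 levels beyond the
      logarithm, and 30 + 24C is at most 54C.\<close>
    moreover have "3 * y + 6 \<le> 54 * C" using C by (simp add: y_def)
    ultimately show "real (k1 + k2 + (j + 3)) \<le> H" using H by simp
  qed
  ultimately show ?thesis by blast
qed

end

text \<open>The union bound suffices if (1 - \<alpha>)^2 (2 + \<alpha>) \<le> \<epsilon>. A ratio of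
  at most 2/5 forces \<alpha> \<ge> 1/2, so that \<alpha> - \<alpha>^3 is at least 3(1 - \<alpha>)/4
  and therefore 1 - \<alpha> is at most 8\<epsilon>/15.\<close>

lemma np_bound_trivial:
  assumes p: "p > 1" and \<alpha>: "0 < \<alpha>" "\<alpha> \<le> 1" and \<epsilon>: "0 < \<epsilon>" "\<epsilon> < \<alpha> ^ 3"
    and T: "(\<alpha> - \<alpha> ^ 3) / \<epsilon> \<le> 2 / 5"
  shows "np_good p \<alpha> (\<alpha> ^ 3 - \<epsilon>) 1"
proof (rule np_good_one[OF p])
  have le: "\<alpha> - \<alpha> ^ 3 \<le> 2 / 5 * \<epsilon>" using T \<epsilon> by (simp add: field_simps)
  have e1: "\<epsilon> \<le> 1" using \<epsilon> power_le_one[of \<alpha> 3] \<alpha> by linarith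
  have cube: "\<alpha> ^ 3 = \<alpha> * \<alpha>\<^sup>2" by (simp add: power3_eq_cube power2_eq_square)
  have half: "1 / 2 \<le> \<alpha>"
  proof (rule ccontr)
    assume "\<not> ?thesis"
    then have "\<alpha>\<^sup>2 \<le> (1 / 2)\<^sup>2" using \<alpha> by (intro power_mono) auto
    then have "\<alpha> * \<alpha>\<^sup>2 \<le> \<alpha> * (1 / 4)" using \<alpha> by (intro mult_left_mono) (auto simp: power2_eq_square)
    then show False using le \<epsilon> \<alpha> unfolding cube by linarith
  qed
  have "(1 - \<alpha>) * (3 / 4) \<le> (1 - \<alpha>) * (\<alpha> * (1 + \<alpha>))"
    using half \<alpha> mult_mono[of "1/2" \<alpha> "3/2" "1 + \<alpha>"] by (intro mult_left_mono) auto
  also have "\<dots> = \<alpha> - \<alpha> ^ 3" by (simp add: algebra_simps power3_eq_cube)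
  finally have d: "1 - \<alpha> \<le> 8 / 15 * \<epsilon>" using le by simp
  have "(1 - \<alpha>) * (1 - \<alpha>) \<le> (8 / 15 * \<epsilon>) * (8 / 15)" using d e1 \<alpha> by (intro mult_mono) auto
  then have "(1 - \<alpha>) * (1 - \<alpha>) * (2 + \<alpha>) \<le> ((8 / 15 * \<epsilon>) * (8 / 15)) * 3"
  proof (rule mult_mono)
    show "2 + \<alpha> \<le> 3" "0 \<le> 8 / 15 * \<epsilon> * (8 / 15)" "0 \<le> 2 + \<alpha>" using \<alpha> \<epsilon> by auto
  qed
  then show "\<alpha> ^ 3 - \<epsilon> \<le> 3 * \<alpha> - 2" using \<epsilon> by (simp add: algebra_simps power3_eq_cube)
qed

text \<open>A single exponential is enough in characteristic two, and any positive height rounds up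
  to at least one level.\<close>

lemma np_bound_char_two:
  assumes \<alpha>: "0 < \<alpha>" and \<beta>: "\<beta> \<le> \<alpha> ^ 3" and x: "1 / \<alpha> \<le> x" "1 \<le> x" and H: "H > 0"
  shows "\<exists>N. np_good 2 \<alpha> \<beta> N \<and> real N \<le> Tow 2 H x"
proof -
  define N where "N = nat \<lceil>1 / \<alpha>\<rceil>"
  have N: "1 / \<alpha> \<le> N" "real N \<le> 1 / \<alpha> + 1" unfolding N_def using \<alpha> by (auto simp: of_nat_ceiling) 
  have "0 < 1 / \<alpha>" using \<alpha> by simp
  then have N1: "N \<ge> 1" using N by (cases N) auto
  have "1 + N \<le> 2 ^ N" using less_exp[of N] by linarith
  then have "real (1 + N) \<le> real (2 ^ N)" by (rule of_nat_mono)
  then have "1 + real N \<le> 2 ^ N" by simp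
  then have "1 + 1 / \<alpha> \<le> 2 ^ N" using N(1) by linarith
  then have "np_good 2 \<alpha> \<beta> N" using np_good_char_two[OF \<alpha> \<beta> N1] by simp
  moreover have "real N \<le> Tow 2 H x"
  proof -
    have "1 + (x - 1) / 2 \<le> 1 + (x - 1) * ln 2" using ln2_ge_half x mult_left_mono[of "1/2" "ln 2" "x - 1"] by simp
    also have "\<dots> \<le> exp ((x - 1) * ln 2)" by (rule exp_ge_add_one_self)
    also have "\<dots> = 2 powr (x - 1)" by (simp add: powr_def)
    also have "\<dots> = 2 powr x / 2" by (simp add: powr_diff)
    finally have "x + 1 \<le> 2 powr x" by (simp add: field_simps)
    then have "real N \<le> 2 powr x" using N(2) x(1) by (meson add_right_mono order_trans)
    also have "\<dots> = tow_nat 2 1 x" by simp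
    also have "\<dots> \<le> tow_nat 2 (nat \<lceil>H\<rceil>) x" using H by (intro tow_nat_mono_height) linarith+
    finally show ?thesis by (simp add: Tow_def)
  qed
  ultimately show ?thesis by blast
qed

section \<open>Absorbing additive constants into the heights\<close>

lemma n_p_le: "np_good p \<alpha> \<beta> N \<Longrightarrow> real N \<le> t \<Longrightarrow> real (n_p p \<alpha> \<beta>) \<le> t"
  using Least_le[of "np_good p \<alpha> \<beta>" N] unfolding n_p_def by linarith

text \<open>Here log(\<alpha>/\<beta>) is at least 8 + 8C and C at least log p, so
  log_p(\<alpha>/\<beta>) \<ge> 8 and Z \<ge> 3. The additive 54C is thus at most 18CZ, which
  together with 2CZ makes the constant 20.\<close>

lemma height_middle:
  fixes p C \<alpha> \<beta> c :: real
  assumes p: "p \<ge> 2" and C: "1 \<le> C" "log 2 p \<le> C" "C \<le> c * log 2 p" and pos: "\<alpha> > 0" "\<beta> > 0"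
    and \<beta>: "\<beta> \<le> 2 powr (- 8 - 8 * C) * \<alpha>" and c: "c > 0"
  defines "Z \<equiv> log 2 (log p (\<alpha> / \<beta>))"
  shows "log 2 (log 2 (\<alpha> / \<beta>) / (8 + 8 * C)) \<le> Z" "2 * C * Z + 54 * C \<le> 20 * c * log 2 p * Z"
proof -
  define Y where "Y = log 2 (\<alpha> / \<beta>)"
  have L: "log 2 p \<ge> 1" using p by (simp add: le_log_iff)
  have "2 powr (8 + 8 * C) \<le> \<alpha> / \<beta>"
    using \<beta> pos by (simp add: powr_diff powr_minus powr_add field_simps)
  then have Y: "8 + 8 * C \<le> Y" unfolding Y_def using pos by (subst le_log_iff) auto
  have Zeq: "Z = log 2 (Y / log 2 p)"
    unfolding Z_def Y_def using p by (simp add: log_base_change[of 2 p])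
  have "8 * log 2 p \<le> Y" using Y C by linarith
  then have 8: "8 \<le> Y / log 2 p" using L by (simp add: le_divide_eq)
  have "log 2 (2 powr 3) \<le> log 2 (Y / log 2 p)" using 8 by (subst log_le_cancel_iff) (auto simp: powr_numeral)
  then have Z: "3 \<le> Z" unfolding Zeq by (subst (asm) log_powr_cancel) auto
  have "Y / (8 + 8 * C) \<le> Y / log 2 p" using C L Y by (intro divide_left_mono) auto
  then show "log 2 (log 2 (\<alpha> / \<beta>) / (8 + 8 * C)) \<le> Z"
    unfolding Zeq Y_def[symmetric] using C L Y 8 by (subst log_le_cancel_iff) auto
  have "C * 54 \<le> C * (18 * Z)" using Z C by (intro mult_left_mono) auto
  then have "2 * C * Z + 54 * C \<le> 20 * (C * Z)" by simp
  also have "C * Z \<le> c * log 2 p * Z" using C Z by (intro mult_right_mono) auto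
  finally show "2 * C * Z + 54 * C \<le> 20 * c * log 2 p * Z" by (simp add: mult_ac)
qed

text \<open>With l = -log \<alpha> and y = log(\<alpha>^3/\<beta>) the ratio is 1 + 2l / y, and
  \<beta> \<ge> \<alpha>^C / 2 gives y \<le> C l. So the ratio is at least 1 + 1 / C, its logarithm
  at least 1 / (2C), and the additive 3 is at most 6C times that logarithm.\<close>

lemma height_small:
  fixes p C \<alpha> \<beta> c :: real
  assumes p: "p \<ge> 2" and C: "1 \<le> C" "C \<le> c * log 2 p" and \<alpha>: "0 < \<alpha>" "\<alpha> \<le> 1" and \<beta>0: "\<beta> > 0"
    and \<beta>: "\<beta> \<le> 2 powr (- 8 - 8 * C) * \<alpha> ^ 3" and low: "\<alpha> powr C / 2 \<le> \<beta>"
  defines "r \<equiv> log 2 (\<alpha> / \<beta>) / log 2 (\<alpha> ^ 3 / \<beta>)"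
  shows "0 \<le> log 2 r" "2 * C * log 2 r + 3 \<le> 20 * c * log 2 p * log 2 r"
proof -
  define y where "y = log 2 (\<alpha> ^ 3 / \<beta>)"
  define l where "l = - log 2 \<alpha>"
  have "2 powr (8 + 8 * C) \<le> \<alpha> ^ 3 / \<beta>"
    using \<beta> \<beta>0 by (simp add: powr_diff powr_minus powr_add field_simps)
  then have y: "8 + 8 * C \<le> y" unfolding y_def using \<alpha> \<beta>0 by (subst le_log_iff) auto
  have "log 2 (\<alpha> powr C / 2) \<le> log 2 \<beta>" using low \<alpha> \<beta>0 by (subst log_le_cancel_iff) auto
  then have b: "- C * l - 1 \<le> log 2 \<beta>" using \<alpha> by (simp add: log_divide log_powr l_def)
  have yl: "y = - 3 * l - log 2 \<beta>" using \<alpha> \<beta>0 by (simp add: y_def log_divide log_nat_power l_def)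
  have l0: "0 \<le> l" using \<alpha> by (simp add: l_def)
  have "8 + 8 * C \<le> C * l + 1 - 3 * l" using y yl b by linarith
  then have "C * 8 \<le> C * l" using l0 by linarith
  then have l8: "8 \<le> l" using C by simp
  have yC: "y \<le> C * l" using yl b l8 by linarith
  have r: "r = 1 + 2 * l / y"
  proof -
    have "log 2 (\<alpha> / \<beta>) = y + 2 * l" using \<alpha> \<beta>0 unfolding yl by (simp add: log_divide l_def)
    then show ?thesis using y C by (simp add: r_def y_def[symmetric] add_divide_distrib)
  qed
  have "1 / C \<le> 2 * l / y"
  proof -
    have "0 \<le> C * l" using C l0 by simp
    then have "y \<le> C * (2 * l)" using yC by linarith
    then show ?thesis using y C by (simp add: field_simps)
  qed
  moreover have "0 < 1 / C" using C by simp
  ultimately have "log 2 (1 + 1 / C) \<le> log 2 r" unfolding r by (subst log_le_cancel_iff) linarith+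
  moreover have "1 / C / 2 \<le> log 2 (1 + 1 / C)" using C by (intro log2_one_plus_ge) auto
  ultimately have lr: "1 / C / 2 \<le> log 2 r" by linarith
  then show r0: "0 \<le> log 2 r" using C by (meson divide_nonneg_pos order_trans zero_le_one zero_less_numeral less_le_trans zero_less_one)
  have "6 * C * (1 / C / 2) \<le> 6 * C * log 2 r" using lr C by (intro mult_left_mono) auto
  then have "2 * C * log 2 r + 3 \<le> 8 * (C * log 2 r)" using C by simp
  also have "\<dots> \<le> 20 * (C * log 2 r)" using r0 C by (intro mult_right_mono mult_nonneg_nonneg) auto
  also have "C * log 2 r \<le> c * log 2 p * log 2 r" using C r0 by (intro mult_right_mono) auto
  finally show "2 * C * log 2 r + 3 \<le> 20 * c * log 2 p * log 2 r" by (simp add: mult_ac)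
qed

theorem theorem6:
  fixes C :: "nat \<Rightarrow> real"
  assumes C_ge1: "\<forall>p. prime p \<longrightarrow> C p \<ge> 1"
    and C_count: "\<forall>p m X. prime p \<and> m \<ge> 1 \<and> X \<subseteq> vecs p m \<longrightarrow>
        real (ap3_pairs p m X) \<ge> density p m X powr C p * real p ^ (2 * m)"
    and C_theta: "\<exists>c1 c2. c1 > 0 \<and> c2 > 0 \<and>
        (\<forall>p. prime p \<longrightarrow> c1 * log 2 p \<le> C p \<and> C p \<le> c2 * log 2 p)"
  shows "\<exists>K::real. \<forall>(p::nat) (\<alpha>::real) (\<epsilon>::real).
     prime p \<and> 0 < \<alpha> \<and> \<alpha> \<le> 1 \<and> \<epsilon> > 0 \<and> \<alpha> ^ 3 - \<epsilon> \<ge> \<alpha> powr C p / 2 \<longrightarrow>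
     (let \<beta> = \<alpha> ^ 3 - \<epsilon> in
       (\<exists>N. np_good p \<alpha> \<beta> N) \<and>
       real (n_p p \<alpha> \<beta>) \<le> Tow p (log 2 ((\<alpha> - \<alpha> ^ 3) / \<epsilon>) + 5) (1 / \<epsilon>) \<and>
       (2 powr (- 8 - 8 * C p) * \<alpha> ^ 3 < \<beta> \<and> \<beta> \<le> 2 powr (- 8 - 8 * C p) * \<alpha> \<longrightarrow>
          real (n_p p \<alpha> \<beta>) \<le>
            Tow p (log 2 (\<beta> / \<epsilon>) + K * log 2 p * log 2 (log p (\<alpha> / \<beta>))) (1 / \<epsilon>)) \<and>
       (\<beta> \<le> 2 powr (- 8 - 8 * C p) * \<alpha> ^ 3 \<longrightarrow>
          real (n_p p \<alpha> \<beta>) \<le>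
            Tow p (K * log 2 p * log 2 (log 2 (\<alpha> / \<beta>) / log 2 (\<alpha> ^ 3 / \<beta>))) (1 / \<beta>)))"
proof -
  obtain c1 c2 where c: "c2 > 0" "\<And>p. prime p \<Longrightarrow> C p \<le> c2 * log 2 p"
    using C_theta by blast
  show ?thesis
  \<comment> \<open>The factor 20 comes from the two height comparisons, c2 from the upper bound of
    C by log p.\<close>
  proof (intro exI[of _ "20 * c2"] allI impI)
    fix p :: nat and \<alpha> \<epsilon> :: real
    assume asm: "prime p \<and> 0 < \<alpha> \<and> \<alpha> \<le> 1 \<and> \<epsilon> > 0 \<and> \<alpha> ^ 3 - \<epsilon> \<ge> \<alpha> powr C p / 2"
    define \<beta> where "\<beta> = \<alpha> ^ 3 - \<epsilon>"
    have pr: "prime p" and \<alpha>: "0 < \<alpha>" "\<alpha> \<le> 1" and \<epsilon>: "\<epsilon> > 0" and low: "\<alpha> powr C p / 2 \<le> \<beta>"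
      using asm by (auto simp: \<beta>_def)
    have "0 < \<alpha> powr C p / 2" using \<alpha> by simp
    then have \<beta>: "\<beta> > 0" using low by linarith
    have C1: "C p \<ge> 1" using C_ge1 pr by blast
    have Cc: "C p \<le> c2 * log 2 p" using c pr by blast
    have p2: "real p \<ge> 2" using prime_ge_2_nat[OF pr] by simp
    have L1: "log 2 p \<ge> 1" using p2 by (simp add: le_log_iff)
    have cnt: "density p m X powr C p * real p ^ (2 * m) \<le> real (ap3_pairs p m X)"
      if "m \<ge> 1" "X \<subseteq> vecs p m" for m X
      using C_count that pr by blast
    have cube: "\<alpha> ^ 3 \<le> \<alpha>" "\<alpha> ^ 3 \<le> 1" using \<alpha> power_decreasing[of 1 3 \<alpha>] power_le_one[of \<alpha> 3] by auto
    have \<epsilon>\<alpha>: "\<epsilon> < \<alpha> ^ 3" using \<beta> by (simp add: \<beta>_def)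
    have \<beta>\<alpha>: "\<beta> \<le> \<alpha> ^ 3" using \<epsilon> by (simp add: \<beta>_def)
    have x: "1 \<le> 1 / \<epsilon>" "1 / \<alpha> \<le> 1 / \<epsilon>" "1 \<le> 1 / \<beta>" "1 / \<alpha> \<le> 1 / \<beta>"
      using \<epsilon> \<beta> \<alpha> \<epsilon>\<alpha> \<beta>\<alpha> cube by (auto intro!: divide_left_mono)
    have two: "\<exists>N. np_good p \<alpha> \<beta> N \<and> real N \<le> Tow p H y" if "p = 2" "1 / \<alpha> \<le> y" "1 \<le> y" "H > 0" for H y
      using np_bound_char_two[OF \<alpha>(1) \<beta>\<alpha> that(2-4)] that(1) by simp
    have odd: "popular_difference p (C p) \<alpha> \<epsilon> \<beta>" if "p \<noteq> 2"
    proof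
      show "odd p" using prime_odd_nat[OF pr] that p2 by simp
      then show "3 \<le> p" using that p2 by linarith
    qed (use C1 cnt \<alpha> \<epsilon> \<beta> \<beta>_def in auto)
    \<comment> \<open>For p = 2 the logarithm is 1; for odd p the sphere construction
      applies.\<close>
    have LC: "log 2 p \<le> C p"
    proof (cases "p = 2")
      case False
      then interpret popular_difference p "C p" \<alpha> \<epsilon> \<beta> by (rule odd)
      show ?thesis by (rule exponent_lower_bound[OF p C1 cnt])
    qed (use C1 in simp)
    have 1: "\<exists>N. np_good p \<alpha> \<beta> N \<and> real N \<le> Tow p (log 2 ((\<alpha> - \<alpha> ^ 3) / \<epsilon>) + 5) (1 / \<epsilon>)"
    proof (cases "(\<alpha> - \<alpha> ^ 3) / \<epsilon> \<le> 2 / 5")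
      case True
      have "np_good p \<alpha> \<beta> 1"
        unfolding \<beta>_def using np_bound_trivial[OF _ \<alpha> \<epsilon> \<epsilon>\<alpha> True] p2 by simp
      \<comment> \<open>A tower is at least its base 1 / \<epsilon> whatever the height, which
        covers negative heights and also \<alpha> = 1, where the logarithm is taken at 0.\<close>
      moreover have "real 1 \<le> Tow p (log 2 ((\<alpha> - \<alpha> ^ 3) / \<epsilon>) + 5) (1 / \<epsilon>)"
        using Tow_ge_base[OF p2, of "1 / \<epsilon>"] x(1) order_trans by auto
      ultimately show ?thesis by blast
    next
      case T: False
      show ?thesis
      proof (cases "p = 2")
        case True
        have "log 2 t + 5 > 0" if "t > 2 / 5" for t :: real
        proof -
          have "log 2 (2 powr (- 2)) < log 2 t"
            using that by (subst log_less_cancel_iff) (auto simp: powr_minus powr_numeral)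
          then show ?thesis by (subst (asm) log_powr_cancel) auto
        qed
        then have "log 2 ((\<alpha> - \<alpha> ^ 3) / \<epsilon>) + 5 > 0" using T by (meson not_le)
        then show ?thesis using True x by (intro two) auto
      next
        case False
        then interpret popular_difference p "C p" \<alpha> \<epsilon> \<beta> by (rule odd)
        show ?thesis using T by (intro np_bound_general) simp
      qed
    qed
    have 2: "\<exists>N. np_good p \<alpha> \<beta> N \<and> real N \<le> Tow p (log 2 (\<beta> / \<epsilon>) + 20 * c2 * log 2 p * log 2 (log p (\<alpha> / \<beta>))) (1 / \<epsilon>)"
      if b: "2 powr (- 8 - 8 * C p) * \<alpha> ^ 3 < \<beta>" "\<beta> \<le> 2 powr (- 8 - 8 * C p) * \<alpha>"
    proof -
      define Z where "Z = log 2 (log p (\<alpha> / \<beta>))"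
      note h = height_middle[OF p2 C1 LC Cc \<alpha>(1) \<beta> b(2) c(1), folded Z_def]
      show ?thesis unfolding Z_def[symmetric]
      proof (cases "p = 2")
        case True
        \<comment> \<open>For p = 2 the height just has to be positive: log(\<beta>/\<epsilon>) is
          at least -8 - 8C, which the term 54C outweighs.\<close>
        have "2 powr (- 8 - 8 * C p) * \<epsilon> \<le> 2 powr (- 8 - 8 * C p) * \<alpha> ^ 3" using \<epsilon>\<alpha> by (intro mult_left_mono) auto
        then have "2 powr (- 8 - 8 * C p) * \<epsilon> \<le> \<beta>" using b(1) by linarith
        then have "2 powr (- 8 - 8 * C p) \<le> \<beta> / \<epsilon>" using \<epsilon> by (simp add: le_divide_eq)
        then have "- 8 - 8 * C p \<le> log 2 (\<beta> / \<epsilon>)" using \<beta> \<epsilon> by (subst le_log_iff) auto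
        moreover have "0 \<le> 2 * C p * Z"
        proof -
          have "C p \<le> log 2 (\<alpha> / \<beta>)"
          proof -
            have "2 powr (C p) \<le> 2 powr (8 + 8 * C p)" using C1 by (intro powr_mono) auto
            also have "\<dots> \<le> \<alpha> / \<beta>" using b \<beta> by (simp add: powr_diff powr_minus powr_add field_simps)
            finally show ?thesis using \<alpha> \<beta> by (subst le_log_iff) auto
          qed
          then have "1 \<le> log p (\<alpha> / \<beta>)" using True C1 by simp
          then show ?thesis using C1 by (simp add: Z_def)
        qed
        ultimately have "log 2 (\<beta> / \<epsilon>) + 20 * c2 * log 2 p * Z > 0" using h(2) C1 by linarith
        then show "\<exists>N. np_good p \<alpha> \<beta> N \<and> real N \<le> Tow p (log 2 (\<beta> / \<epsilon>) + 20 * c2 * log 2 p * Z) (1 / \<epsilon>)"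
          using True x by (intro two) auto
      next
        case False
        then interpret popular_difference p "C p" \<alpha> \<epsilon> \<beta> by (rule odd)
        show "\<exists>N. np_good p \<alpha> \<beta> N \<and> real N \<le> Tow p (log 2 (\<beta> / \<epsilon>) + 20 * c2 * log 2 p * Z) (1 / \<epsilon>)"
          by (rule np_bound_middle[OF b h(1)]) (use h(2) in linarith)
      qed
    qed
    have 3: "\<exists>N. np_good p \<alpha> \<beta> N \<and> real N \<le> Tow p (20 * c2 * log 2 p * log 2 (log 2 (\<alpha> / \<beta>) / log 2 (\<alpha> ^ 3 / \<beta>))) (1 / \<beta>)"
      if b: "\<beta> \<le> 2 powr (- 8 - 8 * C p) * \<alpha> ^ 3"
    proof -
      note h = height_small[OF p2 C1 Cc \<alpha> \<beta> b low]
      show ?thesis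
      proof (cases "p = 2")
        case True
        have "0 \<le> 2 * C p * log 2 (log 2 (\<alpha> / \<beta>) / log 2 (\<alpha> ^ 3 / \<beta>))" using h(1) C1 by simp
        then have "20 * c2 * log 2 p * log 2 (log 2 (\<alpha> / \<beta>) / log 2 (\<alpha> ^ 3 / \<beta>)) > 0" using h(2) by linarith
        then show ?thesis using True x by (intro two) auto
      next
        case False
        then interpret popular_difference p "C p" \<alpha> \<epsilon> \<beta> by (rule odd)
        show ?thesis by (rule np_bound_small[OF b h(2) h(1)])
      qed
    qed
    show "let \<beta> = \<alpha> ^ 3 - \<epsilon> in
       (\<exists>N. np_good p \<alpha> \<beta> N) \<and>
       real (n_p p \<alpha> \<beta>) \<le> Tow p (log 2 ((\<alpha> - \<alpha> ^ 3) / \<epsilon>) + 5) (1 / \<epsilon>) \<and>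
       (2 powr (- 8 - 8 * C p) * \<alpha> ^ 3 < \<beta> \<and> \<beta> \<le> 2 powr (- 8 - 8 * C p) * \<alpha> \<longrightarrow>
          real (n_p p \<alpha> \<beta>) \<le>
            Tow p (log 2 (\<beta> / \<epsilon>) + 20 * c2 * log 2 p * log 2 (log p (\<alpha> / \<beta>))) (1 / \<epsilon>)) \<and>
       (\<beta> \<le> 2 powr (- 8 - 8 * C p) * \<alpha> ^ 3 \<longrightarrow>
          real (n_p p \<alpha> \<beta>) \<le>
            Tow p (20 * c2 * log 2 p * log 2 (log 2 (\<alpha> / \<beta>) / log 2 (\<alpha> ^ 3 / \<beta>))) (1 / \<beta>))"
      unfolding \<beta>_def[symmetric] Let_def
    proof (intro conjI impI)
      show "\<exists>N. np_good p \<alpha> \<beta> N" using 1 by blast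
      show "real (n_p p \<alpha> \<beta>) \<le> Tow p (log 2 ((\<alpha> - \<alpha> ^ 3) / \<epsilon>) + 5) (1 / \<epsilon>)"
        using 1 n_p_le by blast
    next
      assume "2 powr (- 8 - 8 * C p) * \<alpha> ^ 3 < \<beta> \<and> \<beta> \<le> 2 powr (- 8 - 8 * C p) * \<alpha>"
      then show "real (n_p p \<alpha> \<beta>) \<le> Tow p (log 2 (\<beta> / \<epsilon>) + 20 * c2 * log 2 p * log 2 (log p (\<alpha> / \<beta>))) (1 / \<epsilon>)"
        using 2 n_p_le by blast
    next
      assume "\<beta> \<le> 2 powr (- 8 - 8 * C p) * \<alpha> ^ 3"
      then show "real (n_p p \<alpha> \<beta>) \<le> Tow p (20 * c2 * log 2 p * log 2 (log 2 (\<alpha> / \<beta>) / log 2 (\<alpha> ^ 3 / \<beta>))) (1 / \<beta>)"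
        using 3 n_p_le by blast
    qed
  qed
qed

end
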